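(* Let $R=\bigoplus_{\alpha\in\Gamma}R_{\alpha}$ be a graded integral domain and let $\star$ be a semistar operation on $R$ such that $R^{\star}\subsetneq R_H$. Then the following statements are equivalent: (1) $R$ is a GP$\star$MD; (2) each homogeneously $(\star,t)$-linked overring of $R$ is a P$v$MD; (3) each homogeneously $(\star,d)$-linked overring of $R$ is a graded-Prüfer domain; (4) each homogeneously $(\star,t)$-linked overring of $R$ is integrally closed; (5) each homogeneously $(\star,d)$-linked overring of $R$ is integrally closed.
   Context: $\Gamma$ is a commutative cancellative monoid (written additively) whose quotient group $\langle\Gamma\rangle$ is torsion-free. A graded integral domain $R=\bigoplus_{\alpha\in\Gamma}R_\alpha$ is an integral domain that is the direct sum of additive subgroups $R_\alpha$ with $R_\alpha R_\beta\subseteq R_{\alpha+\beta}$. $K$ is its quotient field, $H$ the set of nonzero homogeneous elements, $R_H=\bigoplus_{\alpha\in\langle\Gamma\rangle}(R_H)_\alpha$ the homogeneous quotient field. A homogeneous overring of $R$ is a ring $T$ with $R\subseteq T\subseteq R_H$ and $T=\bigoplus_\alpha(T\cap(R_H)_\alpha)$ (a graded integral domain). A semistar operation on $R$ is a map $\star$ from the set of nonzero $R$-submodules of $K$ to itself such that for all $0\ne x\in K$ and $E,F$: $(xE)^\star=xE^\star$; $E\subseteq F\Rightarrow E^\star\subseteq F^\star$; $E\subseteq E^\star$; $(E^\star)^\star=E^\star$. $\star_f$: $E^{\star_f}=\bigcup\{F^\star: F\subseteq E$ nonzero finitely generated fractional ideal$\}$. A nonzero fractional ideal $I$ is $\star_f$-invertible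 if $(I(R:I))^{\star_f}=R^\star$, where $(R:I)=\{x\in K: xI\subseteq R\}$. $R$ is a GP$\star$MD if every nonzero finitely generated homogeneous ideal of $R$ is $\star_f$-invertible; a graded-Prüfer domain is one in which every nonzero finitely generated homogeneous ideal is invertible. On a domain $T$: $d$ is the identity operation, $v$ is $E\mapsto (T:(T:E))$, and $t=v_f$. A P$v$MD is a domain in which every nonzero finitely generated ideal is $t$-invertible. For a homogeneous overring $T$ of $R$ and a semistar operation $\star'$ on $T$, $T$ is a homogeneously $(\star,\star')$-linked overring of $R$ if for each nonzero homogeneous finitely generated ideal $F$ of $R$, $F^\star=R^\star$ implies $(FT)^{\star'}=T^{\star'}$. *)

theory Defs
  imports Main
begin

text \<open>The quotient field K of R is the whole type 'k (a field); the grading monoid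
  Gamma is a submonoid of an abelian group 'g (its Grothendieck group).\<close>

definition subring :: "'k::field set \<Rightarrow> bool" where
  "subring A \<longleftrightarrow> 0 \<in> A \<and> 1 \<in> A \<and>
     (\<forall>x\<in>A. \<forall>y\<in>A. x + y \<in> A \<and> x * y \<in> A \<and> - x \<in> A)"

definition prodm :: "'k::field set \<Rightarrow> 'k set \<Rightarrow> 'k set" where
  "prodm A B = {x. \<exists>(n::nat) f g. (\<forall>i<n. f i \<in> A \<and> g i \<in> B) \<and> x = (\<Sum>i<n. f i * g i)}"

definition submod :: "'k::field set \<Rightarrow> 'k set \<Rightarrow> bool" where
  "submod T E \<longleftrightarrow> 0 \<in> E \<and> (\<forall>x\<in>E. \<forall>y\<in>E. x + y \<in> E) \<and> (\<forall>a\<in>T. \<forall>x\<in>E. a * x \<in> E)"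

definition nz_submod :: "'k::field set \<Rightarrow> 'k set \<Rightarrow> bool" where
  "nz_submod T E \<longleftrightarrow> submod T E \<and> E \<noteq> {0}"

definition ideal_of :: "'k::field set \<Rightarrow> 'k set \<Rightarrow> bool" where
  "ideal_of T I \<longleftrightarrow> submod T I \<and> I \<subseteq> T"

definition fg :: "'k::field set \<Rightarrow> 'k set \<Rightarrow> bool" where
  "fg T E \<longleftrightarrow> (\<exists>S. finite S \<and> E = prodm T S)"

definition frac :: "'k::field set \<Rightarrow> 'k set \<Rightarrow> bool" where
  "frac T E \<longleftrightarrow> submod T E \<and> (\<exists>d. d \<noteq> 0 \<and> (\<lambda>y. d * y) ` E \<subseteq> T)"

definition semistar :: "'k::field set \<Rightarrow> ('k set \<Rightarrow> 'k set) \<Rightarrow> bool" where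
  "semistar T st \<longleftrightarrow>
     (\<forall>E. nz_submod T E \<longrightarrow> nz_submod T (st E)) \<and>
     (\<forall>x E. x \<noteq> 0 \<longrightarrow> nz_submod T E \<longrightarrow> st ((\<lambda>y. x * y) ` E) = (\<lambda>y. x * y) ` st E) \<and>
     (\<forall>E F. nz_submod T E \<longrightarrow> nz_submod T F \<longrightarrow> E \<subseteq> F \<longrightarrow> st E \<subseteq> st F) \<and>
     (\<forall>E. nz_submod T E \<longrightarrow> E \<subseteq> st E) \<and>
     (\<forall>E. nz_submod T E \<longrightarrow> st (st E) = st E)"

definition star_f :: "'k::field set \<Rightarrow> ('k set \<Rightarrow> 'k set) \<Rightarrow> 'k set \<Rightarrow> 'k set" where
  "star_f T st E = \<Union> {st F | F. F \<subseteq> E \<and> F \<noteq> {0} \<and> fg T F \<and> frac T F}"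

definition colon :: "'k::field set \<Rightarrow> 'k set \<Rightarrow> 'k set" where
  "colon T I = {x. \<forall>y\<in>I. x * y \<in> T}"

definition star_f_inv :: "'k::field set \<Rightarrow> ('k set \<Rightarrow> 'k set) \<Rightarrow> 'k set \<Rightarrow> bool" where
  "star_f_inv T st I \<longleftrightarrow> star_f T st (prodm I (colon T I)) = st T"

definition v_op :: "'k::field set \<Rightarrow> 'k set \<Rightarrow> 'k set" where
  "v_op T E = colon T (colon T E)"

definition t_op :: "'k::field set \<Rightarrow> 'k set \<Rightarrow> 'k set" where
  "t_op T = star_f T (v_op T)"

definition d_op :: "'k::field set \<Rightarrow> 'k set \<Rightarrow> 'k set" where
  "d_op T E = E"

definition grp :: "'g::ab_group_add set \<Rightarrow> 'g set" where
  "grp \<Gamma> = {a - b | a b. a \<in> \<Gamma> \<and> b \<in> \<Gamma>}"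

definition graded_domain :: "'g::ab_group_add set \<Rightarrow> ('g \<Rightarrow> 'k::field set) \<Rightarrow> 'k set \<Rightarrow> bool" where
  "graded_domain \<Gamma> G R \<longleftrightarrow>
     0 \<in> \<Gamma> \<and> (\<forall>a\<in>\<Gamma>. \<forall>b\<in>\<Gamma>. a + b \<in> \<Gamma>) \<and>
     (\<forall>x\<in>grp \<Gamma>. \<forall>n::nat. n > 0 \<longrightarrow> (\<Sum>i<n. x) = 0 \<longrightarrow> x = 0) \<and>
     subring R \<and> (\<forall>x. \<exists>a\<in>R. \<exists>b\<in>R. b \<noteq> 0 \<and> x = a / b) \<and>
     (\<forall>\<alpha>\<in>\<Gamma>. G \<alpha> \<subseteq> R \<and> 0 \<in> G \<alpha> \<and> (\<forall>x\<in>G \<alpha>. \<forall>y\<in>G \<alpha>. x - y \<in> G \<alpha>)) \<and>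
     (\<forall>\<alpha>\<in>\<Gamma>. \<forall>\<beta>\<in>\<Gamma>. \<forall>x\<in>G \<alpha>. \<forall>y\<in>G \<beta>. x * y \<in> G (\<alpha> + \<beta>)) \<and>
     (\<forall>x\<in>R. \<exists>F f. finite F \<and> F \<subseteq> \<Gamma> \<and> (\<forall>\<alpha>\<in>F. f \<alpha> \<in> G \<alpha>) \<and> x = (\<Sum>\<alpha>\<in>F. f \<alpha>)) \<and>
     (\<forall>F f. finite F \<longrightarrow> F \<subseteq> \<Gamma> \<longrightarrow> (\<forall>\<alpha>\<in>F. f \<alpha> \<in> G \<alpha>) \<longrightarrow>
        (\<Sum>\<alpha>\<in>F. f \<alpha>) = 0 \<longrightarrow> (\<forall>\<alpha>\<in>F. f \<alpha> = 0))"

definition homs :: "'g set \<Rightarrow> ('g \<Rightarrow> 'k::field set) \<Rightarrow> 'k set" where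
  "homs \<Gamma> G = {x. \<exists>\<alpha>\<in>\<Gamma>. x \<in> G \<alpha> \<and> x \<noteq> 0}"

definition RH :: "'g set \<Rightarrow> ('g \<Rightarrow> 'k::field set) \<Rightarrow> 'k set \<Rightarrow> 'k set" where
  "RH \<Gamma> G R = {a / h | a h. a \<in> R \<and> h \<in> homs \<Gamma> G}"

definition RHg :: "'g::ab_group_add set \<Rightarrow> ('g \<Rightarrow> 'k::field set) \<Rightarrow> 'g \<Rightarrow> 'k set" where
  "RHg \<Gamma> G \<alpha> = {a / h | a h \<beta> \<gamma>. \<beta> \<in> \<Gamma> \<and> \<gamma> \<in> \<Gamma> \<and> a \<in> G \<beta> \<and> h \<in> G \<gamma> \<and> h \<noteq> 0 \<and> \<alpha> = \<beta> - \<gamma>}"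

definition decomp :: "'g set \<Rightarrow> ('g \<Rightarrow> 'k::field set) \<Rightarrow> 'k set \<Rightarrow> bool" where
  "decomp I Gr E \<longleftrightarrow> (\<forall>x\<in>E. \<exists>F f. finite F \<and> F \<subseteq> I \<and>
      (\<forall>\<alpha>\<in>F. f \<alpha> \<in> E \<inter> Gr \<alpha>) \<and> x = (\<Sum>\<alpha>\<in>F. f \<alpha>))"

definition hom_overring :: "'g::ab_group_add set \<Rightarrow> ('g \<Rightarrow> 'k::field set) \<Rightarrow> 'k set \<Rightarrow> 'k set \<Rightarrow> bool" where
  "hom_overring \<Gamma> G R T \<longleftrightarrow> subring T \<and> R \<subseteq> T \<and> T \<subseteq> RH \<Gamma> G R \<and> decomp (grp \<Gamma>) (RHg \<Gamma> G) T"

definition GPstarMD :: "'g::ab_group_add set \<Rightarrow> ('g \<Rightarrow> 'k::field set) \<Rightarrow> 'k set \<Rightarrow> ('k set \<Rightarrow> 'k set) \<Rightarrow> bool" where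
  "GPstarMD \<Gamma> G R st \<longleftrightarrow> (\<forall>I. ideal_of R I \<and> I \<noteq> {0} \<and> fg R I \<and> decomp \<Gamma> G I \<longrightarrow> star_f_inv R st I)"

text \<open>Graded-Pruefer for a homogeneous overring T, graded by T \<inter> (R_H)_alpha.\<close>
definition graded_Prufer :: "'g::ab_group_add set \<Rightarrow> ('g \<Rightarrow> 'k::field set) \<Rightarrow> 'k set \<Rightarrow> bool" where
  "graded_Prufer \<Gamma> G T \<longleftrightarrow> (\<forall>I. ideal_of T I \<and> I \<noteq> {0} \<and> fg T I \<and> decomp (grp \<Gamma>) (RHg \<Gamma> G) I
       \<longrightarrow> prodm I (colon T I) = T)"

definition PvMD :: "'k::field set \<Rightarrow> bool" where
  "PvMD T \<longleftrightarrow> (\<forall>I. ideal_of T I \<and> I \<noteq> {0} \<and> fg T I \<longrightarrow> star_f_inv T (t_op T) I)"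

definition integrally_closed :: "'k::field set \<Rightarrow> bool" where
  "integrally_closed T \<longleftrightarrow> (\<forall>x. (\<exists>(n::nat) c. (\<forall>i<n. c i \<in> T) \<and> x ^ n + (\<Sum>i<n. c i * x ^ i) = 0) \<longrightarrow> x \<in> T)"

definition hlinked :: "'g::ab_group_add set \<Rightarrow> ('g \<Rightarrow> 'k::field set) \<Rightarrow> 'k set \<Rightarrow> ('k set \<Rightarrow> 'k set)
    \<Rightarrow> 'k set \<Rightarrow> ('k set \<Rightarrow> 'k set) \<Rightarrow> bool" where
  "hlinked \<Gamma> G R st T st' \<longleftrightarrow> hom_overring \<Gamma> G R T \<and>
     (\<forall>F. ideal_of R F \<and> F \<noteq> {0} \<and> fg R F \<and> decomp \<Gamma> G F \<and> st F = st R
        \<longrightarrow> st' (prodm F T) = st' T)"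

end

theory Submission
  imports Defs "HOL-Computational_Algebra.Polynomial"
begin

text \<open>A homogeneous overring T is a PvMD as soon as its finitely generated homogeneous ideals are t-invertible:
  by a form of Gauss' lemma the content of a product is controlled by t-invertibility, and modulo contents one may work in
  the homogeneous quotient field, where every finitely generated ideal is t-invertible. The latter holds because
  finitely many elements live over a free group of degrees of finite rank, and adding one free generator to the group
  reduces, again by Gauss' lemma, to Laurent polynomials in one variable over a field, a principal ideal domain.
  The star-invertibility of homogeneous ideals of R passes to t-invertibility (or invertibility) in linked overrings,
  and PvMDs are integrally closed.
  Conversely, if I (R : I) is not everything, enlarge it to a homogeneous ideal P maximal among those
  containing no finitely generated F with 1 in the star closure of F. Then P is prime on homogeneous elements, and every
  homogeneous overring of the homogeneous localization A of R at P is linked. If all of these are integrally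
  closed, then every homogeneous x lies in A[x^2], so x or its inverse lies in A, and I A is principal, which
  contradicts I (R : I) being contained in P.\<close>

section \<open>Submodules of a field\<close>

text \<open>t-invertibility of a finite set A is carried by a finite set B with A B inside T and (T
  : A B) inside T. This elementwise form survives scaling, splitting B into homogeneous components
  and enlarging the degree group; it also allows a factor from B to be introduced in Gauss' lemma
  and removed again.

  The degree group is never ordered. The leading pair of degrees in Gauss' lemma comes from a weaker
  property: for two finite sets of degrees, some sum is attained exactly once. It passes from free
  subgroups of finite rank to the whole group, because it concerns finite sets only.

  Gauss' lemma serves two gradings. One is the given grading, with T inside R_H. The other is by the
  powers of a homogeneous u whose degree is new, with the ring over the larger subgroup inside
  Laurent polynomials over a fraction field; there a homogeneous element is, up to a power of u, a
  fraction of elements over the smaller subgroup, where the induction hypothesis applies.\<close>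

lemma subringD:
  assumes "subring A"
  shows "0 \<in> A" "1 \<in> A" "x \<in> A \<Longrightarrow> y \<in> A \<Longrightarrow> x + y \<in> A" "x \<in> A \<Longrightarrow> y \<in> A \<Longrightarrow> x * y \<in> A"
    "x \<in> A \<Longrightarrow> - x \<in> A" "x \<in> A \<Longrightarrow> y \<in> A \<Longrightarrow> x - y \<in> A" "x \<in> A \<Longrightarrow> x ^ n \<in> A"
proof -
  show *: "0 \<in> A" "1 \<in> A" "x \<in> A \<Longrightarrow> y \<in> A \<Longrightarrow> x + y \<in> A" "x \<in> A \<Longrightarrow> y \<in> A \<Longrightarrow> x * y \<in> A"
    "x \<in> A \<Longrightarrow> - x \<in> A" for x y
    using assms unfolding subring_def by auto
  show "x \<in> A \<Longrightarrow> y \<in> A \<Longrightarrow> x - y \<in> A" using *(3)[of x "- y"] *(5)[of y] by simp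
  show "x \<in> A \<Longrightarrow> x ^ n \<in> A" by (induction n) (auto intro: *)
qed

lemma sum_closed:
  assumes "0 \<in> E" "\<And>x y. x \<in> E \<Longrightarrow> y \<in> E \<Longrightarrow> x + y \<in> E" "\<And>i. i \<in> I \<Longrightarrow> f i \<in> E"
  shows "(\<Sum>i\<in>I. f i) \<in> E"
  using assms(3) by (induction I rule: infinite_finite_induct) (auto intro: assms(1,2))

lemma prodm_mem: "a \<in> A \<Longrightarrow> b \<in> B \<Longrightarrow> a * b \<in> prodm A B"
  unfolding prodm_def
  by (intro CollectI exI[of _ "1::nat"] exI[of _ "\<lambda>_. a"] exI[of _ "\<lambda>_. b"]) auto

lemma prodm_0: "0 \<in> prodm A B"
  unfolding prodm_def by (auto intro!: exI[of _ "0::nat"])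

lemma prodm_add:
  assumes "x \<in> prodm A B" "y \<in> prodm A B"
  shows "x + y \<in> prodm A B"
proof -
  from assms obtain n m :: nat and f g f' g' where
    x: "\<forall>i<n. f i \<in> A \<and> g i \<in> B" "x = (\<Sum>i<n. f i * g i)" and
    y: "\<forall>i<m. f' i \<in> A \<and> g' i \<in> B" "y = (\<Sum>i<m. f' i * g' i)"
    unfolding prodm_def mem_Collect_eq by (elim exE conjE) (rule that; assumption)
  let ?F = "\<lambda>i. if i < n then f i else f' (i - n)"
  let ?G = "\<lambda>i. if i < n then g i else g' (i - n)"
  have "(\<Sum>i<n + m. ?F i * ?G i) = (\<Sum>i<n. ?F i * ?G i) + (\<Sum>i<m. ?F (n + i) * ?G (n + i))"
    by (induction m) (auto simp: algebra_simps)
  also have "\<dots> = x + y" unfolding x y by simp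
  finally have "x + y = (\<Sum>i<n + m. ?F i * ?G i)" ..
  moreover have "\<forall>i<n + m. ?F i \<in> A \<and> ?G i \<in> B" using x(1) y(1) by auto
  ultimately show ?thesis
    unfolding prodm_def by (intro CollectI exI[of _ "n + m"] exI[of _ ?F] exI[of _ ?G] conjI)
qed

lemma prodm_least:
  assumes "0 \<in> E" "\<And>x y. x \<in> E \<Longrightarrow> y \<in> E \<Longrightarrow> x + y \<in> E"
    "\<And>a b. a \<in> A \<Longrightarrow> b \<in> B \<Longrightarrow> a * b \<in> E"
  shows "prodm A B \<subseteq> E"
  unfolding prodm_def by (auto intro!: sum_closed assms(1,2) assms(3))

text \<open>Multiplication by a fixed \<open>c\<close> is additive, so a conductor condition on a
  product module has to be tested on the products \<open>a * b\<close> only.\<close>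

lemma prodm_mult_closed:
  assumes "x \<in> prodm A B" "\<And>a b. a \<in> A \<Longrightarrow> b \<in> B \<Longrightarrow> c * (a * b) \<in> E"
    "0 \<in> E" "\<And>x y. x \<in> E \<Longrightarrow> y \<in> E \<Longrightarrow> x + y \<in> E"
  shows "c * x \<in> E"
proof -
  have "prodm A B \<subseteq> {x. c * x \<in> E}"
    by (rule prodm_least) (auto simp: assms distrib_left)
  then show ?thesis using assms(1) by auto
qed

lemma prodm_commute: "prodm A B = prodm B (A :: 'k::field set)"
proof -
  have "prodm A B \<subseteq> prodm B A" for A B :: "'k set"
  proof (rule prodm_least)
    fix a b :: 'k assume "a \<in> A" "b \<in> B"
    then show "a * b \<in> prodm B A" by (subst mult.commute) (rule prodm_mem)
  qed (auto intro: prodm_0 prodm_add)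
  then show ?thesis by blast
qed

lemma prodm_mono: "A \<subseteq> A' \<Longrightarrow> B \<subseteq> B' \<Longrightarrow> prodm A B \<subseteq> prodm A' B'"
  by (rule prodm_least) (auto intro: prodm_0 prodm_add prodm_mem)

lemma submodD:
  assumes "submod T E"
  shows "0 \<in> E" "x \<in> E \<Longrightarrow> y \<in> E \<Longrightarrow> x + y \<in> E" "a \<in> T \<Longrightarrow> x \<in> E \<Longrightarrow> a * x \<in> E"
  using assms unfolding submod_def by auto

lemma subring_submod: "subring T \<Longrightarrow> submod T T"
  unfolding subring_def submod_def by auto

lemma submod_prodm:
  assumes "submod T A"
  shows "submod T (prodm A B)"
  unfolding submod_def
proof (intro conjI ballI)
  show "0 \<in> prodm A B" by (rule prodm_0)
  fix x y assume "x \<in> prodm A B" "y \<in> prodm A B"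
  then show "x + y \<in> prodm A B" by (rule prodm_add)
next
  fix a x assume "a \<in> T" "x \<in> prodm A B"
  then show "a * x \<in> prodm A B"
    by (intro prodm_mult_closed[of x A B]) (auto intro: prodm_0 prodm_add prodm_mem submodD[OF assms] simp flip: mult.assoc)
qed

lemma submod_span: "subring T \<Longrightarrow> submod T (prodm T B)"
  by (intro submod_prodm subring_submod)

lemma span_base: "subring T \<Longrightarrow> b \<in> B \<Longrightarrow> b \<in> prodm T B"
  using prodm_mem[of 1 T b B] subringD(2) by auto

lemma span_least: "submod T E \<Longrightarrow> B \<subseteq> E \<Longrightarrow> prodm T B \<subseteq> E"
  by (rule prodm_least) (auto simp: submod_def)

lemma colon_span: "subring T \<Longrightarrow> colon T (prodm T A) = colon T A"
proof
  assume T: "subring T"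
  show "colon T (prodm T A) \<subseteq> colon T A"
    unfolding colon_def using span_base[OF T] by auto
  show "colon T A \<subseteq> colon T (prodm T A)"
  proof
    fix x assume "x \<in> colon T A"
    then have "x * y \<in> T" if "y \<in> prodm T A" for y
      using that by (intro prodm_mult_closed[of y T A]) (auto simp: colon_def subringD[OF T] mult.left_commute)
    then show "x \<in> colon T (prodm T A)" by (simp add: colon_def)
  qed
qed

lemma prodm_colon_subset: "subring T \<Longrightarrow> prodm I (colon T I) \<subseteq> T"
  by (rule prodm_least) (auto simp: colon_def subringD mult.commute)

text \<open>Serves three ring extensions: Laurent polynomials in \<open>u\<close>, adjoining
  \<open>x ^ 2\<close>, and localization, where \<open>M\<close> consists of inverses of a
  multiplicative set.\<close>

lemma subring_span_monoid:
  assumes "subring T" "1 \<in> M" "\<And>x y. x \<in> M \<Longrightarrow> y \<in> M \<Longrightarrow> x * y \<in> M"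
  shows "subring (prodm T M)"
proof -
  note T = subringD[OF assms(1)] and M = submodD[OF submod_span[OF assms(1), of M]]
  have "x * y \<in> prodm T M" if x: "x \<in> prodm T M" and y: "y \<in> prodm T M" for x y
  proof (rule prodm_mult_closed[OF y _ M(1,2)])
    fix a b assume ab: "a \<in> T" "b \<in> M"
    have "(a * b) * x \<in> prodm T M"
    proof (rule prodm_mult_closed[OF x _ M(1,2)])
      fix c d assume "c \<in> T" "d \<in> M"
      then have "(a * c) * (b * d) \<in> prodm T M" using ab by (intro prodm_mem T assms)
      then show "a * b * (c * d) \<in> prodm T M" by (simp add: ac_simps)
    qed
    then show "x * (a * b) \<in> prodm T M" by (simp add: ac_simps)
  qed
  moreover have "- x \<in> prodm T M" if "x \<in> prodm T M" for x
    using M(3)[of "- 1" x] that T by simp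
  ultimately show ?thesis
    unfolding subring_def using M span_base[OF assms(1,2)] by auto
qed

lemma span_subset_ring: "subring T \<Longrightarrow> T \<subseteq> prodm T M" if "1 \<in> M"
  using prodm_mem[of _ T 1 M] that by auto

text \<open>For a finite set A with a nonzero element, this says that the T-module generated by A is
  t-invertible; the witness B generates a submodule of the inverse.\<close>

definition t_inv :: "'k::field set \<Rightarrow> 'k set \<Rightarrow> bool" where
  "t_inv T A \<longleftrightarrow> (\<exists>B. finite B \<and> (\<exists>b\<in>B. b \<noteq> 0) \<and> (\<forall>a\<in>A. \<forall>b\<in>B. a * b \<in> T) \<and>
      (\<forall>x. (\<forall>a\<in>A. \<forall>b\<in>B. x * (a * b) \<in> T) \<longrightarrow> x \<in> T))"

lemma t_invI:
  assumes "finite B" "b \<in> B" "b \<noteq> 0" "\<And>a b. a \<in> A \<Longrightarrow> b \<in> B \<Longrightarrow> a * b \<in> T"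
    "\<And>x. (\<And>a b. a \<in> A \<Longrightarrow> b \<in> B \<Longrightarrow> x * (a * b) \<in> T) \<Longrightarrow> x \<in> T"
  shows "t_inv T A"
  unfolding t_inv_def using assms by (intro exI[of _ B]) auto

lemma t_invE:
  assumes "t_inv T A"
  obtains B b where "finite B" "b \<in> B" "b \<noteq> 0" "\<forall>a\<in>A. \<forall>b\<in>B. a * b \<in> T"
    "\<forall>x. (\<forall>a\<in>A. \<forall>b\<in>B. x * (a * b) \<in> T) \<longrightarrow> x \<in> T"
  using assms unfolding t_inv_def by metis

text \<open>The last two hypotheses make \<open>A\<close> and the multiple of \<open>A'\<close> by
  \<open>d\<close> generate the same T-module. The inverse of \<open>A'\<close> is therefore
  \<open>d\<close> times that of \<open>A\<close>, and the witness is scaled by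
  \<open>d\<close>.\<close>

lemma t_inv_rescale:
  assumes "t_inv T A" "subring T" "d \<noteq> 0"
    "\<And>a. a \<in> A \<Longrightarrow> \<exists>t\<in>T. \<exists>a'\<in>A'. a = t * (a' * d)"
    "\<And>a'. a' \<in> A' \<Longrightarrow> \<exists>t\<in>T. \<exists>a\<in>A. a' * d = t * a"
  shows "t_inv T A'"
proof -
  obtain B b where B: "finite B" "b \<in> B" "b \<noteq> 0" "\<forall>a\<in>A. \<forall>b\<in>B. a * b \<in> T"
    "\<forall>x. (\<forall>a\<in>A. \<forall>b\<in>B. x * (a * b) \<in> T) \<longrightarrow> x \<in> T"
    using t_invE[OF assms(1)] .
  show ?thesis
  proof (rule t_invI[of "(*) d ` B" "d * b"])
    fix a' b' assume "a' \<in> A'" "b' \<in> (*) d ` B"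
    then obtain b t a where *: "b \<in> B" "b' = d * b" "t \<in> T" "a \<in> A" "a' * d = t * a"
      using assms(5)[of a'] by auto
    have "a' * b' = (a' * d) * b" unfolding *(2) by (rule mult.assoc[symmetric])
    also have "\<dots> = t * (a * b)" unfolding *(5) by (rule mult.assoc)
    finally show "a' * b' \<in> T" using * B(4) subringD(4)[OF assms(2)] by metis
  next
    fix x assume x: "\<And>a b. a \<in> A' \<Longrightarrow> b \<in> (*) d ` B \<Longrightarrow> x * (a * b) \<in> T"
    show "x \<in> T"
    proof (rule B(5)[rule_format])
      fix a b assume "a \<in> A" and b: "b \<in> B"
      then obtain t a' where *: "t \<in> T" "a' \<in> A'" "a = t * (a' * d)" using assms(4) by blast
      have "x * (a * b) = t * (x * (a' * (d * b)))" using * by (simp add: ac_simps)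
      moreover have "x * (a' * (d * b)) \<in> T" using * x b by auto
      ultimately show "x * (a * b) \<in> T" using *(1) subringD(4)[OF assms(2)] by metis
    qed
  qed (use B assms in auto)
qed

section \<open>Graded rings in which all homogeneous elements are invertible\<close>

text \<open>The unique product property, written additively. The pair (a, b) plays the role that the
  two leading degrees would have under a group order.\<close>

definition unique_sums :: "'g::ab_group_add set \<Rightarrow> bool" where
  "unique_sums D \<longleftrightarrow> (\<forall>A B. finite A \<longrightarrow> A \<noteq> {} \<longrightarrow> A \<subseteq> D \<longrightarrow> finite B \<longrightarrow> B \<noteq> {} \<longrightarrow> B \<subseteq> D \<longrightarrow>
     (\<exists>a\<in>A. \<exists>b\<in>B. \<forall>a'\<in>A. \<forall>b'\<in>B. a' + b' = a + b \<longrightarrow> a' = a \<and> b' = b))"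

text \<open>The components sit inside an ambient field and are indexed by the whole type; degrees
  that do not occur have component {0}. Since \<open>inverse 0 = 0\<close>, closure under inverses
  can be stated without excluding zero.\<close>

locale graded_field =
  fixes U :: "'g::ab_group_add \<Rightarrow> 'k::field set"
  assumes U_0: "0 \<in> U \<alpha>"
    and U_diff: "x \<in> U \<alpha> \<Longrightarrow> y \<in> U \<alpha> \<Longrightarrow> x - y \<in> U \<alpha>"
    and U_mult: "x \<in> U \<alpha> \<Longrightarrow> y \<in> U \<beta> \<Longrightarrow> x * y \<in> U (\<alpha> + \<beta>)"
    and U_1: "1 \<in> U 0"
    and U_inverse: "x \<in> U \<alpha> \<Longrightarrow> inverse x \<in> U (- \<alpha>)"
    and U_indep: "finite F \<Longrightarrow> (\<And>\<alpha>. \<alpha> \<in> F \<Longrightarrow> f \<alpha> \<in> U \<alpha>) \<Longrightarrow> (\<Sum>\<alpha>\<in>F. f \<alpha>) = 0 \<Longrightarrow> \<alpha> \<in> F \<Longrightarrow> f \<alpha> = 0"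
begin

definition tot :: "'k set" where
  "tot = {x. \<exists>F f. finite F \<and> (\<forall>\<alpha>\<in>F. f \<alpha> \<in> U \<alpha>) \<and> x = (\<Sum>\<alpha>\<in>F. f \<alpha>)}"

text \<open>For \<open>x\<close> in \<open>tot\<close> the choice is forced, as
  \<open>comp_unique\<close> shows from independence of the components.\<close>

definition comp :: "'k \<Rightarrow> 'g \<Rightarrow> 'k" where
  "comp x = (SOME c. finite {\<alpha>. c \<alpha> \<noteq> 0} \<and> (\<forall>\<alpha>. c \<alpha> \<in> U \<alpha>) \<and> x = (\<Sum>\<alpha> | c \<alpha> \<noteq> 0. c \<alpha>))"

definition supp :: "'k \<Rightarrow> 'g set" where
  "supp x = {\<alpha>. comp x \<alpha> \<noteq> 0}"

text \<open>For an additive subgroup this says that it is the sum of its intersections with the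
  components. It replaces the existential predicate \<open>decomp\<close>, see
  \<open>decomp_R_iff\<close> and \<open>decomp_RH_iff\<close>.\<close>

definition homog :: "'k set \<Rightarrow> bool" where
  "homog E \<longleftrightarrow> (\<forall>x\<in>E. x \<in> tot \<and> (\<forall>\<alpha>. comp x \<alpha> \<in> E))"

lemma U_minus: "x \<in> U \<alpha> \<Longrightarrow> - x \<in> U \<alpha>"
  using U_diff[of 0 \<alpha> x] U_0 by simp

lemma U_add: "x \<in> U \<alpha> \<Longrightarrow> y \<in> U \<alpha> \<Longrightarrow> x + y \<in> U \<alpha>"
  using U_diff[of x \<alpha> "- y"] U_minus by simp

lemma U_power: "x \<in> U \<alpha> \<Longrightarrow> \<exists>\<beta>. x ^ n \<in> U \<beta>"
proof (induction n)
  case 0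
  then show ?case using U_1 by auto
next
  case (Suc n)
  then obtain \<beta> where "x ^ n \<in> U \<beta>" by auto
  then show ?case using U_mult[OF Suc(2)] Suc by auto
qed

lemma comp_spec:
  assumes "x \<in> tot"
  shows "finite (supp x)" "comp x \<alpha> \<in> U \<alpha>" "(\<Sum>\<alpha>\<in>supp x. comp x \<alpha>) = x"
proof -
  obtain F f where F: "finite F" "\<And>\<alpha>. \<alpha> \<in> F \<Longrightarrow> f \<alpha> \<in> U \<alpha>" "x = (\<Sum>\<alpha>\<in>F. f \<alpha>)"
    using assms unfolding tot_def by auto
  let ?c = "\<lambda>\<alpha>. if \<alpha> \<in> F then f \<alpha> else 0"
  have "(\<Sum>\<alpha> | ?c \<alpha> \<noteq> 0. ?c \<alpha>) = (\<Sum>\<alpha>\<in>F. ?c \<alpha>)"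
    by (rule sum.mono_neutral_left) (use F in auto)
  then have "x = (\<Sum>\<alpha> | ?c \<alpha> \<noteq> 0. ?c \<alpha>)" using F(3) by simp
  moreover have "finite {\<alpha>. ?c \<alpha> \<noteq> 0}" by (rule finite_subset[OF _ F(1)]) auto
  ultimately have "\<exists>c. finite {\<alpha>. c \<alpha> \<noteq> 0} \<and> (\<forall>\<alpha>. c \<alpha> \<in> U \<alpha>) \<and> x = (\<Sum>\<alpha> | c \<alpha> \<noteq> 0. c \<alpha>)"
    using F(2) U_0 by (intro exI[of _ ?c]) auto
  from someI_ex[OF this] show "finite (supp x)" "comp x \<alpha> \<in> U \<alpha>" "(\<Sum>\<alpha>\<in>supp x. comp x \<alpha>) = x"
    unfolding comp_def[symmetric] supp_def[symmetric] by auto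
qed

lemma tot_sumI:
  assumes "finite F" "\<And>\<alpha>. \<alpha> \<in> F \<Longrightarrow> f \<alpha> \<in> U \<alpha>"
  shows "(\<Sum>\<alpha>\<in>F. f \<alpha>) \<in> tot"
  unfolding tot_def using assms by auto

lemma comp_unique:
  assumes "finite F" "\<And>\<alpha>. c \<alpha> \<in> U \<alpha>" "\<And>\<alpha>. \<alpha> \<notin> F \<Longrightarrow> c \<alpha> = 0" "x = (\<Sum>\<alpha>\<in>F. c \<alpha>)"
  shows "x \<in> tot" "comp x = c"
proof -
  show x: "x \<in> tot" using tot_sumI[OF assms(1,2)] assms(4) by simp
  let ?F = "F \<union> supp x"
  have fin: "finite ?F" using comp_spec(1)[OF x] assms(1) by simp
  have "(\<Sum>\<alpha>\<in>?F. comp x \<alpha>) = (\<Sum>\<alpha>\<in>supp x. comp x \<alpha>)"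
    by (rule sum.mono_neutral_right[OF fin]) (auto simp: supp_def)
  then have "(\<Sum>\<alpha>\<in>?F. comp x \<alpha>) = x" using comp_spec(3)[OF x] by (rule trans)
  moreover have "(\<Sum>\<alpha>\<in>?F. c \<alpha>) = x"
    using sum.mono_neutral_right[OF fin, of F c] assms(3,4) by auto
  ultimately have "(\<Sum>\<alpha>\<in>?F. comp x \<alpha> - c \<alpha>) = 0" by (simp add: sum_subtractf)
  then have "\<alpha> \<in> ?F \<Longrightarrow> comp x \<alpha> - c \<alpha> = 0" for \<alpha>
    using U_indep[OF fin, of "\<lambda>\<alpha>. comp x \<alpha> - c \<alpha>"] comp_spec(2)[OF x] assms(2) U_diff by blast
  moreover have "\<alpha> \<notin> ?F \<Longrightarrow> comp x \<alpha> = c \<alpha>" for \<alpha> using assms(3) by (auto simp: supp_def)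
  ultimately show "comp x = c" by (metis eq_iff_diff_eq_0 ext)
qed

lemma comp_sum_superset: "x \<in> tot \<Longrightarrow> finite F \<Longrightarrow> supp x \<subseteq> F \<Longrightarrow> (\<Sum>\<alpha>\<in>F. comp x \<alpha>) = x"
  by (rule trans[OF sum.mono_neutral_right comp_spec(3)]) (auto simp: supp_def)

lemma comp_hom:
  assumes "x \<in> U \<alpha>"
  shows "x \<in> tot" "comp x = (\<lambda>\<beta>. if \<beta> = \<alpha> then x else 0)"
  using comp_unique[of "{\<alpha>}" "\<lambda>\<beta>. if \<beta> = \<alpha> then x else 0" x] assms U_0 by auto

lemma tot_0: "0 \<in> tot" and comp_0: "comp 0 \<alpha> = 0"
  using comp_hom[OF U_0[of 0]] by auto

lemma comp_diff:
  assumes "x \<in> tot" "y \<in> tot"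
  shows "x - y \<in> tot" "comp (x - y) \<alpha> = comp x \<alpha> - comp y \<alpha>"
proof -
  let ?F = "supp x \<union> supp y"
  have fin: "finite ?F" using comp_spec(1) assms by simp
  have "x - y = (\<Sum>\<alpha>\<in>?F. comp x \<alpha> - comp y \<alpha>)"
    using comp_sum_superset[OF assms(1) fin] comp_sum_superset[OF assms(2) fin] by (simp add: sum_subtractf)
  from comp_unique[OF fin _ _ this] show "x - y \<in> tot" "comp (x - y) \<alpha> = comp x \<alpha> - comp y \<alpha>"
    using comp_spec(2) assms U_diff by (auto simp: supp_def)
qed

lemma comp_minus:
  assumes "x \<in> tot"
  shows "- x \<in> tot" "comp (- x) \<alpha> = - comp x \<alpha>"
  using comp_diff[OF tot_0 assms] comp_0 by auto

lemma comp_add: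
  assumes "x \<in> tot" "y \<in> tot"
  shows "x + y \<in> tot" "comp (x + y) \<alpha> = comp x \<alpha> + comp y \<alpha>"
  using comp_diff[OF assms(1) comp_minus(1)[OF assms(2)]] comp_minus(2)[OF assms(2)] by auto

lemma comp_sum:
  assumes "\<And>i. i \<in> I \<Longrightarrow> f i \<in> tot"
  shows "(\<Sum>i\<in>I. f i) \<in> tot \<and> comp (\<Sum>i\<in>I. f i) \<alpha> = (\<Sum>i\<in>I. comp (f i) \<alpha>)"
  using assms by (induction I rule: infinite_finite_induct) (auto simp: tot_0 comp_0 comp_add)

lemma comp_hmult:
  assumes "y \<in> U \<alpha>" "x \<in> tot"
  shows "y * x \<in> tot" "comp (y * x) \<beta> = y * comp x (\<beta> - \<alpha>)"
proof -
  let ?F = "(\<lambda>\<beta>. \<alpha> + \<beta>) ` supp x"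
  have "(\<Sum>\<beta>\<in>?F. y * comp x (\<beta> - \<alpha>)) = (\<Sum>\<beta>\<in>supp x. y * comp x \<beta>)"
    by (subst sum.reindex) (auto simp: inj_on_def)
  also have "\<dots> = y * x"
    unfolding sum_distrib_left[symmetric] using comp_spec(3)[OF assms(2)] by (rule arg_cong)
  finally have s: "y * x = (\<Sum>\<beta>\<in>?F. y * comp x (\<beta> - \<alpha>))" ..
  have "y * comp x (\<beta> - \<alpha>) \<in> U \<beta>" for \<beta>
    using U_mult[OF assms(1) comp_spec(2)[OF assms(2), of "\<beta> - \<alpha>"]] by simp
  moreover have "\<beta> \<notin> ?F \<Longrightarrow> y * comp x (\<beta> - \<alpha>) = 0" for \<beta>
    using imageI[of "\<beta> - \<alpha>" "supp x" "(+) \<alpha>"] by (auto simp: supp_def)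
  ultimately show "y * x \<in> tot" "comp (y * x) \<beta> = y * comp x (\<beta> - \<alpha>)"
    using comp_unique[OF _ _ _ s] comp_spec(1)[OF assms(2)] by auto
qed

lemma comp_mult:
  assumes "x \<in> tot" "y \<in> tot"
  shows "x * y \<in> tot" "comp (x * y) \<beta> = (\<Sum>\<alpha>\<in>supp x. comp x \<alpha> * comp y (\<beta> - \<alpha>))"
proof -
  have "x * y = (\<Sum>\<alpha>\<in>supp x. comp x \<alpha> * y)"
    using comp_spec(3)[OF assms(1)] by (simp flip: sum_distrib_right)
  then show "x * y \<in> tot" "comp (x * y) \<beta> = (\<Sum>\<alpha>\<in>supp x. comp x \<alpha> * comp y (\<beta> - \<alpha>))"
    using comp_sum[of "supp x" "\<lambda>\<alpha>. comp x \<alpha> * y" \<beta>] comp_hmult[OF comp_spec(2)[OF assms(1)] assms(2)] by auto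
qed

lemma subring_tot: "subring tot"
  unfolding subring_def using tot_0 comp_hom(1)[OF U_1] comp_add(1) comp_mult(1) comp_minus(1) by auto

lemma supp_empty: "x \<in> tot \<Longrightarrow> supp x = {} \<longleftrightarrow> x = 0"
  using comp_spec(3)[of x] by (auto simp: supp_def comp_0)

lemma homogI:
  assumes "\<And>x. x \<in> E \<Longrightarrow> \<exists>F f. finite F \<and> (\<forall>\<alpha>\<in>F. f \<alpha> \<in> E \<inter> U \<alpha>) \<and> x = (\<Sum>\<alpha>\<in>F. f \<alpha>)" "0 \<in> E"
  shows "homog E"
  unfolding homog_def
proof
  fix x assume "x \<in> E"
  from assms(1)[OF this] obtain F f where
    F: "finite F" "\<And>\<alpha>. \<alpha> \<in> F \<Longrightarrow> f \<alpha> \<in> E \<inter> U \<alpha>" "x = (\<Sum>\<alpha>\<in>F. f \<alpha>)" by auto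
  have "x \<in> tot \<and> comp x = (\<lambda>\<alpha>. if \<alpha> \<in> F then f \<alpha> else 0)"
    using comp_unique[OF F(1), of "\<lambda>\<alpha>. if \<alpha> \<in> F then f \<alpha> else 0" x] F U_0 by auto
  then show "x \<in> tot \<and> (\<forall>\<alpha>. comp x \<alpha> \<in> E)" using F assms(2) by auto
qed

lemma homog_prodm:
  assumes "homog A" "homog B"
  shows "homog (prodm A B)"
proof -
  have "prodm A B \<subseteq> {x \<in> tot. \<forall>\<alpha>. comp x \<alpha> \<in> prodm A B}"
  proof (rule prodm_least)
    fix a b assume "a \<in> A" "b \<in> B"
    then have ab: "a \<in> tot" "b \<in> tot" "\<And>\<alpha>. comp a \<alpha> \<in> A" "\<And>\<alpha>. comp b \<alpha> \<in> B"
      using assms unfolding homog_def by auto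
    show "a * b \<in> {x \<in> tot. \<forall>\<alpha>. comp x \<alpha> \<in> prodm A B}"
      using comp_mult[OF ab(1,2)] ab by (auto intro!: sum_closed prodm_0 prodm_add prodm_mem)
  qed (auto simp: tot_0 comp_0 comp_add prodm_0 prodm_add)
  then show ?thesis unfolding homog_def by auto
qed

text \<open>Complements \<open>homog_prodm\<close>: a set of homogeneous generators need not contain
  0, and so need not satisfy \<open>homog\<close> itself.\<close>

lemma homog_span:
  assumes "homog T" "0 \<in> T" "\<And>b. b \<in> B \<Longrightarrow> \<exists>\<alpha>. b \<in> U \<alpha>"
  shows "homog (prodm T B)"
proof -
  have "prodm T B \<subseteq> {x \<in> tot. \<forall>\<alpha>. comp x \<alpha> \<in> prodm T B}"
  proof (rule prodm_least)
    fix a b assume ab: "a \<in> T" "b \<in> B"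
    then obtain \<beta> where b: "b \<in> U \<beta>" using assms by auto
    have "a \<in> tot" "\<And>\<alpha>. comp a \<alpha> \<in> T" using assms ab unfolding homog_def by auto
    then show "a * b \<in> {x \<in> tot. \<forall>\<alpha>. comp x \<alpha> \<in> prodm T B}"
      using comp_hmult[OF b] prodm_mem[of _ T b B] ab by (auto simp: mult.commute[of a b]) (metis mult.commute)
  qed (auto simp: tot_0 comp_0 comp_add prodm_0 prodm_add)
  then show ?thesis unfolding homog_def by auto
qed

text \<open>Some nonzero component of \<open>h\<close> is a homogeneous unit of \<open>tot\<close>
  lying in \<open>E\<close>, and this forces \<open>x\<close> into \<open>tot\<close>. Multiplying
  \<open>x\<close> by the components of elements of \<open>E\<close>, one at a time, merely shifts
  degrees and so separates the components of \<open>x\<close>.\<close>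

lemma homog_colon:
  assumes "homog T" "subring T" "homog E" "h \<in> E" "h \<noteq> 0"
  shows "homog (colon T E)"
  unfolding homog_def
proof (intro ballI)
  fix x assume x: "x \<in> colon T E"
  have "supp h \<noteq> {}" using assms supp_empty unfolding homog_def by auto
  then obtain \<alpha> where a: "comp h \<alpha> \<noteq> 0" "comp h \<alpha> \<in> E" "comp h \<alpha> \<in> U \<alpha>"
    using assms(3,4) comp_spec(2)[of h] unfolding homog_def supp_def by blast
  then have "x * comp h \<alpha> \<in> T" using x unfolding colon_def by auto
  then have "inverse (comp h \<alpha>) * (x * comp h \<alpha>) \<in> tot"
    using comp_hmult(1)[OF U_inverse[OF a(3)]] assms(1) unfolding homog_def by auto
  then have xt: "x \<in> tot" using a(1) by (simp add: field_simps)
  have "comp x \<beta> * y \<in> T" if y: "y \<in> E" for y \<beta>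
  proof -
    have "comp y \<gamma> * comp x \<beta> \<in> T" for \<gamma>
    proof -
      have c: "comp y \<gamma> \<in> U \<gamma>" "comp y \<gamma> \<in> E"
        using assms(3) y comp_spec(2) unfolding homog_def by auto
      have "comp y \<gamma> * x \<in> T" using x c unfolding colon_def by (auto simp: mult.commute)
      then have "comp (comp y \<gamma> * x) (\<beta> + \<gamma>) \<in> T" using assms(1) unfolding homog_def by auto
      then show ?thesis using comp_hmult(2)[OF c(1) xt] by simp
    qed
    then have "(\<Sum>\<gamma>\<in>supp y. comp y \<gamma> * comp x \<beta>) \<in> T"
      by (intro sum_closed) (auto simp: subringD[OF assms(2)])
    moreover have "(\<Sum>\<gamma>\<in>supp y. comp y \<gamma>) = y"
      using comp_spec(3)[of y] y assms(3) unfolding homog_def by auto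
    ultimately show ?thesis by (metis mult.commute sum_distrib_right)
  qed
  then show "x \<in> tot \<and> (\<forall>\<alpha>. comp x \<alpha> \<in> colon T E)" using xt unfolding colon_def by auto
qed

end

definition subgr :: "'g::ab_group_add set \<Rightarrow> bool" where
  "subgr N \<longleftrightarrow> 0 \<in> N \<and> (\<forall>x\<in>N. \<forall>y\<in>N. x - y \<in> N)"

lemma subgrD:
  assumes "subgr N"
  shows "0 \<in> N" "x \<in> N \<Longrightarrow> y \<in> N \<Longrightarrow> x - y \<in> N" "x \<in> N \<Longrightarrow> - x \<in> N" "x \<in> N \<Longrightarrow> y \<in> N \<Longrightarrow> x + y \<in> N"
proof -
  show *: "0 \<in> N" "x \<in> N \<Longrightarrow> y \<in> N \<Longrightarrow> x - y \<in> N" for x y using assms unfolding subgr_def by auto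
  show **: "x \<in> N \<Longrightarrow> - x \<in> N" for x using *(2)[of 0 x] *(1) by simp
  show "x \<in> N \<Longrightarrow> y \<in> N \<Longrightarrow> x + y \<in> N" using *(2)[of x "- y"] **[of y] by simp
qed

section \<open>From homogeneous to arbitrary finitely generated ideals\<close>

context graded_field
begin

lemma supp_hmult:
  assumes "y \<in> U \<alpha>" "x \<in> tot"
  shows "card (supp (y * x)) \<le> card (supp x)"
proof -
  have "supp (y * x) \<subseteq> (+) \<alpha> ` supp x"
  proof
    fix \<beta> assume "\<beta> \<in> supp (y * x)"
    then have "\<beta> - \<alpha> \<in> supp x" using comp_hmult(2)[OF assms] by (auto simp: supp_def)
    from imageI[OF this, of "(+) \<alpha>"] show "\<beta> \<in> (+) \<alpha> ` supp x" by simp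
  qed
  then have "card (supp (y * x)) \<le> card ((+) \<alpha> ` supp x)"
    using comp_spec(1)[OF assms(2)] by (intro card_mono) auto
  also have "\<dots> \<le> card (supp x)" using comp_spec(1)[OF assms(2)] by (rule card_image_le)
  finally show ?thesis .
qed

lemma supp_remove:
  assumes "x \<in> tot" "\<alpha> \<in> supp x"
  shows "x - comp x \<alpha> \<in> tot" "comp (x - comp x \<alpha>) \<beta> = (if \<beta> = \<alpha> then 0 else comp x \<beta>)"
    "card (supp (x - comp x \<alpha>)) < card (supp x)"
proof -
  note h = comp_hom[OF comp_spec(2)[OF assms(1), of \<alpha>]]
  show "x - comp x \<alpha> \<in> tot" using comp_diff(1)[OF assms(1) h(1)] .
  have c: "comp (x - comp x \<alpha>) \<beta> = (if \<beta> = \<alpha> then 0 else comp x \<beta>)" for \<beta>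
    using comp_diff(2)[OF assms(1) h(1), of \<beta>] by (simp add: h(2))
  show "comp (x - comp x \<alpha>) \<beta> = (if \<beta> = \<alpha> then 0 else comp x \<beta>)" by (rule c)
  have "supp (x - comp x \<alpha>) \<subset> supp x" using assms(2) by (auto simp: supp_def c split: if_splits)
  then show "card (supp (x - comp x \<alpha>)) < card (supp x)"
    by (rule psubset_card_mono[OF comp_spec(1)[OF assms(1)]])
qed

lemma homog_mult_tot:
  assumes "homog T" "c \<in> U \<alpha>" "c \<noteq> 0" "b * c \<in> T"
  shows "b \<in> tot" "comp b \<beta> * c \<in> T"
proof -
  have "inverse c * (b * c) \<in> tot"
    using comp_hmult(1)[OF U_inverse[OF assms(2)]] assms unfolding homog_def by auto
  moreover have "inverse c * (b * c) = b" using assms(3) by (simp add: field_simps)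
  ultimately show b: "b \<in> tot" by simp
  have "comp (c * b) (\<beta> + \<alpha>) \<in> T"
    using assms unfolding homog_def by (auto simp: mult.commute[of c b])
  then show "comp b \<beta> * c \<in> T" using comp_hmult(2)[OF assms(2) b, of "\<beta> + \<alpha>"] by (simp add: mult.commute)
qed

text \<open>Multiplication by a homogeneous \<open>a\<close> shifts degrees, so if
  \<open>a * b\<close> lies in the homogeneous ring T, so do the products of \<open>a\<close> with
  the components of \<open>b\<close>. All components of a witness together therefore form a
  homogeneous witness.\<close>

lemma t_inv_homogE:
  assumes "t_inv T C" "homog T" "subring T" "C \<noteq> {}" "\<forall>c\<in>C. c \<noteq> 0 \<and> (\<exists>\<alpha>. c \<in> U \<alpha>)"
  obtains B b where "finite B" "b \<in> B" "b \<noteq> 0" "\<forall>b\<in>B. \<exists>\<alpha>. b \<in> U \<alpha>" "\<forall>a\<in>C. \<forall>b\<in>B. a * b \<in> T"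
    "\<forall>x. (\<forall>a\<in>C. \<forall>b\<in>B. x * (a * b) \<in> T) \<longrightarrow> x \<in> T"
proof -
  obtain B b where B: "finite B" "b \<in> B" "b \<noteq> 0" "\<forall>a\<in>C. \<forall>b\<in>B. a * b \<in> T"
    "\<forall>x. (\<forall>a\<in>C. \<forall>b\<in>B. x * (a * b) \<in> T) \<longrightarrow> x \<in> T"
    using t_invE[OF assms(1)] .
  obtain c where c: "c \<in> C" using assms(4) by auto
  then obtain \<gamma> where "c \<in> U \<gamma>" "c \<noteq> 0" using assms(5) by auto
  note Bt' = homog_mult_tot(1)[OF assms(2) this]
  have Bt: "b \<in> tot" if "b \<in> B" for b
    using Bt'[of b] B(4) that c by (auto simp: mult.commute)
  let ?B = "\<Union>b\<in>B. comp b ` supp b"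
  have "supp b \<noteq> {}" using supp_empty[OF Bt[OF B(2)]] B(3) by simp
  then obtain \<alpha> where "\<alpha> \<in> supp b" by auto
  then have *: "comp b \<alpha> \<in> ?B" "comp b \<alpha> \<noteq> 0" using B(2) by (auto simp: supp_def)
  show ?thesis
  proof (rule that[of ?B "comp b \<alpha>", OF _ *])
    show "finite ?B" using B(1) Bt comp_spec(1) by auto
    show "\<forall>b\<in>?B. \<exists>\<alpha>. b \<in> U \<alpha>" using Bt comp_spec(2) by auto
    show "\<forall>a\<in>C. \<forall>b\<in>?B. a * b \<in> T"
    proof (intro ballI)
      fix a b' assume a: "a \<in> C" and "b' \<in> ?B"
      then obtain b \<beta> where b: "b \<in> B" "b' = comp b \<beta>" by auto
      obtain \<alpha> where "a \<in> U \<alpha>" "a \<noteq> 0" using a assms(5) by auto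
      from homog_mult_tot(2)[OF assms(2) this, of b \<beta>] show "a * b' \<in> T"
        using a b B(4) by (simp add: mult.commute)
    qed
    show "\<forall>x. (\<forall>a\<in>C. \<forall>b\<in>?B. x * (a * b) \<in> T) \<longrightarrow> x \<in> T"
    proof (intro allI impI)
      fix x assume x: "\<forall>a\<in>C. \<forall>b\<in>?B. x * (a * b) \<in> T"
      show "x \<in> T"
      proof (rule B(5)[rule_format])
        fix a b assume a: "a \<in> C" and b: "b \<in> B"
        have "(\<Sum>\<beta>\<in>supp b. x * (a * comp b \<beta>)) \<in> T"
          by (rule sum_closed) (use a b x subringD[OF assms(3)] in auto)
        also have "(\<Sum>\<beta>\<in>supp b. x * (a * comp b \<beta>)) = x * (a * b)"
          unfolding sum_distrib_left[symmetric] comp_spec(3)[OF Bt[OF b]] ..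
        finally show "x * (a * b) \<in> T" .
      qed
    qed
  qed
qed

text \<open>A form of Gauss' lemma: for y with leading component y0 and u in the inverse of the content of x,
  the product of x with u * x0 * (y - y0) lies in T, so induction on the number of components
  applies to it, and t-invertibility of the content removes the factor u again.\<close>

lemma gauss:
  assumes T: "subring T" "homog T" and D: "unique_sums {\<alpha>. U \<alpha> \<noteq> {0}}"
    and H: "\<And>C. finite C \<Longrightarrow> C \<noteq> {} \<Longrightarrow> \<forall>c\<in>C. c \<noteq> 0 \<and> (\<exists>\<alpha>. c \<in> U \<alpha>) \<Longrightarrow> t_inv T C"
    and "x \<in> tot" "y \<in> tot" "x * y \<in> T"
  shows "comp x \<alpha> * comp y \<beta> \<in> T"
  using assms(5-7)
proof (induction "card (supp x) + card (supp y)" arbitrary: x y \<alpha> \<beta> rule: less_induct)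
  case less
  note T1 = subringD[OF T(1)]
  show ?case
  proof (cases "x = 0 \<or> y = 0")
    case True
    then show ?thesis using T1 by (auto simp: comp_0)
  next
    case False
    have "supp x \<noteq> {}" "supp y \<noteq> {}" using False less supp_empty by auto
    moreover have "supp z \<subseteq> {\<alpha>. U \<alpha> \<noteq> {0}}" if "z \<in> tot" for z
      using comp_spec(2)[OF that] by (auto simp: supp_def)
    ultimately obtain \<alpha>0 \<beta>0 where ab: "\<alpha>0 \<in> supp x" "\<beta>0 \<in> supp y"
      and unique: "\<And>\<alpha> \<beta>. \<alpha> \<in> supp x \<Longrightarrow> \<beta> \<in> supp y \<Longrightarrow> \<alpha> + \<beta> = \<alpha>0 + \<beta>0 \<Longrightarrow> \<alpha> = \<alpha>0 \<and> \<beta> = \<beta>0"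
      using D comp_spec(1) less(2,3) unfolding unique_sums_def by metis
    define x0 y0 where "x0 = comp x \<alpha>0" and "y0 = comp y \<beta>0"
    have hx: "x0 \<in> U \<alpha>0" and hy: "y0 \<in> U \<beta>0" using comp_spec(2) less by (auto simp: x0_def y0_def)
    \<comment> \<open>As the sum of the two chosen degrees is attained only once, this component of
      \<open>x * y\<close> is the single product \<open>x0 * y0\<close>, and homogeneity puts it
      into T.\<close>
    have "comp (x * y) (\<alpha>0 + \<beta>0) = (\<Sum>\<alpha>\<in>supp x. comp x \<alpha> * comp y (\<alpha>0 + \<beta>0 - \<alpha>))"
      using comp_mult(2)[OF less(2,3)] .
    also have "\<dots> = (\<Sum>\<alpha>\<in>{\<alpha>0}. comp x \<alpha> * comp y (\<alpha>0 + \<beta>0 - \<alpha>))"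
    proof (rule sum.mono_neutral_right)
      show "\<forall>\<alpha>\<in>supp x - {\<alpha>0}. comp x \<alpha> * comp y (\<alpha>0 + \<beta>0 - \<alpha>) = 0"
      proof
        fix \<alpha> assume \<alpha>: "\<alpha> \<in> supp x - {\<alpha>0}"
        have "\<alpha>0 + \<beta>0 - \<alpha> \<notin> supp y" using unique[of \<alpha> "\<alpha>0 + \<beta>0 - \<alpha>"] \<alpha> by auto
        then show "comp x \<alpha> * comp y (\<alpha>0 + \<beta>0 - \<alpha>) = 0" by (simp add: supp_def)
      qed
    qed (use ab comp_spec(1) less in auto)
    finally have lead: "x0 * y0 \<in> T"
      using less(4) T(2) unfolding homog_def x0_def y0_def by (metis (no_types, lifting) add_diff_cancel_left' finite.emptyI empty_iff sum.insert sum.empty add.right_neutral)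
    let ?C = "comp x ` supp x"
    have C: "?C \<noteq> {}" "\<forall>c\<in>?C. c \<noteq> 0 \<and> (\<exists>\<alpha>. c \<in> U \<alpha>)"
      using ab less(2) comp_spec(2) by (auto simp: supp_def)
    have "t_inv T ?C" using H[OF _ C] comp_spec(1)[OF less(2)] by simp
    from t_inv_homogE[OF this T(2,1) C] obtain B b where
      B: "finite B" "b \<in> B" "b \<noteq> 0" "\<forall>b\<in>B. \<exists>\<alpha>. b \<in> U \<alpha>" "\<forall>a\<in>?C. \<forall>b\<in>B. a * b \<in> T"
      "\<forall>x. (\<forall>a\<in>?C. \<forall>b\<in>B. x * (a * b) \<in> T) \<longrightarrow> x \<in> T" .
    note y' = supp_remove[OF less(3) ab(2), folded y0_def]
    have *: "x0 * comp y \<beta> \<in> T" for \<beta>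
    proof (cases "\<beta> = \<beta>0")
      case True
      then show ?thesis using lead by (simp add: y0_def)
    next
      case False
      show ?thesis
      proof (rule B(6)[rule_format])
        fix a u assume "a \<in> ?C" and u: "u \<in> B"
        then obtain \<alpha> where a: "\<alpha> \<in> supp x" "a = comp x \<alpha>" by auto
        obtain \<gamma> where \<gamma>: "u \<in> U \<gamma>" using B(4) u by auto
        have ux0: "u * x0 \<in> U (\<gamma> + \<alpha>0)" "u * x0 \<in> T"
          using U_mult[OF \<gamma> hx] B(5) u ab by (auto simp: x0_def mult.commute[of u])
        have "(\<Sum>\<alpha>\<in>supp x. comp x \<alpha> * u) \<in> T"
          by (rule sum_closed) (use B(5) u T1 in auto)
        then have ux: "x * u \<in> T" using comp_spec(3)[OF less(2)] by (simp flip: sum_distrib_right)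
        let ?z = "(u * x0) * (y - y0)"
        note z = comp_hmult[OF ux0(1) y'(1)]
        have "x * ?z = (u * x0) * (x * y) - (x0 * y0) * (x * u)" by (simp add: algebra_simps)
        then have "x * ?z \<in> T" using T1 less(4) ux0 ux lead by simp
        moreover have "card (supp ?z) < card (supp y)"
          using supp_hmult[OF ux0(1) y'(1)] y'(3) by simp
        ultimately have "comp x \<alpha> * comp ?z (\<beta> + (\<gamma> + \<alpha>0)) \<in> T"
          using less(1)[OF _ less(2) z(1)] by auto
        then show "x0 * comp y \<beta> * (a * u) \<in> T"
          unfolding z(2) y'(2) using False a by (simp add: ac_simps)
      qed
    qed
    show ?thesis
    proof (cases "\<alpha> = \<alpha>0")
      case True
      then show ?thesis using * by (simp add: x0_def)
    next
      case False
      \<comment> \<open>Once \<open>x0\<close> multiplies every component of \<open>y\<close> into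
        T, the product stays in T when \<open>x\<close> loses its leading component, and induction
        handles the remaining ones.\<close>
      have "(\<Sum>\<beta>\<in>supp y. x0 * comp y \<beta>) \<in> T"
        by (rule sum_closed) (use * T1 in auto)
      then have "x0 * y \<in> T" using comp_spec(3)[OF less(3)] by (simp flip: sum_distrib_left)
      then have "(x - x0) * y \<in> T" using less(4) T1 by (simp add: left_diff_distrib)
      moreover note x' = supp_remove[OF less(2) ab(1), folded x0_def]
      ultimately have "comp (x - x0) \<alpha> * comp y \<beta> \<in> T"
        using less(1)[OF _ x'(1) less(3)] by auto
      then show ?thesis using x'(2) False by simp
    qed
  qed
qed

text \<open>To invert the ideal of A, use the inverse of the homogeneous ideal generated by all components
  of A together with a homogeneous multiple of an inverse over the whole graded field.\<close>

theorem t_inv_from_homogeneous: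
  assumes T: "subring T" "homog T" and D: "unique_sums {\<alpha>. U \<alpha> \<noteq> {0}}"
    and scale: "\<And>X. finite X \<Longrightarrow> X \<subseteq> tot \<Longrightarrow> \<exists>\<gamma> h. h \<in> U \<gamma> \<and> h \<noteq> 0 \<and> (\<forall>x\<in>X. h * x \<in> T)"
    and H: "\<And>C. finite C \<Longrightarrow> C \<noteq> {} \<Longrightarrow> \<forall>c\<in>C. c \<noteq> 0 \<and> (\<exists>\<alpha>. c \<in> U \<alpha>) \<Longrightarrow> t_inv T C"
    and tot: "t_inv tot A" and A: "finite A" "A \<subseteq> tot" "a \<in> A" "a \<noteq> 0"
  shows "t_inv T A"
proof -
  note T1 = subringD[OF T(1)]
  obtain B2 b2 where B2: "finite B2" "b2 \<in> B2" "b2 \<noteq> 0" "\<forall>a\<in>A. \<forall>b\<in>B2. a * b \<in> tot"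
    "\<forall>x. (\<forall>a\<in>A. \<forall>b\<in>B2. x * (a * b) \<in> tot) \<longrightarrow> x \<in> tot"
    using t_invE[OF tot] .
  have "finite ((\<lambda>(a, b). a * b) ` (A \<times> B2))" using A B2 by auto
  moreover have "(\<lambda>(a, b). a * b) ` (A \<times> B2) \<subseteq> tot" using B2(4) by auto
  ultimately have "\<exists>\<gamma> h. h \<in> U \<gamma> \<and> h \<noteq> 0 \<and> (\<forall>x\<in>(\<lambda>(a, b). a * b) ` (A \<times> B2). h * x \<in> T)"
    by (rule scale)
  then obtain \<gamma> h where h: "h \<in> U \<gamma>" "h \<noteq> 0" "\<And>a b. a \<in> A \<Longrightarrow> b \<in> B2 \<Longrightarrow> h * (a * b) \<in> T"
    by auto
  have h_tot: "x \<in> tot" if "h * x \<in> tot" for x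
    using comp_hmult(1)[OF U_inverse[OF h(1)] that] h(2) by (simp flip: mult.assoc)
  let ?C = "\<Union>a\<in>A. comp a ` supp a"
  have "supp a \<noteq> {}" using supp_empty[of a] A by auto
  then have C: "?C \<noteq> {}" "\<forall>c\<in>?C. c \<noteq> 0 \<and> (\<exists>\<alpha>. c \<in> U \<alpha>)"
    using A comp_spec(2) by (auto simp: supp_def)
  have "finite ?C" using A comp_spec(1) by auto
  from t_inv_homogE[OF H[OF this C] T(2,1) C] obtain B b where
    B: "finite B" "b \<in> B" "b \<noteq> 0" "\<forall>b\<in>B. \<exists>\<alpha>. b \<in> U \<alpha>" "\<forall>a\<in>?C. \<forall>b\<in>B. a * b \<in> T"
    "\<forall>x. (\<forall>a\<in>?C. \<forall>b\<in>B. x * (a * b) \<in> T) \<longrightarrow> x \<in> T" .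
  show ?thesis
  proof (rule t_invI[of "B \<union> (*) h ` B2" b])
    fix a b assume a: "a \<in> A" and b: "b \<in> B \<union> (*) h ` B2"
    from b show "a * b \<in> T"
    proof
      assume b: "b \<in> B"
      have "(\<Sum>\<alpha>\<in>supp a. comp a \<alpha> * b) \<in> T"
        by (rule sum_closed) (use B(5) a b T1 in auto)
      then show ?thesis using comp_spec(3)[of a] a A(2) by (auto simp flip: sum_distrib_right)
    next
      assume "b \<in> (*) h ` B2"
      then show ?thesis using h(3)[OF a] by (auto simp: mult.left_commute)
    qed
  next
    fix x assume x: "\<And>a b. a \<in> A \<Longrightarrow> b \<in> B \<union> (*) h ` B2 \<Longrightarrow> x * (a * b) \<in> T"
    \<comment> \<open>The two halves of the witness do separate jobs: the multiples of
      \<open>B2\<close> put \<open>x\<close> into \<open>tot\<close>, and only then can Gauss' lemma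
      and \<open>B\<close> put the components of \<open>x\<close> into T.\<close>
    have xt: "x \<in> tot"
    proof (rule B2(5)[rule_format])
      fix a b assume "a \<in> A" "b \<in> B2"
      then have "x * (a * (h * b)) \<in> T" using x by blast
      then have "h * (x * (a * b)) \<in> tot" using T(2) unfolding homog_def by (auto simp: ac_simps)
      then show "x * (a * b) \<in> tot" by (rule h_tot)
    qed
    have "comp x \<beta> \<in> T" for \<beta>
    proof (rule B(6)[rule_format])
      fix c b assume "c \<in> ?C" and b: "b \<in> B"
      then obtain a \<alpha> where c: "a \<in> A" "c = comp a \<alpha>" by auto
      obtain \<gamma> where \<gamma>: "b \<in> U \<gamma>" using B(4) b by auto
      note bx = comp_hmult[OF \<gamma> xt]
      have "a * (b * x) \<in> T" using x[OF c(1), of b] b by (simp add: ac_simps)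
      moreover have "a \<in> tot" using c A(2) by auto
      ultimately have "comp a \<alpha> * comp (b * x) (\<beta> + \<gamma>) \<in> T"
        by (intro gauss[OF T D H _ bx(1)])
      then show "comp x \<beta> * (c * b) \<in> T" unfolding bx(2) c(2) by (simp add: ac_simps)
    qed
    then have "(\<Sum>\<beta>\<in>supp x. comp x \<beta>) \<in> T" by (intro sum_closed T1)
    then show "x \<in> T" using comp_spec(3)[OF xt] by simp
  qed (simp_all add: B(1-3) B2(1))
qed

section \<open>Subrings of elements supported in a subgroup of degrees\<close>

definition sub :: "'g set \<Rightarrow> 'k set" where
  "sub N = {x \<in> tot. supp x \<subseteq> N}"

definition res :: "'g set \<Rightarrow> 'k \<Rightarrow> 'k" where
  "res P x = (\<Sum>\<alpha>\<in>supp x \<inter> P. comp x \<alpha>)"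

lemma comp_res:
  assumes "x \<in> tot"
  shows "res P x \<in> tot" "comp (res P x) \<beta> = (if \<beta> \<in> P then comp x \<beta> else 0)"
proof -
  note fin = comp_spec(1)[OF assms]
  have 1: "res P x = (\<Sum>\<alpha>\<in>supp x. if \<alpha> \<in> P then comp x \<alpha> else 0)"
    unfolding res_def by (rule sum.inter_restrict[OF fin])
  show "res P x \<in> tot" "comp (res P x) \<beta> = (if \<beta> \<in> P then comp x \<beta> else 0)"
    using comp_unique[OF fin _ _ 1] comp_spec(2)[OF assms] U_0 by (auto simp: supp_def)
qed

lemma eqI_comp: "x \<in> tot \<Longrightarrow> y \<in> tot \<Longrightarrow> (\<And>\<alpha>. comp x \<alpha> = comp y \<alpha>) \<Longrightarrow> x = y"
  using comp_spec(3)[of x] comp_spec(3)[of y] by (simp add: supp_def)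

lemma sub_hom: "\<alpha> \<in> N \<Longrightarrow> x \<in> U \<alpha> \<Longrightarrow> x \<in> sub N"
  using comp_hom[of x \<alpha>] by (auto simp: sub_def supp_def)

lemma subring_sub:
  assumes "subgr N"
  shows "subring (sub N)"
proof -
  note N = subgrD[OF assms]
  have "x * y \<in> sub N" if "x \<in> sub N" "y \<in> sub N" for x y
  proof -
    have t: "x \<in> tot" "y \<in> tot" using that by (auto simp: sub_def)
    have "comp (x * y) \<beta> = 0" if "\<beta> \<notin> N" for \<beta>
      unfolding comp_mult(2)[OF t]
    proof (rule sum.neutral, rule ballI)
      fix \<alpha> assume "\<alpha> \<in> supp x"
      then have "\<beta> - \<alpha> \<notin> supp y"
        using \<open>x \<in> sub N\<close> \<open>y \<in> sub N\<close> \<open>\<beta> \<notin> N\<close> N(4)[of "\<beta> - \<alpha>" \<alpha>] unfolding sub_def by auto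
      then show "comp x \<alpha> * comp y (\<beta> - \<alpha>) = 0" by (simp add: supp_def)
    qed
    then show ?thesis using comp_mult(1)[OF t] by (auto simp: sub_def supp_def)
  qed
  moreover have "x + y \<in> sub N" "- x \<in> sub N" if "x \<in> sub N" "y \<in> sub N" for x y
    using that comp_add comp_minus by (auto simp: sub_def supp_def subset_iff; metis add.right_neutral)+
  moreover have "0 \<in> sub N" "1 \<in> sub N" using sub_hom[OF N(1)] U_0 U_1 by auto
  ultimately show ?thesis unfolding subring_def by auto
qed

text \<open>The last hypothesis makes \<open>P\<close> a union of cosets of \<open>N\<close>.
  Multiplying by something supported in \<open>N\<close> keeps each coset in place, so truncation to
  \<open>P\<close> is linear over \<open>sub N\<close>.\<close>

lemma res_mult:
  assumes "e \<in> sub N" "x \<in> tot" "\<And>\<nu> \<alpha>. \<nu> \<in> N \<Longrightarrow> \<nu> + \<alpha> \<in> P \<longleftrightarrow> \<alpha> \<in> P"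
  shows "res P (e * x) = e * res P x"
proof -
  have e: "e \<in> tot" "supp e \<subseteq> N" using assms(1) by (auto simp: sub_def)
  note ex = comp_mult[OF e(1) assms(2)] and r = comp_res[OF assms(2), of P]
  note er = comp_mult[OF e(1) r(1)]
  show ?thesis
  proof (rule eqI_comp)
    fix \<beta>
    have eq: "\<beta> - \<alpha> \<in> P \<longleftrightarrow> \<beta> \<in> P" if "\<alpha> \<in> supp e" for \<alpha>
      using assms(3)[of \<alpha> "\<beta> - \<alpha>"] that e(2) by auto
    show "comp (res P (e * x)) \<beta> = comp (e * res P x) \<beta>"
      unfolding comp_res(2)[OF ex(1)] er(2) r(2) ex(2)
      using eq by (auto intro!: sum.cong)
  qed (use comp_res(1) ex(1) er(1) in auto)
qed

text \<open>\<open>sub N'\<close> is a free \<open>sub N\<close>-module, with one homogeneous unit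
  as basis element for each coset of \<open>N\<close> in which a nonzero element occurs. The witness
  property over \<open>sub N\<close> can therefore be applied coset by coset.\<close>

lemma t_inv_sub_mono:
  assumes N: "subgr N" and N': "subgr N'" "N \<subseteq> N'" and "t_inv (sub N) A" "a \<in> A" "a \<noteq> 0"
  shows "t_inv (sub N') A"
proof -
  have mono: "sub N \<subseteq> sub N'" using N'(2) by (auto simp: sub_def)
  note R = subringD[OF subring_sub[OF N]] and R' = subringD[OF subring_sub[OF N'(1)]]
  obtain B b where B: "finite B" "b \<in> B" "b \<noteq> 0" "\<forall>a\<in>A. \<forall>b\<in>B. a * b \<in> sub N"
    "\<forall>x. (\<forall>a\<in>A. \<forall>b\<in>B. x * (a * b) \<in> sub N) \<longrightarrow> x \<in> sub N"
    using t_invE[OF assms(4)] .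
  \<comment> \<open>A denominator known in advance: as \<open>e\<close> is one of the products
    \<open>a * b\<close>, every \<open>x\<close> to be tested has \<open>x * e\<close> in
    \<open>sub N'\<close>. The numerator has components, which \<open>x\<close> itself is not yet
    known to have.\<close>
  define e where "e = a * b"
  have e: "e \<noteq> 0" "e \<in> sub N" using assms B by (auto simp: e_def)
  have key: "s \<in> sub N' \<Longrightarrow> (\<And>a b. a \<in> A \<Longrightarrow> b \<in> B \<Longrightarrow> s / e * (a * b) \<in> sub N') \<Longrightarrow> s / e \<in> sub N'" for s
  proof (induction "card (supp s)" arbitrary: s rule: less_induct)
    case less
    have st: "s \<in> tot" "supp s \<subseteq> N'" using less(2) by (auto simp: sub_def)
    show ?case
    proof (cases "s = 0")
      case True
      then show ?thesis using R' by simp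
    next
      case False
      then obtain \<alpha> where \<alpha>: "\<alpha> \<in> supp s" using supp_empty[OF st(1)] by auto
      \<comment> \<open>The coset of \<open>N\<close> through one degree of \<open>s\<close>; its
        part of \<open>s\<close> is settled now and the rest by induction on the number of
        components.\<close>
      define P where "P = {\<beta>. \<beta> - \<alpha> \<in> N}"
      have P: "\<nu> + \<beta> \<in> P \<longleftrightarrow> \<beta> \<in> P" if "\<nu> \<in> N" for \<nu> \<beta>
        using subgrD(4)[OF N that, of "\<beta> - \<alpha>"] subgrD(2)[OF N _ that, of "\<nu> + \<beta> - \<alpha>"]
        by (auto simp: P_def algebra_simps)
      note rs = comp_res[OF st(1), of P]
      have PN': "P \<subseteq> N'"
      proof
        fix \<beta> assume "\<beta> \<in> P"
        then show "\<beta> \<in> N'" using subgrD(4)[OF N'(1), of "\<beta> - \<alpha>" \<alpha>] \<alpha> st(2) N'(2) by (auto simp: P_def)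
      qed
      have split: "res P s / e * (a * b) \<in> sub N' \<and> supp (res P s / e * (a * b)) \<subseteq> P" if ab: "a \<in> A" "b \<in> B" for a b
      proof -
        let ?t = "s / e * (a * b)"
        have t: "?t \<in> sub N'" "?t \<in> tot" using less(3)[OF ab] by (auto simp: sub_def)
        have abN: "a * b \<in> sub N" using B(4) ab by auto
        have "e * ?t = (a * b) * s" using e by simp
        then have "res P (e * ?t) = res P ((a * b) * s)" by simp
        then have "e * res P ?t = (a * b) * res P s"
          using res_mult[OF e(2) t(2), of P] res_mult[OF abN st(1), of P] P by simp
        then have *: "res P s / e * (a * b) = res P ?t" using e by (simp add: field_simps)
        show ?thesis unfolding * using comp_res[OF t(2), of P] PN' by (auto simp: sub_def supp_def)
      qed
      \<comment> \<open>A homogeneous unit that carries the coset \<open>P\<close> onto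
        \<open>N\<close>, where the original property of \<open>B\<close> is available.\<close>
      define w where "w = inverse (comp s \<alpha>)"
      have w: "w \<in> U (- \<alpha>)" "w \<noteq> 0" "inverse w \<in> U \<alpha>"
        using U_inverse[OF comp_spec(2)[OF st(1), of \<alpha>]] \<alpha> comp_spec(2)[OF st(1), of \<alpha>] by (auto simp: w_def supp_def)
      have shift: "w * z \<in> sub N" if "z \<in> tot" "supp z \<subseteq> P" for z
        using comp_hmult[OF w(1) that(1)] that(2) by (auto simp: sub_def supp_def P_def)
      have "w * (res P s / e) \<in> sub N"
      proof (rule B(5)[rule_format])
        fix a b assume "a \<in> A" "b \<in> B"
        then show "w * (res P s / e) * (a * b) \<in> sub N"
          using shift[of "res P s / e * (a * b)"] split[of a b] by (auto simp: sub_def mult.assoc)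
      qed
      then have "inverse w * (w * (res P s / e)) \<in> sub N'"
        using mono sub_hom[OF _ w(3), of N'] \<alpha> st(2) by (intro R'(4)[of "inverse w"]) blast+
      then have s1: "res P s / e \<in> sub N'" using w(2) by (simp flip: mult.assoc)
      have rN': "res P s \<in> sub N'" using rs PN' by (auto simp: sub_def supp_def)
      have s': "s - res P s \<in> sub N'" using less(2) rN' R' by simp
      have "comp (s - res P s) \<beta> = (if \<beta> \<in> P then 0 else comp s \<beta>)" for \<beta>
        using comp_diff(2)[OF st(1) rs(1)] rs(2) by simp
      moreover have "\<alpha> \<in> P" using subgrD(1)[OF N] by (simp add: P_def)
      ultimately have "supp (s - res P s) \<subset> supp s" using \<alpha> by (auto simp: supp_def split: if_splits)
      then have "card (supp (s - res P s)) < card (supp s)"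
        by (rule psubset_card_mono[OF comp_spec(1)[OF st(1)]])
      moreover have "(s - res P s) / e * (a * b) \<in> sub N'" if "a \<in> A" "b \<in> B" for a b
        using less(3)[OF that] split[OF that] R' by (simp add: diff_divide_distrib left_diff_distrib)
      ultimately have "(s - res P s) / e \<in> sub N'" using less(1)[of "s - res P s"] s' by blast
      then have "(s - res P s) / e + res P s / e \<in> sub N'" using s1 R' by simp
      then show ?thesis by (simp add: diff_divide_distrib)
    qed
  qed
  show ?thesis
  proof (rule t_invI[OF B(1-3)])
    fix a b assume "a \<in> A" "b \<in> B" then show "a * b \<in> sub N'" using B(4) mono by auto
  next
    fix x assume x: "\<And>a b. a \<in> A \<Longrightarrow> b \<in> B \<Longrightarrow> x * (a * b) \<in> sub N'"
    have "(x * e) / e \<in> sub N'"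
      by (rule key) (use x assms(5) B(2) e in \<open>auto simp: e_def\<close>)
    then show "x \<in> sub N'" using e by simp
  qed
qed

end

section \<open>Finitely generated subgroups of torsion-free groups\<close>

text \<open>The integer multiples in an abelian group, built from repeated sums because
  torsion-freeness in \<open>graded_domain\<close> is phrased with them. One of the two sums is
  empty, according to the sign.\<close>

definition zmul :: "int \<Rightarrow> 'g::ab_group_add \<Rightarrow> 'g" where
  "zmul k x = (\<Sum>i<nat k. x) - (\<Sum>i<nat (- k). x)"

lemma sum_const_add: "(\<Sum>i<m + n::nat. x) = (\<Sum>i<m. x) + (\<Sum>i<n. x :: 'g::ab_group_add)"
  by (induction n) (auto simp: add.assoc)

lemma zmul_diff: "zmul (int m - int n) x = (\<Sum>i<m. x) - (\<Sum>i<n. x)"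
proof -
  let ?k = "int m - int n"
  have "nat ?k + n = m + nat (- ?k)" by auto
  then have "(\<Sum>i<nat ?k. x) + (\<Sum>i<n. x) = (\<Sum>i<m. x) + (\<Sum>i<nat (- ?k). x)"
    by (metis sum_const_add)
  then show ?thesis unfolding zmul_def by (simp add: algebra_simps)
qed

lemma zmul_add: "zmul (k + l) x = zmul k x + zmul l x"
proof -
  obtain a b c d where k: "k = int a - int b" "l = int c - int d" by (metis int_diff_cases)
  have "k + l = int (a + c) - int (b + d)" using k by simp
  then show ?thesis unfolding k zmul_diff by (simp only: zmul_diff sum_const_add) (simp add: algebra_simps)
qed

lemma zmul_1: "zmul 1 x = x"
  by (simp add: zmul_def)

lemma zmul_right: "zmul k (x + y) = zmul k x + zmul k y"
  by (simp add: zmul_def sum.distrib)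

lemma zmul_zmul: "zmul k (zmul l x) = zmul (k * l) x"
proof -
  have n: "zmul (int n) (zmul l x) = zmul (int n * l) x" for n
  proof (induction n)
    case 0
    then show ?case by (simp add: zmul_def)
  next
    case (Suc n)
    have "zmul (int (Suc n)) (zmul l x) = zmul l x + zmul (int n) (zmul l x)"
      using zmul_add[of 1 "int n" "zmul l x"] by (simp add: zmul_1)
    also have "\<dots> = zmul (int (Suc n) * l) x"
      using zmul_add[of l "int n * l" x] Suc by (simp add: distrib_right)
    finally show ?case .
  qed
  have m: "zmul (- l) y = - zmul l y" for l and y :: 'a by (simp add: zmul_def)
  show ?thesis
  proof (cases "k \<ge> 0")
    case True
    then show ?thesis using n[of "nat k"] by simp
  next
    case False
    then show ?thesis using n[of "nat (- k)"] m[of "- k"] m[of "- (k * l)" x] by simp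
  qed
qed

interpretation zm: module zmul
  by unfold_locales (auto simp: zmul_right zmul_add zmul_zmul zmul_1)

definition torsion_free :: "'g::ab_group_add set \<Rightarrow> bool" where
  "torsion_free D \<longleftrightarrow> (\<forall>x\<in>D. \<forall>n::nat. n > 0 \<longrightarrow> (\<Sum>i<n. x) = 0 \<longrightarrow> x = 0)"

lemma torsion_freeD:
  assumes "torsion_free D" "x \<in> D" "zmul k x = 0" "k \<noteq> 0"
  shows "x = 0"
proof (cases "k > 0")
  case True
  then have "(\<Sum>i<nat k. x) = 0" "nat k > 0" using assms(3) by (auto simp: zmul_def)
  then show ?thesis using assms(1,2) unfolding torsion_free_def by blast
next
  case False
  then have "(\<Sum>i<nat (- k). x) = 0" "nat (- k) > 0" using assms(3,4) by (auto simp: zmul_def)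
  then show ?thesis using assms(1,2) unfolding torsion_free_def by blast
qed

text \<open>Euclid's algorithm on the coefficients of a relation.\<close>

lemma relation_reduce:
  assumes "subgr D" "torsion_free D" "finite B" "B \<subseteq> D" "\<exists>v\<in>B. u v \<noteq> 0" "(\<Sum>v\<in>B. zmul (u v) v) = 0"
  shows "\<exists>B'. finite B' \<and> B' \<subseteq> D \<and> card B' < card B \<and> B \<subseteq> zm.span B'"
  using assms(3-6)
proof (induction "\<Sum>v\<in>B. nat \<bar>u v\<bar>" arbitrary: B u rule: less_induct)
  case less
  obtain v0 where v0: "v0 \<in> B" "u v0 \<noteq> 0" using less by auto
  show ?case
  proof (cases "\<exists>w\<in>B. w \<noteq> v0 \<and> u w \<noteq> 0")
    case False
    have "(\<Sum>v\<in>B. zmul (u v) v) = (\<Sum>v\<in>{v0}. zmul (u v) v)"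
      by (rule sum.mono_neutral_right) (use less v0 False in auto)
    then have "v0 = 0" using less(5) torsion_freeD[OF assms(2), of v0] v0 less(3) by auto
    then have "v \<in> zm.span (B - {v0})" if "v \<in> B" for v
      using that by (cases "v = v0") (auto intro: zm.span_zero zm.span_base)
    then have "B \<subseteq> zm.span (B - {v0})" by blast
    moreover have "card (B - {v0}) < card B" using less(2) v0(1) by (rule card_Diff1_less)
    ultimately show ?thesis using less(2,3) by (intro exI[of _ "B - {v0}"]) blast
  next
    case True
    then obtain v w where vw: "v \<in> B" "w \<in> B" "v \<noteq> w" "u v \<noteq> 0" "u w \<noteq> 0" "\<bar>u w\<bar> \<le> \<bar>u v\<bar>"
      using v0 by (metis linear)
    \<comment> \<open>The sign for which subtracting \<open>s * u w\<close> shrinks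
      \<open>u v\<close>. Replacing \<open>w\<close> by \<open>w + s v\<close> preserves the
      relation, as u(v) v + u(w) w = (u(v) - s u(w)) v + u(w) (w + s v).\<close>
    define s where "s = (if (u v > 0) = (u w > 0) then 1 else - 1 :: int)"
    have s: "\<bar>u v - s * u w\<bar> < \<bar>u v\<bar>" using vw(4-6) by (auto simp: s_def split: if_splits)
    define w' where "w' = w + zmul s v"
    define B1 where "B1 = insert w' (B - {w})"
    have vB1: "v \<in> B - {w}" using vw by auto
    have "w = w' - zmul s v" by (simp add: w'_def)
    moreover have "w' - zmul s v \<in> zm.span B1"
      by (intro zm.span_diff zm.span_scale zm.span_base) (use vB1 in \<open>auto simp: B1_def\<close>)
    ultimately have "w \<in> zm.span B1" by simp
    then have BB1: "B \<subseteq> zm.span B1" using zm.span_base[of _ B1] by (auto simp: B1_def)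
    have D_zmul: "zmul k x \<in> D" if "x \<in> D" for k x
    proof -
      have "(\<Sum>i<n::nat. x) \<in> D" for n
        by (rule sum_closed) (use that subgrD[OF assms(1)] in auto)
      then show ?thesis unfolding zmul_def using subgrD(2)[OF assms(1)] by blast
    qed
    have "w \<in> D" "v \<in> D" using less(3) vw by auto
    then have B1D: "B1 \<subseteq> D" using less(3) subgrD(4)[OF assms(1)] D_zmul by (auto simp: B1_def w'_def)
    have fB1: "finite B1" "finite (B - {w})" using less(2) by (auto simp: B1_def)
    show ?thesis
    proof (cases "w' \<in> B - {w}")
      \<comment> \<open>The new generator coincides with an old one, so the generating set has
        already become smaller.\<close>
      case True
      then have "B1 = B - {w}" by (auto simp: B1_def)
      then have "card B1 < card B" using card_Diff1_less[OF less(2) vw(2)] by simp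
      then show ?thesis using fB1 B1D BB1 by auto
    next
      case False
      define u' where "u' = u(v := u v - s * u w, w' := u w)"
      have w'v: "w' \<noteq> v" using False vB1 by auto
      have split: "(\<Sum>x\<in>B. g x) = g w + (g v + (\<Sum>x\<in>B - {w} - {v}. g x))" for g :: "'a \<Rightarrow> 'b::comm_monoid_add"
        using sum.remove[OF less(2) vw(2), of g] sum.remove[OF fB1(2) vB1, of g] by simp
      have split1: "(\<Sum>x\<in>B1. g x) = g w' + (g v + (\<Sum>x\<in>B - {w} - {v}. g x))" for g :: "'a \<Rightarrow> 'b::comm_monoid_add"
        using sum.insert[OF fB1(2) False, of g] sum.remove[OF fB1(2) vB1, of g] by (simp add: B1_def)
      have u'_else: "u' x = u x" if "x \<in> B - {w} - {v}" for x
        using that False by (auto simp: u'_def)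
      have u': "u' w' = u w" "u' v = u v - s * u w" using w'v by (auto simp: u'_def)
      have "zmul (u v) v = zmul (s * u w) v + zmul (u' v) v"
        unfolding u' zmul_add[symmetric] by simp
      then have "(\<Sum>x\<in>B1. zmul (u' x) x) = (\<Sum>x\<in>B. zmul (u x) x)"
        unfolding split split1 using u'_else
        by (simp add: u'(1)) (simp add: w'_def zmul_right zmul_zmul ac_simps)
      moreover have "(\<Sum>x\<in>B1. nat \<bar>u' x\<bar>) < (\<Sum>x\<in>B. nat \<bar>u x\<bar>)"
        unfolding split split1 using u' u'_else s by simp
      moreover have "\<exists>x\<in>B1. u' x \<noteq> 0" using u' vw by (auto simp: B1_def)
      ultimately obtain B' where B': "finite B'" "B' \<subseteq> D" "card B' < card B1" "B1 \<subseteq> zm.span B'"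
        using less(1)[of u' B1] fB1 B1D less(5) by auto
      have "card B1 = card B"
        unfolding B1_def using card_insert_disjoint[OF fB1(2) False] card_Suc_Diff1[OF less(2) vw(2)] by simp
      moreover have "B \<subseteq> zm.span B'"
        using BB1 zm.span_minimal[OF B'(4) zm.subspace_span] by blast
      ultimately show ?thesis using B' by auto
    qed
  qed
qed

text \<open>Take a spanning set of least size; a relation would produce a smaller one. Selecting a
  subset of \<open>X\<close> would not do: {2, 3} generates the integers but contains no basis of
  them.\<close>

lemma finite_subset_independent_span:
  assumes "subgr D" "torsion_free D" "finite X" "X \<subseteq> D"
  shows "\<exists>B. finite B \<and> B \<subseteq> D \<and> X \<subseteq> zm.span B \<and> zm.independent B"
proof -
  let ?P = "\<lambda>B. finite B \<and> B \<subseteq> D \<and> X \<subseteq> zm.span B"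
  have "?P X" using assms zm.span_superset by auto
  then obtain B where B: "?P B" and min: "\<And>B'. ?P B' \<Longrightarrow> card B \<le> card B'"
    using ex_has_least_nat[of ?P X card] by auto
  have "zm.independent B"
  proof
    assume "zm.dependent B"
    then obtain u where "\<exists>v\<in>B. u v \<noteq> 0" "(\<Sum>v\<in>B. zmul (u v) v) = 0"
      using zm.dependent_finite[of B] B by blast
    then obtain B' where B': "finite B'" "B' \<subseteq> D" "card B' < card B" "B \<subseteq> zm.span B'"
      using relation_reduce[OF assms(1,2), of B u] B by auto
    then have "?P B'" using B zm.span_minimal[OF B'(4) zm.subspace_span] by blast
    then show False using min B'(3) by fastforce
  qed
  then show ?thesis using B by auto
qed

lemma subgr_span: "subgr (zm.span B)"
  unfolding subgr_def by (auto intro: zm.span_zero zm.span_diff)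

text \<open>The form in which freeness is used: a new basis element has infinite order modulo the
  span of the others.\<close>

lemma independent_insert_zmul:
  assumes "finite B" "zm.independent (insert b B)" "b \<notin> B" "zmul k b \<in> zm.span B"
  shows "k = 0"
proof (rule ccontr)
  assume k: "k \<noteq> 0"
  obtain c where c: "zmul k b = (\<Sum>v\<in>B. zmul (c v) v)" using assms(4) zm.span_finite[OF assms(1)] by auto
  let ?c = "c(b := - k)"
  have "(\<Sum>v\<in>B. zmul (?c v) v) = (\<Sum>v\<in>B. zmul (c v) v)"
    by (rule sum.cong) (use assms(3) in auto)
  then have "(\<Sum>v\<in>insert b B. zmul (?c v) v) = 0"
    using assms(1,3) c by simp
  moreover have "?c b \<noteq> 0" using k by simp
  ultimately show False using assms(1,2) zm.dependent_finite[of "insert b B"] by blast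
qed

section \<open>Unique sums in the integers and under adjunction of a free generator\<close>

lemma unique_sums_int: "unique_sums (D :: int set)"
  unfolding unique_sums_def
proof (intro allI impI)
  fix A B :: "int set" assume *: "finite A" "A \<noteq> {}" "finite B" "B \<noteq> {}"
  show "\<exists>a\<in>A. \<exists>b\<in>B. \<forall>a'\<in>A. \<forall>b'\<in>B. a' + b' = a + b \<longrightarrow> a' = a \<and> b' = b"
  proof (intro bexI ballI impI)
    fix a b assume ab: "a \<in> A" "b \<in> B" "a + b = Max A + Max B"
    show "a = Max A \<and> b = Max B" using Max_ge[OF *(1) ab(1)] Max_ge[OF *(3) ab(2)] ab(3) by simp
  qed (use Max_in[OF *(1,2)] Max_in[OF *(3,4)] in auto)
qed

text \<open>A lexicographic argument. The coefficient of \<open>\<gamma>\<close> is well defined, as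
  no nonzero multiple of \<open>\<gamma>\<close> lies in \<open>N\<close>; a sum can have the
  maximal total coefficient only if both summands are maximal, and among those \<open>N\<close>
  decides.\<close>

lemma unique_sums_extend:
  assumes N: "subgr N" and "unique_sums N" and \<gamma>: "\<And>k. zmul k \<gamma> \<in> N \<Longrightarrow> k = 0"
  shows "unique_sums {x. \<exists>k. x - zmul k \<gamma> \<in> N}"
  unfolding unique_sums_def
proof (intro allI impI)
  fix A B assume A: "finite A" "A \<noteq> {}" "A \<subseteq> {x. \<exists>k. x - zmul k \<gamma> \<in> N}"
    and B: "finite B" "B \<noteq> {}" "B \<subseteq> {x. \<exists>k. x - zmul k \<gamma> \<in> N}"
  define k where "k x = (SOME k. x - zmul k \<gamma> \<in> N)" for x
  have kA: "a - zmul (k a) \<gamma> \<in> N" if "a \<in> A" for a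
    unfolding k_def by (rule someI_ex) (use A that in auto)
  have kB: "b - zmul (k b) \<gamma> \<in> N" if "b \<in> B" for b
    unfolding k_def by (rule someI_ex) (use B that in auto)
  define m n where "m = Max (k ` A)" and "n = Max (k ` B)"
  have mA: "k a \<le> m" if "a \<in> A" for a using A that by (auto simp: m_def)
  have nB: "k b \<le> n" if "b \<in> B" for b using B that by (auto simp: n_def)
  have "m \<in> k ` A" "n \<in> k ` B" unfolding m_def n_def using A B by (auto intro!: Max_in)
  let ?A = "(\<lambda>a. a - zmul m \<gamma>) ` {a \<in> A. k a = m}"
  let ?B = "(\<lambda>b. b - zmul n \<gamma>) ` {b \<in> B. k b = n}"
  have "finite ?A" "finite ?B" using A(1) B(1) by auto
  moreover have "?A \<noteq> {}" "?B \<noteq> {}" using \<open>m \<in> k ` A\<close> \<open>n \<in> k ` B\<close> by auto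
  moreover have "?A \<subseteq> N" "?B \<subseteq> N" using kA kB by auto
  ultimately obtain a1 b1 where "a1 \<in> ?A" "b1 \<in> ?B"
    and uni: "\<forall>a'\<in>?A. \<forall>b'\<in>?B. a' + b' = a1 + b1 \<longrightarrow> a' = a1 \<and> b' = b1"
    using assms(2)[unfolded unique_sums_def, rule_format, of ?A ?B] by blast
  then obtain a b where ab: "a \<in> A" "k a = m" "a1 = a - zmul m \<gamma>" "b \<in> B" "k b = n" "b1 = b - zmul n \<gamma>"
    by auto
  have "a' = a \<and> b' = b" if *: "a' \<in> A" "b' \<in> B" "a' + b' = a + b" for a' b'
  proof -
    have "(a - zmul m \<gamma> + (b - zmul n \<gamma>)) - (a' - zmul (k a') \<gamma> + (b' - zmul (k b') \<gamma>)) \<in> N"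
      using subgrD(2)[OF N subgrD(4)[OF N kA[OF ab(1)] kB[OF ab(4)]] subgrD(4)[OF N kA[OF *(1)] kB[OF *(2)]]]
      unfolding ab(2,5) .
    moreover have "(a - zmul m \<gamma> + (b - zmul n \<gamma>)) - (a' - zmul (k a') \<gamma> + (b' - zmul (k b') \<gamma>))
        = (a + b) - (a' + b') + zmul (k a' + k b' - (m + n)) \<gamma>"
      by (simp add: algebra_simps zmul_add zm.scale_left_diff_distrib)
    ultimately have "k a' + k b' - (m + n) = 0" using * by (intro \<gamma>) simp
    then have "k a' = m" "k b' = n" using mA[of a'] nB[of b'] * by auto
    then have "a' - zmul m \<gamma> \<in> ?A" "b' - zmul n \<gamma> \<in> ?B" using * by auto
    moreover have "a' - zmul m \<gamma> + (b' - zmul n \<gamma>) = (a' + b') - (zmul m \<gamma> + zmul n \<gamma>)" by simp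
    then have "a' - zmul m \<gamma> + (b' - zmul n \<gamma>) = a1 + b1" unfolding *(3) ab(3,6) by simp
    ultimately have "a' - zmul m \<gamma> = a1 \<and> b' - zmul n \<gamma> = b1" using uni by blast
    then show ?thesis using ab by simp
  qed
  then show "\<exists>a\<in>A. \<exists>b\<in>B. \<forall>a'\<in>A. \<forall>b'\<in>B. a' + b' = a + b \<longrightarrow> a' = a \<and> b' = b"
    using ab by blast
qed

section \<open>Laurent polynomials in one variable over a field\<close>

text \<open>Division with remainder: the ideal of \<open>W\<close> generated by \<open>A\<close> is
  generated by the value at \<open>u\<close> of a polynomial of least degree over the field
  \<open>L\<close>, and the inverse of that generator is the witness.\<close>

lemma laurent_principal:
  assumes L: "subring L" "\<And>x. x \<in> L \<Longrightarrow> inverse x \<in> L" and u: "u \<noteq> (0::'k::field)"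
    and W: "W = prodm L (range (\<lambda>i::int. u powi i))" and A: "A \<subseteq> W" "a \<in> A" "a \<noteq> 0"
  shows "t_inv W A"
proof -
  note L1 = subringD[OF L(1)]
  have ring: "subring W" unfolding W
  proof (rule subring_span_monoid[OF L(1)])
    show "1 \<in> range (\<lambda>i::int. u powi i)" using rangeI[of "\<lambda>i::int. u powi i" 0] by simp
    show "x * y \<in> range (\<lambda>i::int. u powi i)" if "x \<in> range (\<lambda>i::int. u powi i)" "y \<in> range (\<lambda>i::int. u powi i)" for x y
    proof -
      obtain i j :: int where "x = u powi i" "y = u powi j" using \<open>x \<in> _\<close> \<open>y \<in> _\<close> by auto
      then have "x * y = u powi (i + j)" using u by (simp add: power_int_add)
      then show ?thesis by auto
    qed
  qed
  note W1 = subringD[OF ring]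
  have uW: "c * u powi i \<in> W" if "c \<in> L" for c and i :: int
    unfolding W by (rule prodm_mem) (use that in auto)
  define PL :: "'k poly set" where "PL = {p. \<forall>i. coeff p i \<in> L}"
  have PL: "p + q \<in> PL" "p - q \<in> PL" "p * q \<in> PL" if "p \<in> PL" "q \<in> PL" for p q
    using that L1 by (auto simp: PL_def coeff_mult intro!: sum_closed)
  have PLm: "monom c n \<in> PL" if "c \<in> L" for c n using that L1 by (auto simp: PL_def)
  have polyW: "poly p u \<in> W" if "p \<in> PL" for p
    unfolding poly_altdef
    by (rule sum_closed) (use W1 that uW[of "coeff p _" "int _"] in \<open>auto simp: PL_def\<close>)
  \<comment> \<open>Powers of \<open>u\<close> are units of \<open>W\<close>, so up to such a factor
    every element is the value of an honest polynomial.\<close>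
  have lift: "\<exists>k. \<exists>p\<in>PL. w * u ^ k = poly p u" if "w \<in> W" for w
  proof -
    have "prodm L (range (\<lambda>i::int. u powi i)) \<subseteq> {w. \<exists>k. \<exists>p\<in>PL. w * u ^ k = poly p u}"
    proof (rule prodm_least)
      show "0 \<in> {w. \<exists>k. \<exists>p\<in>PL. w * u ^ k = poly p u}" using L1 by (auto intro!: exI[of _ 0] simp: PL_def)
    next
      fix x y assume "x \<in> {w. \<exists>k. \<exists>p\<in>PL. w * u ^ k = poly p u}" "y \<in> {w. \<exists>k. \<exists>p\<in>PL. w * u ^ k = poly p u}"
      then obtain k p l q where *: "p \<in> PL" "x * u ^ k = poly p u" "q \<in> PL" "y * u ^ l = poly q u" by auto
      have "(x + y) * u ^ (k + l) = (x * u ^ k) * u ^ l + (y * u ^ l) * u ^ k"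
        by (simp add: algebra_simps power_add)
      also have "\<dots> = poly (p * monom 1 l + q * monom 1 k) u"
        unfolding * by (simp add: poly_monom)
      finally have "(x + y) * u ^ (k + l) = poly (p * monom 1 l + q * monom 1 k) u" .
      moreover have "p * monom 1 l + q * monom 1 k \<in> PL"
        by (intro PL PLm L1 *)
      ultimately show "x + y \<in> {w. \<exists>k. \<exists>p\<in>PL. w * u ^ k = poly p u}" by blast
    next
      fix c w assume "c \<in> L" "w \<in> range (\<lambda>i::int. u powi i)"
      then obtain i :: int where c: "c \<in> L" and w: "w = u powi i" by auto
      show "c * w \<in> {w. \<exists>k. \<exists>p\<in>PL. w * u ^ k = poly p u}"
      proof (cases "i \<ge> 0")
        case True
        then have "c * w * u ^ 0 = poly (monom c (nat i)) u" by (simp add: w poly_monom power_int_def)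
        then show ?thesis using PLm[OF c] by blast
      next
        case False
        then have "c * w * u ^ nat (- i) = poly (monom c 0) u" using u by (simp add: w poly_monom power_int_def field_simps)
        then show ?thesis using PLm[OF c] by blast
      qed
    qed
    then show ?thesis using that W by blast
  qed
  define I where "I = prodm W A"
  note I = submodD[OF submod_span[OF ring, of A], folded I_def]
  \<comment> \<open>What is excluded is a zero value at \<open>u\<close>, not merely the zero
    polynomial: \<open>u\<close> may be algebraic over \<open>L\<close> here.\<close>
  let ?Q = "\<lambda>p. p \<in> PL \<and> poly p u \<in> I \<and> poly p u \<noteq> 0"
  have upW: "u ^ k \<in> W" for k using uW[OF L1(2), of "int k"] by simp
  have AI: "a \<in> I" if "a \<in> A" for a unfolding I_def using span_base[OF ring that] .
  obtain k p where "p \<in> PL" "a * u ^ k = poly p u" using lift[of a] A(1,2) by auto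
  moreover have "a * u ^ k \<in> I" using I(3)[OF upW AI[OF A(2)]] by (simp add: mult.commute)
  ultimately have "?Q p" using A(3) u by auto
  then obtain g where g: "?Q g" and min: "\<And>q. ?Q q \<Longrightarrow> degree g \<le> degree q"
    using ex_has_least_nat[of ?Q p degree] by auto
  define e where "e = poly g u"
  have g0: "lead_coeff g \<noteq> 0" using g by auto
  have div: "p \<in> PL \<Longrightarrow> poly p u \<in> I \<Longrightarrow> \<exists>w\<in>W. poly p u = w * e" for p
  proof (induction "degree p" arbitrary: p rule: less_induct)
    case less
    show ?case
    proof (cases "poly p u = 0")
      case True
      then show ?thesis using W1 by (intro bexI[of _ 0]) auto
    next
      case False
      then have deg: "degree g \<le> degree p" using min less by auto
      define m where "m = monom (lead_coeff p / lead_coeff g) (degree p - degree g)"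
      have m: "m \<in> PL" unfolding m_def divide_inverse
        by (intro PLm L1 L(2)) (use less(2) g in \<open>auto simp: PL_def\<close>)
      define q where "q = p - m * g"
      have q: "q \<in> PL" using less(2) g m PL by (auto simp: q_def)
      have "poly m u * poly g u \<in> I" using I(3)[OF polyW[OF m]] g by auto
      then have "- 1 * (poly m u * poly g u) \<in> I" by (rule I(3)[OF W1(5)[OF W1(2)]])
      then have qI: "poly q u \<in> I" using I(2)[OF less(3), of "- 1 * (poly m u * poly g u)"] by (simp add: q_def)
      have "degree (m * g) \<le> degree p"
        using degree_mult_le[of m g] degree_monom_le[of "lead_coeff p / lead_coeff g" "degree p - degree g"] deg
        unfolding m_def by linarith
      then have "degree q \<le> degree p" unfolding q_def by (intro degree_diff_le) auto
      moreover have "coeff q (degree p) = 0"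
        using g0 deg by (simp add: q_def m_def coeff_monom_mult)
      ultimately have "q = 0 \<or> degree q < degree p" by (rule eq_zero_or_degree_less)
      then have "\<exists>w\<in>W. poly q u = w * e"
      proof
        assume "q = 0"
        then show ?thesis using W1(1) by (intro bexI[of _ 0]) simp_all
      qed (rule less(1)[OF _ q qI])
      then obtain w where "w \<in> W" "poly q u = w * e" by auto
      then have "poly p u = (w + poly m u) * e" by (simp add: q_def e_def algebra_simps)
      then show ?thesis using \<open>w \<in> W\<close> polyW[OF m] W1 by blast
    qed
  qed
  have e: "e \<noteq> 0" "e \<in> I" using g by (auto simp: e_def)
  have dvd: "a / e \<in> W" if aA: "a \<in> A" for a
  proof -
    obtain k p where kp: "p \<in> PL" "a * u ^ k = poly p u" using lift[of a] A(1) aA by auto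
    moreover have "a * u ^ k \<in> I" using I(3)[OF upW AI[OF aA]] by (simp add: mult.commute)
    ultimately obtain w where w: "w \<in> W" "poly p u = w * e" using div[of p] by auto
    have "a / e = w * (1 * u powi (- int k))" using kp w e u by (simp add: power_int_minus field_simps)
    then show ?thesis using w(1) uW[OF L1(2), of "- int k"] W1 by metis
  qed
  show ?thesis
  proof (rule t_invI[of "{inverse e}" "inverse e"])
    fix x assume x: "\<And>a b. a \<in> A \<Longrightarrow> b \<in> {inverse e} \<Longrightarrow> x * (a * b) \<in> W"
    have "(x / e) * e \<in> W"
    proof (rule prodm_mult_closed[of e W A])
      show "e \<in> prodm W A" using e by (simp add: I_def)
      fix w a assume "w \<in> W" "a \<in> A"
      then show "x / e * (w * a) \<in> W" using W1(4)[of w "x * (a * inverse e)"] x by (simp add: field_simps)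
    qed (use W1 in auto)
    then show "x \<in> W" using e by simp
  qed (use dvd e in \<open>auto simp: divide_inverse\<close>)
qed

lemma common_denominator:
  assumes "subring M" "\<And>d x. d \<in> M \<Longrightarrow> x \<in> T \<Longrightarrow> d * x \<in> T" "finite I"
    "\<And>i. i \<in> I \<Longrightarrow> \<exists>d\<in>M. d \<noteq> 0 \<and> d * f i \<in> T"
  shows "\<exists>d\<in>M. d \<noteq> (0::'k::field) \<and> (\<forall>i\<in>I. d * f i \<in> T)"
  using assms(3,4)
proof (induction I)
  case empty
  then show ?case using subringD(2)[OF assms(1)] by (intro bexI[of _ 1]) auto
next
  case (insert j I)
  then obtain d where d: "d \<in> M" "d \<noteq> 0" "\<forall>i\<in>I. d * f i \<in> T" by auto
  obtain e where e: "e \<in> M" "e \<noteq> 0" "e * f j \<in> T" using insert(4)[of j] by auto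
  have "d * e * f i \<in> T" if "i \<in> insert j I" for i
  proof (cases "i = j")
    case True
    then show ?thesis using assms(2)[OF d(1) e(3)] by (simp add: mult.assoc)
  next
    case False
    then have "d * f i \<in> T" using that d(3) by auto
    from assms(2)[OF e(1) this] have "e * (d * f i) \<in> T" .
    then show ?thesis by (simp add: ac_simps)
  qed
  then show ?case using d e subringD(4)[OF assms(1)] by (intro bexI[of _ "d * e"]) auto
qed

section \<open>The graded field itself\<close>

context graded_field
begin

lemma U_powi:
  assumes "u \<in> U \<gamma>"
  shows "u powi i \<in> U (zmul i \<gamma>)"
proof -
  have pow: "v ^ n \<in> U (zmul (int n) \<delta>)" if "v \<in> U \<delta>" for v \<delta> n
  proof (induction n)
    case 0
    then show ?case using U_1 by (simp add: zmul_def)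
  next
    case (Suc n)
    have "zmul (int (Suc n)) \<delta> = \<delta> + zmul (int n) \<delta>"
      using zmul_add[of 1 "int n" \<delta>] by (simp add: zmul_1)
    then show ?case using U_mult[OF that Suc] by simp
  qed
  have "zmul i \<gamma> = zmul (- i) (- \<gamma>)" by (simp add: zmul_def sum_negf)
  then show ?thesis
    using pow[OF assms, of "nat i"] pow[OF U_inverse[OF assms], of "nat (- i)"] by (auto simp: power_int_def)
qed

text \<open>The i-th term is supported in the coset of \<open>N\<close> through
  \<open>zmul i \<gamma>\<close>, and these cosets are pairwise distinct. In other words,
  \<open>u\<close> is transcendental over \<open>sub N\<close>.\<close>

lemma infinite_order_indep:
  assumes N: "subgr N" and \<gamma>: "\<And>k. zmul k \<gamma> \<in> N \<Longrightarrow> k = 0" and u: "u \<in> U \<gamma>" "u \<noteq> 0"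
    and F: "finite F" "\<And>i. i \<in> F \<Longrightarrow> e i \<in> sub N" "(\<Sum>i\<in>F. e i * u powi i) = 0" "j \<in> F"
  shows "e j = 0"
proof -
  have e: "e i \<in> tot" "supp (e i) \<subseteq> N" if "i \<in> F" for i using F(2)[OF that] by (auto simp: sub_def)
  have "comp (e j) \<nu> = 0" for \<nu>
  proof (cases "\<nu> \<in> N")
    case False
    then show ?thesis using e(2)[OF F(4)] by (auto simp: supp_def)
  next
    case True
    let ?\<alpha> = "\<nu> + zmul j \<gamma>"
    have c: "u powi i * e i \<in> tot" "comp (u powi i * e i) ?\<alpha> = (if i = j then u powi j * comp (e j) \<nu> else 0)" if "i \<in> F" for i
    proof -
      note h = comp_hmult[OF U_powi[OF u(1), of i] e(1)[OF that]]
      show "u powi i * e i \<in> tot" by (rule h(1))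
      have "?\<alpha> - zmul i \<gamma> \<notin> N" if "i \<noteq> j"
      proof
        assume "?\<alpha> - zmul i \<gamma> \<in> N"
        then have "(?\<alpha> - zmul i \<gamma>) - \<nu> \<in> N" using subgrD(2)[OF N _ True] by blast
        then have "zmul (j - i) \<gamma> \<in> N" by (simp add: zm.scale_left_diff_distrib)
        then show False using \<gamma> that by fastforce
      qed
      then show "comp (u powi i * e i) ?\<alpha> = (if i = j then u powi j * comp (e j) \<nu> else 0)"
        unfolding h(2) using e(2)[OF \<open>i \<in> F\<close>] by (auto simp: supp_def)
    qed
    have "comp (\<Sum>i\<in>F. u powi i * e i) ?\<alpha> = (\<Sum>i\<in>F. comp (u powi i * e i) ?\<alpha>)"
      using comp_sum[of F "\<lambda>i. u powi i * e i"] c(1) by blast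
    also have "\<dots> = (\<Sum>i\<in>F. if i = j then u powi j * comp (e j) \<nu> else 0)"
      by (rule sum.cong) (use c(2) in auto)
    also have "\<dots> = u powi j * comp (e j) \<nu>" using F(1,4) by simp
    finally have "u powi j * comp (e j) \<nu> = 0" using F(3) by (simp add: mult.commute comp_0)
    then show ?thesis using u(2) by simp
  qed
  then have "supp (e j) = {}" by (auto simp: supp_def)
  then show ?thesis using supp_empty[OF e(1)[OF F(4)]] by simp
qed

text \<open>The ring of the extended subgroup is graded by the integers inside the Laurent polynomials in u
  over the fraction field L.\<close>

lemma t_inv_extend:
  assumes N: "subgr N" and \<gamma>: "\<And>k. zmul k \<gamma> \<in> N \<Longrightarrow> k = 0" and u: "u \<in> U \<gamma>" "u \<noteq> 0"
    and IH: "\<And>A a. finite A \<Longrightarrow> A \<subseteq> sub N \<Longrightarrow> a \<in> A \<Longrightarrow> a \<noteq> 0 \<Longrightarrow> t_inv (sub N) A"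
    and N': "N' = {x. \<exists>k. x - zmul k \<gamma> \<in> N}"
    and A: "finite A" "A \<subseteq> sub N'" "a \<in> A" "a \<noteq> 0"
  shows "t_inv (sub N') A"
proof -
  have N'1: "subgr N'" unfolding subgr_def
  proof (intro conjI ballI)
    show "0 \<in> N'" unfolding N' using subgrD(1)[OF N] by (auto intro!: exI[of _ 0])
    fix x y assume "x \<in> N'" "y \<in> N'"
    then obtain k l where "x - zmul k \<gamma> \<in> N" "y - zmul l \<gamma> \<in> N" unfolding N' by auto
    then have "(x - zmul k \<gamma>) - (y - zmul l \<gamma>) \<in> N" using subgrD(2)[OF N] by blast
    moreover have "(x - zmul k \<gamma>) - (y - zmul l \<gamma>) = (x - y) - zmul (k - l) \<gamma>"
      by (simp add: zm.scale_left_diff_distrib)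
    ultimately show "x - y \<in> N'" unfolding N' by auto
  qed
  have NN': "N \<subseteq> N'" unfolding N' by (auto intro!: exI[of _ 0])
  have \<gamma>N': "zmul i \<gamma> \<in> N'" for i unfolding N' using subgrD(1)[OF N] by (auto intro!: exI[of _ i])
  let ?M = "sub N" and ?T = "sub N'"
  have MT: "?M \<subseteq> ?T" using NN' by (auto simp: sub_def)
  note ringM = subring_sub[OF N] and ringT = subring_sub[OF N'1]
  note M1 = subringD[OF ringM] and T1 = subringD[OF ringT]
  have uT: "u powi i \<in> ?T" for i using sub_hom[OF \<gamma>N' U_powi[OF u(1)]] .
  define L where "L = {a / b | a b. a \<in> ?M \<and> b \<in> ?M \<and> b \<noteq> 0}"
  have LI: "a / b \<in> L" if "a \<in> ?M" "b \<in> ?M" "b \<noteq> 0" for a b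
    using that by (auto simp: L_def)
  have MsubL: "?M \<subseteq> L" using LI[of _ 1] M1 by auto
  have ringL: "subring L" unfolding subring_def
  proof (intro conjI ballI)
    show "0 \<in> L" "1 \<in> L" using MsubL M1 by auto
    fix x y assume "x \<in> L" "y \<in> L"
    then obtain a b c d where *: "x = a / b" "a \<in> ?M" "b \<in> ?M" "b \<noteq> 0" "y = c / d" "c \<in> ?M" "d \<in> ?M" "d \<noteq> 0"
      unfolding L_def by auto
    have "x + y = (a * d + c * b) / (b * d)" "x * y = (a * c) / (b * d)" "- x = (- a) / b" using * by (auto simp: field_simps)
    then show "x + y \<in> L" "x * y \<in> L" "- x \<in> L" using * M1 LI by (metis no_zero_divisors)+
  qed
  note L1 = subringD[OF ringL]
  have Linv: "inverse x \<in> L" if x: "x \<in> L" for x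
  proof -
    obtain a b where *: "x = a / b" "a \<in> ?M" "b \<in> ?M" "b \<noteq> 0" using x unfolding L_def by auto
    show ?thesis
    proof (cases "a = 0")
      case True
      then show ?thesis using * L1 by simp
    next
      case False
      then show ?thesis using * LI[of b a] by simp
    qed
  qed
  have Lden: "\<exists>d\<in>?M. d \<noteq> 0 \<and> d * x \<in> ?M" if x: "x \<in> L" for x
  proof -
    obtain a b where *: "x = a / b" "a \<in> ?M" "b \<in> ?M" "b \<noteq> 0" using x unfolding L_def by auto
    then show ?thesis by (intro bexI[of _ b]) auto
  qed
  \<comment> \<open>The grading of the Laurent polynomials by powers of \<open>u\<close>; its
    homogeneous elements are invertible because \<open>L\<close> is a field.\<close>
  define V where "V i = (\<lambda>c. c * u powi i) ` L" for i :: int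
  have VI: "c * u powi i \<in> V i" if "c \<in> L" for c i using that by (auto simp: V_def)
  have VE: "\<exists>c\<in>L. x = c * u powi i" if "x \<in> V i" for x i using that by (auto simp: V_def)
  interpret V: graded_field V
  proof
    fix i j :: int and x y
    show "0 \<in> V i" using VI[OF L1(1), of i] by simp
    show "1 \<in> V 0" using VI[OF L1(2), of 0] by simp
    show "x - y \<in> V i" if "x \<in> V i" "y \<in> V i"
    proof -
      obtain c d where "x = c * u powi i" "y = d * u powi i" "c \<in> L" "d \<in> L" using VE \<open>x \<in> V i\<close> \<open>y \<in> V i\<close> by blast
      then show ?thesis using VI[OF L1(6)[of c d], of i] by (simp add: left_diff_distrib)
    qed
    show "x * y \<in> V (i + j)" if "x \<in> V i" "y \<in> V j"
    proof -
      obtain c d where *: "x = c * u powi i" "y = d * u powi j" "c \<in> L" "d \<in> L" using VE \<open>x \<in> V i\<close> \<open>y \<in> V j\<close> by blast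
      have "x * y = (c * d) * u powi (i + j)" using * u by (simp add: power_int_add ac_simps)
      then show ?thesis using VI[OF L1(4)[OF *(3,4)], of "i + j"] by metis
    qed
    show "inverse x \<in> V (- i)" if "x \<in> V i"
    proof -
      obtain c where *: "x = c * u powi i" "c \<in> L" using VE \<open>x \<in> V i\<close> by blast
      have "inverse x = inverse c * u powi (- i)" using * u by (simp add: power_int_minus)
      then show ?thesis using VI[OF Linv[OF *(2)], of "- i"] by metis
    qed
  next
    fix F :: "int set" and f and j
    assume F: "finite F" "\<And>i. i \<in> F \<Longrightarrow> f i \<in> V i" "(\<Sum>i\<in>F. f i) = 0" "j \<in> F"
    have "\<exists>c\<in>L. f i = c * u powi i" if "i \<in> F" for i using VE F(2) that by blast
    then obtain c where c: "\<And>i. i \<in> F \<Longrightarrow> c i \<in> L \<and> f i = c i * u powi i" by metis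
    \<comment> \<open>\<open>infinite_order_indep\<close> takes coefficients in
      \<open>sub N\<close>, so the coefficients in \<open>L\<close> are first brought there by a
      common denominator.\<close>
    have "\<exists>d\<in>?M. d \<noteq> 0 \<and> (\<forall>i\<in>F. d * c i \<in> ?M)"
      by (rule common_denominator[OF ringM _ F(1)]) (use M1 Lden c in auto)
    then obtain d where d: "d \<noteq> 0" "\<And>i. i \<in> F \<Longrightarrow> d * c i \<in> ?M" by auto
    have "(\<Sum>i\<in>F. (d * c i) * u powi i) = d * (\<Sum>i\<in>F. f i)"
      unfolding sum_distrib_left by (rule sum.cong) (use c in auto)
    then have "(\<Sum>i\<in>F. (d * c i) * u powi i) = 0" using F(3) by simp
    from infinite_order_indep[OF N \<gamma> u F(1) d(2) this F(4)] have "c j = 0" using d(1) by simp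
    then show "f j = 0" using c F(4) by simp
  qed
  have V_in: "x \<in> V.tot" if "x \<in> V i" for x i using V.comp_hom(1)[OF that] .
  have totV: "V.tot = prodm L (range (\<lambda>i::int. u powi i))"
  proof
    note ringV = subringD[OF V.subring_tot]
    show "prodm L (range (\<lambda>i::int. u powi i)) \<subseteq> V.tot"
      by (rule prodm_least) (use ringV V_in[OF VI] in auto)
    show "V.tot \<subseteq> prodm L (range (\<lambda>i::int. u powi i))"
    proof
      fix x assume "x \<in> V.tot"
      note x = V.comp_spec[OF this]
      have "(\<Sum>i\<in>V.supp x. V.comp x i) \<in> prodm L (range (\<lambda>i::int. u powi i))"
      proof (rule sum_closed)
        fix i
        obtain c where "c \<in> L" "V.comp x i = c * u powi i" using VE[OF x(2)] by blast
        then show "V.comp x i \<in> prodm L (range (\<lambda>i::int. u powi i))" by (auto intro: prodm_mem)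
      qed (auto intro: prodm_0 prodm_add)
      then show "x \<in> prodm L (range (\<lambda>i::int. u powi i))" using x(3) by simp
    qed
  qed
  have homT: "V.homog ?T"
  proof (rule V.homogI)
    fix x assume x: "x \<in> ?T"
    then have xt: "x \<in> tot" "supp x \<subseteq> N'" by (auto simp: sub_def)
    have "\<forall>\<alpha>\<in>supp x. \<exists>k. \<alpha> - zmul k \<gamma> \<in> N" using xt(2) N' by auto
    then obtain k where k: "\<And>\<alpha>. \<alpha> \<in> supp x \<Longrightarrow> \<alpha> - zmul (k \<alpha>) \<gamma> \<in> N" by metis
    \<comment> \<open>The part of \<open>x\<close> in the coset of \<open>N\<close> through
      \<open>zmul i \<gamma>\<close>. Divided by the i-th power of \<open>u\<close> it is supported
      in \<open>N\<close>, so it is homogeneous for the integer grading.\<close>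
    let ?f = "\<lambda>i. \<Sum>\<alpha>\<in>{\<alpha>\<in>supp x. k \<alpha> = i}. comp x \<alpha>"
    have fin: "finite (supp x)" using comp_spec(1)[OF xt(1)] .
    have "(\<Sum>i\<in>k ` supp x. ?f i) = (\<Sum>\<alpha>\<in>supp x. comp x \<alpha>)"
      by (rule sum.group) (use fin in auto)
    then have 1: "x = (\<Sum>i\<in>k ` supp x. ?f i)" using comp_spec(3)[OF xt(1)] by simp
    have 2: "?f i \<in> ?T \<inter> V i" for i
    proof (rule sum_closed)
      show "0 \<in> ?T \<inter> V i" using T1 V.U_0 by auto
      show "x + y \<in> ?T \<inter> V i" if "x \<in> ?T \<inter> V i" "y \<in> ?T \<inter> V i" for x y
        using that T1 V.U_add by auto
    next
      fix \<alpha> assume \<alpha>: "\<alpha> \<in> {\<alpha> \<in> supp x. k \<alpha> = i}"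
      have "zmul (- i) \<gamma> + \<alpha> \<in> N" using k[of \<alpha>] \<alpha> by simp
      then have "u powi (- i) * comp x \<alpha> \<in> ?M"
        using sub_hom[OF _ U_mult[OF U_powi[OF u(1), of "- i"] comp_spec(2)[OF xt(1), of \<alpha>]]] by blast
      then have "u powi (- i) * comp x \<alpha> * u powi i \<in> V i" using VI MsubL by blast
      moreover have "u powi (- i) * comp x \<alpha> * u powi i = comp x \<alpha>" using u(2) by (simp add: power_int_minus field_simps)
      moreover have "comp x \<alpha> \<in> ?T" using sub_hom[OF _ comp_spec(2)[OF xt(1)]] \<alpha> xt(2) by blast
      ultimately show "comp x \<alpha> \<in> ?T \<inter> V i" by simp
    qed
    show "\<exists>F f. finite F \<and> (\<forall>i\<in>F. f i \<in> ?T \<inter> V i) \<and> x = (\<Sum>i\<in>F. f i)"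
      using 1 2 fin by (intro exI[of _ "k ` supp x"] exI[of _ ?f]) blast
  qed (rule T1)
  have MT_mult: "d * x \<in> ?T" if "d \<in> ?M" "x \<in> ?T" for d x using that MT T1 by blast
  have Tden: "\<exists>d\<in>?M. d \<noteq> 0 \<and> d * x \<in> ?T" if x: "x \<in> V.tot" for x
  proof -
    have "\<exists>d\<in>?M. d \<noteq> 0 \<and> (\<forall>i\<in>V.supp x. d * V.comp x i \<in> ?T)"
    proof (rule common_denominator[OF ringM MT_mult V.comp_spec(1)[OF x]])
      fix i
      obtain c where c: "c \<in> L" "V.comp x i = c * u powi i" using VE[OF V.comp_spec(2)[OF x]] by blast
      obtain d where d: "d \<in> ?M" "d \<noteq> 0" "d * c \<in> ?M" using Lden[OF c(1)] by auto
      have "(d * c) * u powi i \<in> ?T" using d(3) uT by (rule MT_mult)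
      then show "\<exists>d\<in>?M. d \<noteq> 0 \<and> d * V.comp x i \<in> ?T" using d c by (auto simp: mult.assoc)
    qed
    then obtain d where d: "d \<in> ?M" "d \<noteq> 0" "\<And>i. i \<in> V.supp x \<Longrightarrow> d * V.comp x i \<in> ?T" by auto
    have "(\<Sum>i\<in>V.supp x. d * V.comp x i) \<in> ?T" by (rule sum_closed) (use T1 d in auto)
    then have "d * x \<in> ?T" using V.comp_spec(3)[OF x] by (simp flip: sum_distrib_left)
    then show ?thesis using d by auto
  qed
  have scale: "\<exists>i h. h \<in> V i \<and> h \<noteq> 0 \<and> (\<forall>x\<in>X. h * x \<in> ?T)" if X: "finite X" "X \<subseteq> V.tot" for X
  proof -
    have "\<exists>d\<in>?M. d \<noteq> 0 \<and> (\<forall>x\<in>X. d * x \<in> ?T)"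
      by (rule common_denominator[OF ringM MT_mult X(1)]) (use Tden X(2) in auto)
    then obtain d where "d \<in> ?M" "d \<noteq> 0" "\<forall>x\<in>X. d * x \<in> ?T" by auto
    moreover have "d \<in> V 0" using VI[of d 0] MsubL \<open>d \<in> ?M\<close> by auto
    ultimately show ?thesis by blast
  qed
  \<comment> \<open>Powers of \<open>u\<close> are units of the ring over \<open>N'\<close>. After
    removing them and clearing denominators the set lies in \<open>sub N\<close>; there the
    induction hypothesis applies, and its witness persists over \<open>N'\<close>.\<close>
  have H: "t_inv ?T C" if C: "finite C" "C \<noteq> {}" "\<forall>c\<in>C. c \<noteq> 0 \<and> (\<exists>i. c \<in> V i)" for C
  proof -
    have "\<forall>x\<in>C. \<exists>i. x * u powi (- i) \<in> L"
    proof
      fix x assume "x \<in> C"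
      then obtain i c where "c \<in> L" "x = c * u powi i" using C(3) VE by metis
      then have "x * u powi (- i) \<in> L" using u(2) by (simp add: power_int_minus mult.assoc)
      then show "\<exists>i. x * u powi (- i) \<in> L" ..
    qed
    then obtain i where i: "\<And>x. x \<in> C \<Longrightarrow> x * u powi (- i x) \<in> L" by metis
    have "\<exists>d\<in>?M. d \<noteq> 0 \<and> (\<forall>x\<in>C. d * (x * u powi (- i x)) \<in> ?M)"
      by (rule common_denominator[OF ringM _ C(1)]) (use M1 Lden i in auto)
    then obtain d where d: "d \<noteq> 0" "\<And>x. x \<in> C \<Longrightarrow> d * (x * u powi (- i x)) \<in> ?M" by auto
    let ?g = "\<lambda>x. d * (x * u powi (- i x))"
    obtain c where c: "c \<in> C" using C(2) by auto
    have c0: "?g c \<noteq> 0" using C(3) c d(1) u(2) by auto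
    have "t_inv ?M (?g ` C)"
      by (rule IH[of _ "?g c"]) (use C(1) d(2) c c0 in auto)
    then have "t_inv ?T (?g ` C)"
      using t_inv_sub_mono[OF N N'1 NN' _ _ c0] c by blast
    then show ?thesis
    proof (rule t_inv_rescale[OF _ ringT d(1)])
      fix y assume "y \<in> ?g ` C"
      then obtain x where x: "x \<in> C" "y = ?g x" by auto
      have "y = u powi (- i x) * (x * d)" using x by (simp add: ac_simps)
      then show "\<exists>t\<in>?T. \<exists>a'\<in>C. y = t * (a' * d)" using uT x by blast
    next
      fix x assume x: "x \<in> C"
      have "x * d = u powi (i x) * ?g x" using u(2) by (simp add: power_int_minus field_simps)
      then show "\<exists>t\<in>?T. \<exists>a\<in>?g ` C. x * d = t * a" using uT x by blast
    qed
  qed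
  have AV: "A \<subseteq> V.tot" using A(2) homT unfolding V.homog_def by auto
  have "t_inv V.tot A"
    by (rule laurent_principal[OF ringL Linv u(2) totV AV A(3,4)])
  from V.t_inv_from_homogeneous[OF ringT homT unique_sums_int scale H this A(1) AV A(3,4)]
  show ?thesis .
qed

lemma subgr_degrees: "subgr {\<alpha>. U \<alpha> \<noteq> {0}}"
  unfolding subgr_def
proof (intro conjI ballI)
  show "0 \<in> {\<alpha>. U \<alpha> \<noteq> {0}}" using U_1 by auto
  fix \<alpha> \<beta> assume "\<alpha> \<in> {\<alpha>. U \<alpha> \<noteq> {0}}" "\<beta> \<in> {\<alpha>. U \<alpha> \<noteq> {0}}"
  then obtain x y where *: "x \<in> U \<alpha>" "y \<in> U \<beta>" "x \<noteq> 0" "y \<noteq> 0" using U_0[of \<alpha>] U_0[of \<beta>] by blast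
  have "x * inverse y \<in> U (\<alpha> - \<beta>)" using U_mult[OF *(1) U_inverse[OF *(2)]] by simp
  moreover have "x * inverse y \<noteq> 0" using *(3,4) by simp
  ultimately show "\<alpha> - \<beta> \<in> {\<alpha>. U \<alpha> \<noteq> {0}}" unfolding mem_Collect_eq by (metis singletonD)
qed

text \<open>Induction over the basis. At the start only degree 0 is left and \<open>sub {0}\<close>
  is the field \<open>U 0\<close>; each further basis element has infinite order modulo the span of
  the earlier ones, as the extension lemmas require.\<close>

lemma independent_span_properties:
  assumes "finite B" "B \<subseteq> {\<alpha>. U \<alpha> \<noteq> {0}}" "zm.independent B"
  shows "unique_sums (zm.span B) \<and>
    (\<forall>A a. finite A \<longrightarrow> A \<subseteq> sub (zm.span B) \<longrightarrow> a \<in> A \<longrightarrow> a \<noteq> 0 \<longrightarrow> t_inv (sub (zm.span B)) A)"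
  using assms
proof (induction B)
  case empty
  have "unique_sums {0 :: 'g}" unfolding unique_sums_def by blast
  moreover have "t_inv (sub {0}) A" if A: "finite A" "A \<subseteq> sub {0}" "a \<in> A" "a \<noteq> 0" for A a
  proof -
    have sub0: "x \<in> sub {0} \<longleftrightarrow> x \<in> U 0" for x
    proof
      assume "x \<in> sub {0}"
      then have "x \<in> tot" "supp x \<subseteq> {0}" by (auto simp: sub_def)
      from comp_sum_superset[OF this(1) _ this(2)] show "x \<in> U 0"
        using comp_spec(2)[OF \<open>x \<in> tot\<close>, of 0] by simp
    qed (simp add: sub_hom)
    have m: "x * y \<in> U 0" if "x \<in> U 0" "y \<in> U 0" for x y using U_mult[OF that] by simp
    have "a \<in> U 0" using A sub0 by auto
    then have ia: "inverse a \<in> U 0" using U_inverse[of a 0] by simp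
    show ?thesis
    proof (rule t_invI[of "{inverse a}" "inverse a"])
      fix x assume "\<And>a' b. a' \<in> A \<Longrightarrow> b \<in> {inverse a} \<Longrightarrow> x * (a' * b) \<in> sub {0}"
      from this[OF A(3)] show "x \<in> sub {0}" using A(4) by simp
    qed (use A m ia sub0 in auto)
  qed
  ultimately show ?case by simp
next
  case (insert b B)
  let ?N = "zm.span B" and ?N' = "zm.span (insert b B)"
  have ind: "zm.independent B" using insert(5) zm.independent_mono by blast
  have inf: "k = 0" if "zmul k b \<in> ?N" for k
    using independent_insert_zmul[OF insert(1,5,2) that] .
  obtain u where u: "u \<in> U b" "u \<noteq> 0" using insert(4) U_0[of b] by blast
  have IH: "unique_sums ?N" "\<And>A a. finite A \<Longrightarrow> A \<subseteq> sub ?N \<Longrightarrow> a \<in> A \<Longrightarrow> a \<noteq> 0 \<Longrightarrow> t_inv (sub ?N) A"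
    using insert(3)[OF _ ind] insert(4) by auto
  have "unique_sums ?N'" unfolding zm.span_insert
    by (rule unique_sums_extend[OF subgr_span IH(1) inf])
  moreover have "t_inv (sub ?N') A" if "finite A" "A \<subseteq> sub ?N'" "a \<in> A" "a \<noteq> 0" for A a
    by (rule t_inv_extend[OF subgr_span inf u IH(2) zm.span_insert that])
  ultimately show ?case by blast
qed

context
  assumes tf: "torsion_free {\<alpha>. U \<alpha> \<noteq> {0}}"
begin

lemma unique_sums_degrees: "unique_sums {\<alpha>. U \<alpha> \<noteq> {0}}"
  unfolding unique_sums_def
proof (intro allI impI)
  fix A B :: "'g set"
  assume *: "finite A" "A \<noteq> {}" "A \<subseteq> {\<alpha>. U \<alpha> \<noteq> {0}}" "finite B" "B \<noteq> {}" "B \<subseteq> {\<alpha>. U \<alpha> \<noteq> {0}}"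
  then obtain S where S: "finite S" "S \<subseteq> {\<alpha>. U \<alpha> \<noteq> {0}}" "A \<union> B \<subseteq> zm.span S" "zm.independent S"
    using finite_subset_independent_span[OF subgr_degrees tf, of "A \<union> B"] by auto
  then have "unique_sums (zm.span S)" using independent_span_properties by blast
  moreover have "A \<subseteq> zm.span S" "B \<subseteq> zm.span S" using S(3) by auto
  ultimately show "\<exists>a\<in>A. \<exists>b\<in>B. \<forall>a'\<in>A. \<forall>b'\<in>B. a' + b' = a + b \<longrightarrow> a' = a \<and> b' = b"
    using * unfolding unique_sums_def by simp
qed

text \<open>Finitely many degrees occur in \<open>A\<close>, so a witness exists over a free
  subgroup of finite rank; \<open>t_inv_sub_mono\<close> enlarges that subgroup to the whole
  type.\<close>

lemma t_inv_tot:
  assumes A: "finite A" "A \<subseteq> tot" "a \<in> A" "a \<noteq> 0"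
  shows "t_inv tot A"
proof -
  let ?X = "\<Union>a\<in>A. supp a"
  have "finite ?X" using A comp_spec(1) by auto
  moreover have "?X \<subseteq> {\<alpha>. U \<alpha> \<noteq> {0}}"
  proof
    fix \<alpha> assume "\<alpha> \<in> ?X"
    then obtain x where x: "x \<in> A" "comp x \<alpha> \<noteq> 0" by (auto simp: supp_def)
    then have "comp x \<alpha> \<in> U \<alpha>" using A(2) comp_spec(2) by auto
    then show "\<alpha> \<in> {\<alpha>. U \<alpha> \<noteq> {0}}" using x(2) by auto
  qed
  ultimately obtain S where S: "finite S" "S \<subseteq> {\<alpha>. U \<alpha> \<noteq> {0}}" "?X \<subseteq> zm.span S" "zm.independent S"
    using finite_subset_independent_span[OF subgr_degrees tf, of ?X] by auto
  have "A \<subseteq> sub (zm.span S)" using A(2) S(3) by (auto simp: sub_def)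
  then have "t_inv (sub (zm.span S)) A" using independent_span_properties[OF S(1,2,4)] A by simp
  moreover have "subgr (UNIV :: 'g set)" by (simp add: subgr_def)
  ultimately have "t_inv (sub UNIV) A"
    using t_inv_sub_mono[OF subgr_span, of UNIV S A a] A(3,4) by simp
  moreover have "sub UNIV = tot" by (simp add: sub_def)
  ultimately show ?thesis by simp
qed

end

end

section \<open>The t-operation and integral closure\<close>

lemma colon_antimono: "E \<subseteq> F \<Longrightarrow> colon T F \<subseteq> colon T E"
  unfolding colon_def by auto

lemma colon_self: "subring T \<Longrightarrow> colon T T = T"
  unfolding colon_def using subringD(2,4)[of T] by fastforce

lemma t_op_eq_ring:
  assumes "subring T"
  shows "t_op T T = T"
proof
  have "v_op T F \<subseteq> T" if "F \<subseteq> T" for F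
    using colon_antimono[OF colon_antimono[OF that, of T], of T] by (simp add: v_op_def colon_self[OF assms])
  then show "t_op T T \<subseteq> T" unfolding t_op_def star_f_def by blast
  have "T = prodm T {1}"
    using span_subset_ring[of "{1}" T, OF _ assms] prodm_least[of T T "{1}"] subringD[OF assms] by auto
  then have "fg T T" unfolding fg_def by blast
  moreover have "T \<noteq> {0}" using subringD(2)[OF assms] by auto
  moreover have "Defs.frac T T" unfolding Defs.frac_def using subring_submod[OF assms] by (auto intro!: exI[of _ 1])
  ultimately have "v_op T T \<subseteq> t_op T T" unfolding t_op_def star_f_def by blast
  then show "T \<subseteq> t_op T T" unfolding v_op_def by (simp add: colon_self[OF assms])
qed

lemma frac_ideal: "submod T F \<Longrightarrow> F \<subseteq> T \<Longrightarrow> Defs.frac T F"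
  unfolding Defs.frac_def by (auto intro!: exI[of _ 1])

text \<open>The products of \<open>S\<close> and \<open>B\<close> generate a submodule F of I (T :
  I) with (T : F) inside T, so the v-closure of F contains T. As \<open>star_f_inv\<close> applies
  \<open>star_f\<close> to \<open>t_op\<close>, itself of the form \<open>star_f\<close>, the same F
  is used at both levels.\<close>

lemma t_inv_imp_star_f_inv:
  assumes T: "subring T" and "finite S" "t_inv T S" "a \<in> S" "a \<noteq> 0"
  shows "star_f_inv T (t_op T) (prodm T S)"
proof -
  let ?I = "prodm T S"
  let ?J = "prodm ?I (colon T ?I)"
  obtain B b where B: "finite B" "b \<in> B" "b \<noteq> 0" "\<forall>a\<in>S. \<forall>b\<in>B. a * b \<in> T"
    "\<forall>x. (\<forall>a\<in>S. \<forall>b\<in>B. x * (a * b) \<in> T) \<longrightarrow> x \<in> T"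
    using t_invE[OF assms(3)] .
  have JT: "?J \<subseteq> T" by (rule prodm_colon_subset[OF T])
  have "star_f T (t_op T) ?J = T"
  proof
    have "t_op T F \<subseteq> T" if "F \<subseteq> ?J" for F
    proof -
      have "v_op T F' \<subseteq> T" if "F' \<subseteq> F" for F'
        using colon_antimono[OF colon_antimono[of F' T T], of T] that \<open>F \<subseteq> ?J\<close> JT
        by (auto simp: v_op_def colon_self[OF T])
      then show ?thesis unfolding t_op_def star_f_def by blast
    qed
    then show "star_f T (t_op T) ?J \<subseteq> T" unfolding star_f_def by blast
    let ?P = "(\<lambda>(a, b). a * b) ` (S \<times> B)"
    let ?F = "prodm T ?P"
    have subm: "submod T ?F" by (rule submod_span[OF T])
    have "b \<in> colon T ?I" if "b \<in> B" for b
      unfolding colon_span[OF T] using B(4) that by (simp add: colon_def mult.commute[of b])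
    then have "?P \<subseteq> ?J" using span_base[OF T] by (auto intro!: prodm_mem)
    then have FJ: "?F \<subseteq> ?J" by (intro span_least submod_prodm submod_span T)
    have "(\<lambda>(a, b). a * b) (a, b) \<in> ?P" using assms(4) B(2) by (intro imageI) simp
    then have "a * b \<in> ?F" using span_base[OF T, of "a * b" ?P] by simp
    moreover have "a * b \<notin> {0}" using assms(5) B(3) by simp
    ultimately have F0: "?F \<noteq> {0}" by metis
    have "finite ?P" using assms(2) B(1) by simp
    then have fgF: "fg T ?F" unfolding fg_def by (intro exI[of _ ?P]) simp
    have fr: "Defs.frac T ?F" using frac_ideal[OF subm] FJ JT by blast
    have "x \<in> T" if "x \<in> colon T ?F" for x
      using that B(5) unfolding colon_span[OF T] by (simp add: colon_def)
    then have "colon T ?F \<subseteq> T" by blast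
    then have "T \<subseteq> v_op T ?F" unfolding v_op_def using colon_antimono[of "colon T ?F" T T] colon_self[OF T] by simp
    also have "\<dots> \<subseteq> t_op T ?F" unfolding t_op_def star_f_def using F0 fgF fr by blast
    also have "\<dots> \<subseteq> star_f T (t_op T) ?J" unfolding star_f_def[of T "t_op T"] using F0 fgF fr FJ by blast
    finally show "T \<subseteq> star_f T (t_op T) ?J" .
  qed
  then show ?thesis unfolding star_f_inv_def by (simp add: t_op_eq_ring[OF T])
qed

text \<open>That 1 lies in the v-closure of F means precisely that (T : F) lies in T, and a larger
  module has a smaller inverse.\<close>

lemma t_op_unit_colon:
  assumes "1 \<in> t_op T J"
  shows "colon T J \<subseteq> T"
proof -
  obtain F where "F \<subseteq> J" "1 \<in> v_op T F" using assms unfolding t_op_def star_f_def by auto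
  then show ?thesis using colon_antimono[of F J T] unfolding v_op_def by (auto simp: colon_def[of T "colon T F"])
qed

lemma star_f_inv_imp_colon:
  assumes "subring T" "star_f_inv T (t_op T) I"
  shows "colon T (prodm I (colon T I)) \<subseteq> T"
proof -
  have "1 \<in> star_f T (t_op T) (prodm I (colon T I))"
    using assms(2) subringD(2)[OF assms(1)] unfolding star_f_inv_def by (simp add: t_op_eq_ring[OF assms(1)])
  then obtain F where "F \<subseteq> prodm I (colon T I)" "1 \<in> t_op T F" unfolding star_f_def by auto
  then show ?thesis using t_op_unit_colon[of T F] colon_antimono by blast
qed

text \<open>If x is integral over T, then x maps some nonzero finitely generated ideal I into itself,
  hence multiplies I (T : I) into T.\<close>

lemma PvMD_integrally_closed:
  assumes T: "subring T" and quot: "\<And>x. \<exists>a\<in>T. \<exists>b\<in>T. b \<noteq> 0 \<and> x = a / b" and "PvMD T"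
  shows "integrally_closed T"
  unfolding integrally_closed_def
proof (intro allI impI)
  fix x assume "\<exists>n c. (\<forall>i<n. c i \<in> T) \<and> x ^ n + (\<Sum>i<n. c i * x ^ i) = 0"
  then obtain n c where c: "\<And>i. i < n \<Longrightarrow> c i \<in> T" "x ^ n + (\<Sum>i<n. c i * x ^ i) = 0" by blast
  have n: "n > 0" using c(2) by (cases n) auto
  note T1 = subringD[OF T]
  obtain a b where ab: "a \<in> T" "b \<in> T" "b \<noteq> 0" "x = a / b" using quot by blast
  \<comment> \<open>The powers of \<open>x\<close> below \<open>n\<close> span a module stable under
    \<open>x\<close>; the factor \<open>b ^ n\<close> clears their denominators, so that it becomes
    an ideal of T.\<close>
  let ?S = "(\<lambda>i. b ^ n * x ^ i) ` {..<n}"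
  define I where "I = prodm T ?S"
  have sub: "submod T I" unfolding I_def by (rule submod_span[OF T])
  note I1 = submodD[OF sub]
  have S: "b ^ n * x ^ i \<in> I" if "i < n" for i unfolding I_def by (rule span_base[OF T]) (use that in auto)
  have "?S \<subseteq> T"
  proof
    fix y assume "y \<in> ?S"
    then obtain i where i: "i < n" "y = b ^ n * x ^ i" by auto
    have "b ^ n = b ^ (n - i) * b ^ i" using i(1) by (simp flip: power_add)
    then have "y = b ^ (n - i) * a ^ i" using i(2) ab(3,4) by (simp add: power_divide)
    then show "y \<in> T" using T1 ab by simp
  qed
  then have IT: "I \<subseteq> T" unfolding I_def by (rule span_least[OF subring_submod[OF T]])
  have "I \<noteq> {0}" using S[OF n] ab(3) by auto
  moreover have "fg T I" unfolding fg_def I_def by blast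
  ultimately have *: "colon T (prodm I (colon T I)) \<subseteq> T"
    using assms(3) sub IT star_f_inv_imp_colon[OF T] unfolding PvMD_def ideal_of_def by blast
  have xS: "x * (b ^ n * x ^ i) \<in> I" if i: "i < n" for i
  proof (cases "Suc i < n")
    case True
    then show ?thesis using S[of "Suc i"] by (simp add: mult.left_commute)
  next
    case False
    then have "Suc i = n" using i by simp
    then have "x * (b ^ n * x ^ i) = b ^ n * x ^ n" by (auto simp: mult.left_commute)
    also have "x ^ n = - (\<Sum>j<n. c j * x ^ j)" using c(2) by (simp add: eq_neg_iff_add_eq_0)
    also have "b ^ n * \<dots> = (\<Sum>j<n. (- c j) * (b ^ n * x ^ j))"
      by (simp add: sum_distrib_left sum_negf mult.left_commute)
    also have "\<dots> \<in> I" by (rule sum_closed) (use I1 S c(1) T1(5) in blast)+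
    finally show ?thesis .
  qed
  have xI: "x * y \<in> I" if "y \<in> I" for y
  proof (rule prodm_mult_closed[of y T ?S])
    show "y \<in> prodm T ?S" using that by (simp add: I_def)
    fix t s assume t: "t \<in> T" and "s \<in> ?S"
    then obtain i where i: "i < n" "s = b ^ n * x ^ i" by auto
    show "x * (t * s) \<in> I" using I1(3)[OF t xS[OF i(1)]] unfolding i(2) by (simp add: mult.left_commute)
  qed (use I1 in auto)
  have "x * y \<in> T" if "y \<in> prodm I (colon T I)" for y
  proof (rule prodm_mult_closed[OF that])
    fix y c assume "y \<in> I" "c \<in> colon T I"
    then have "c * (x * y) \<in> T" using xI by (auto simp: colon_def)
    then show "x * (y * c) \<in> T" by (simp add: ac_simps)
  qed (use T1 in auto)
  then show "x \<in> T" using * by (auto simp: colon_def)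
qed

text \<open>Extracts from an inverse the finite witness that \<open>t_inv\<close> asks for.\<close>

lemma prodm_finite_right:
  assumes "finite S" "S \<subseteq> prodm A D"
  shows "\<exists>B. finite B \<and> B \<subseteq> D \<and> S \<subseteq> prodm A B"
  using assms
proof (induction S)
  case empty
  then show ?case by blast
next
  case (insert x S)
  then obtain B where B: "finite B" "B \<subseteq> D" "S \<subseteq> prodm A B" by auto
  have "x \<in> prodm A D" using insert by auto
  then obtain n :: nat and f g where x: "\<forall>i<n. f i \<in> A \<and> g i \<in> D" "x = (\<Sum>i<n. f i * g i)"
    unfolding prodm_def by auto
  let ?B = "B \<union> g ` {..<n}"
  have "f i * g i \<in> prodm A ?B" if "i < n" for i by (rule prodm_mem) (use x(1) that in auto)
  then have "x \<in> prodm A ?B" unfolding x(2) by (intro sum_closed) (auto intro: prodm_0 prodm_add)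
  moreover have "S \<subseteq> prodm A ?B" using B(3) prodm_mono[of A A B ?B] by auto
  ultimately show ?case using B x(1) by (intro exI[of _ ?B]) auto
qed

section \<open>The homogeneous quotient field\<close>

locale graded_dom =
  fixes \<Gamma> :: "'g::ab_group_add set" and G :: "'g \<Rightarrow> 'k::field set" and R :: "'k set"
  assumes graded: "graded_domain \<Gamma> G R"
begin

lemma \<Gamma>_add: "\<alpha> \<in> \<Gamma> \<Longrightarrow> \<beta> \<in> \<Gamma> \<Longrightarrow> \<alpha> + \<beta> \<in> \<Gamma>"
  and \<Gamma>_torsion_free: "torsion_free (grp \<Gamma>)"
  and R_ring: "subring R"
  and R_quot: "\<exists>a\<in>R. \<exists>b\<in>R. b \<noteq> 0 \<and> x = a / b"
  and G_sub: "\<alpha> \<in> \<Gamma> \<Longrightarrow> G \<alpha> \<subseteq> R"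
  and G_0: "\<alpha> \<in> \<Gamma> \<Longrightarrow> 0 \<in> G \<alpha>"
  and G_diff: "\<alpha> \<in> \<Gamma> \<Longrightarrow> y \<in> G \<alpha> \<Longrightarrow> z \<in> G \<alpha> \<Longrightarrow> y - z \<in> G \<alpha>"
  and G_mult: "\<alpha> \<in> \<Gamma> \<Longrightarrow> \<beta> \<in> \<Gamma> \<Longrightarrow> y \<in> G \<alpha> \<Longrightarrow> z \<in> G \<beta> \<Longrightarrow> y * z \<in> G (\<alpha> + \<beta>)"
  and G_decomp: "y \<in> R \<Longrightarrow> \<exists>F f. finite F \<and> F \<subseteq> \<Gamma> \<and> (\<forall>\<alpha>\<in>F. f \<alpha> \<in> G \<alpha>) \<and> y = (\<Sum>\<alpha>\<in>F. f \<alpha>)"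
  and G_indep: "finite F \<Longrightarrow> F \<subseteq> \<Gamma> \<Longrightarrow> (\<forall>\<alpha>\<in>F. f \<alpha> \<in> G \<alpha>) \<Longrightarrow> (\<Sum>\<alpha>\<in>F. f \<alpha>) = 0 \<Longrightarrow> \<forall>\<alpha>\<in>F. f \<alpha> = 0"
  using graded unfolding graded_domain_def torsion_free_def by simp_all

text \<open>Outside \<open>grp \<Gamma>\<close> the set \<open>RHg\<close> is empty. Adding 0 gives
  an additive group in every degree, as \<open>graded_field\<close> requires.\<close>

definition U :: "'g \<Rightarrow> 'k set" where
  "U \<alpha> = insert 0 (RHg \<Gamma> G \<alpha>)"

lemma ex_homog: "\<exists>\<gamma>\<in>\<Gamma>. \<exists>h\<in>G \<gamma>. h \<noteq> 0"
proof -
  obtain F f where "F \<subseteq> \<Gamma>" "\<forall>\<alpha>\<in>F. f \<alpha> \<in> G \<alpha>" "1 = (\<Sum>\<alpha>\<in>F. f \<alpha>)"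
    using G_decomp[OF subringD(2)[OF R_ring]] by blast
  then show ?thesis by (metis subsetD sum.neutral zero_neq_one)
qed

lemma U_I: "\<beta> \<in> \<Gamma> \<Longrightarrow> \<gamma> \<in> \<Gamma> \<Longrightarrow> a \<in> G \<beta> \<Longrightarrow> h \<in> G \<gamma> \<Longrightarrow> h \<noteq> 0 \<Longrightarrow> \<alpha> = \<beta> - \<gamma> \<Longrightarrow> a / h \<in> U \<alpha>"
  unfolding U_def RHg_def by auto

lemma U_E:
  assumes "x \<in> U \<alpha>" "x \<noteq> 0"
  obtains a h \<beta> \<gamma> where "x = a / h" "\<beta> \<in> \<Gamma>" "\<gamma> \<in> \<Gamma>" "a \<in> G \<beta>" "h \<in> G \<gamma>" "h \<noteq> 0" "\<alpha> = \<beta> - \<gamma>"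
  using assms unfolding U_def RHg_def by auto

lemma G_U:
  assumes "\<alpha> \<in> \<Gamma>" "x \<in> G \<alpha>"
  shows "x \<in> U \<alpha>"
proof -
  \<comment> \<open>That 1 has degree 0 is not part of \<open>graded_domain\<close>, so some nonzero
    homogeneous \<open>h\<close> serves as denominator instead.\<close>
  obtain \<gamma> h where h: "\<gamma> \<in> \<Gamma>" "h \<in> G \<gamma>" "h \<noteq> 0" using ex_homog by auto
  then have "(x * h) / h \<in> U \<alpha>"
    using assms by (intro U_I[of "\<alpha> + \<gamma>" \<gamma>] G_mult \<Gamma>_add) auto
  then show ?thesis using h by simp
qed

text \<open>The degrees \<open>\<delta> i + \<gamma>\<close> are tracked because \<open>G\<close> is
  constrained on \<open>\<Gamma>\<close> only. The elements are nonzero because 0 lies in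
  \<open>U\<close> in every degree, also in those that are not differences of elements of
  \<open>\<Gamma>\<close>.\<close>

lemma common_homog_denominator:
  assumes "finite I" "\<And>i. i \<in> I \<Longrightarrow> f i \<in> U (\<delta> i) \<and> f i \<noteq> 0"
  shows "\<exists>\<gamma>\<in>\<Gamma>. \<exists>h\<in>G \<gamma>. h \<noteq> 0 \<and> (\<forall>i\<in>I. \<delta> i + \<gamma> \<in> \<Gamma> \<and> h * f i \<in> G (\<delta> i + \<gamma>))"
  using assms
proof (induction I)
  case empty
  then show ?case using ex_homog by auto
next
  case (insert j I)
  then obtain \<gamma> h where h: "\<gamma> \<in> \<Gamma>" "h \<in> G \<gamma>" "h \<noteq> 0"
    "\<And>i. i \<in> I \<Longrightarrow> \<delta> i + \<gamma> \<in> \<Gamma> \<and> h * f i \<in> G (\<delta> i + \<gamma>)" by (metis insertI2)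
  have "f j \<in> U (\<delta> j)" "f j \<noteq> 0" using insert(4)[of j] by auto
  then obtain a k \<beta> \<epsilon> where k: "f j = a / k" "\<beta> \<in> \<Gamma>" "\<epsilon> \<in> \<Gamma>" "a \<in> G \<beta>" "k \<in> G \<epsilon>" "k \<noteq> 0" "\<delta> j = \<beta> - \<epsilon>"
    by (rule U_E)
  have "\<delta> i + (\<gamma> + \<epsilon>) \<in> \<Gamma> \<and> h * k * f i \<in> G (\<delta> i + (\<gamma> + \<epsilon>))" if "i \<in> insert j I" for i
  proof (cases "i = j")
    case True
    have "\<delta> i + (\<gamma> + \<epsilon>) = \<beta> + \<gamma>" unfolding True k(7) by simp
    moreover have "h * k * f i = a * h" unfolding True k(1) using k(6) by simp
    ultimately show ?thesis using G_mult[OF k(2) h(1) k(4) h(2)] \<Gamma>_add[OF k(2) h(1)] by metis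
  next
    case False
    then have i: "\<delta> i + \<gamma> \<in> \<Gamma>" "h * f i \<in> G (\<delta> i + \<gamma>)" using h(4) that by auto
    have "\<delta> i + (\<gamma> + \<epsilon>) = (\<delta> i + \<gamma>) + \<epsilon>" "h * k * f i = (h * f i) * k" by (auto simp: ac_simps)
    then show ?thesis using G_mult[OF i(1) k(3) i(2) k(5)] \<Gamma>_add[OF i(1) k(3)] by metis
  qed
  moreover have "h * k \<noteq> 0" using h k by simp
  ultimately show ?case using G_mult[OF h(1) k(3) h(2) k(5)] \<Gamma>_add[OF h(1) k(3)] by blast
qed

lemma U_scaleE:
  assumes "x \<in> U \<alpha>" "x \<noteq> 0"
  obtains \<gamma> h where "\<gamma> \<in> \<Gamma>" "h \<in> G \<gamma>" "h \<noteq> 0" "\<alpha> + \<gamma> \<in> \<Gamma>" "h * x \<in> G (\<alpha> + \<gamma>)"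
  using common_homog_denominator[of "{x}" id "\<lambda>_. \<alpha>"] assms by auto

lemma U_scaleI:
  assumes "\<gamma> \<in> \<Gamma>" "h \<in> G \<gamma>" "h \<noteq> 0" "\<alpha> + \<gamma> \<in> \<Gamma>" "h * x \<in> G (\<alpha> + \<gamma>)"
  shows "x \<in> U \<alpha>"
  using U_I[OF assms(4,1,5,2,3), of \<alpha>] assms(3) by simp

sublocale graded_field U
proof
  fix \<alpha> \<beta> :: 'g and x y :: 'k
  show U0: "0 \<in> U \<alpha>" by (simp add: U_def)
  show "1 \<in> U 0"
  proof -
    obtain \<gamma> h where "\<gamma> \<in> \<Gamma>" "h \<in> G \<gamma>" "h \<noteq> 0" using ex_homog by auto
    then show ?thesis using U_I[of \<gamma> \<gamma> h h 0] by simp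
  qed
  show "x - y \<in> U \<alpha>" if x: "x \<in> U \<alpha>" and y: "y \<in> U \<alpha>"
  proof (cases "y = 0")
    case True
    then show ?thesis using x by simp
  next
    case y0: False
    show ?thesis
    proof (cases "x = 0")
      \<comment> \<open>The denominator lemma speaks of nonzero elements, so here the denominator
        comes from \<open>y\<close> alone.\<close>
      case True
      from U_scaleE[OF y y0] obtain \<gamma> h where
        h: "\<gamma> \<in> \<Gamma>" "h \<in> G \<gamma>" "h \<noteq> 0" "\<alpha> + \<gamma> \<in> \<Gamma>" "h * y \<in> G (\<alpha> + \<gamma>)" .
      show ?thesis using U_scaleI[OF h(1-4), of "x - y"] G_diff[OF h(4) G_0[OF h(4)] h(5)] True by simp
    next
      case False
      have "\<exists>\<gamma>\<in>\<Gamma>. \<exists>h\<in>G \<gamma>. h \<noteq> 0 \<and> (\<forall>i\<in>{x, y}. \<alpha> + \<gamma> \<in> \<Gamma> \<and> h * i \<in> G (\<alpha> + \<gamma>))"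
        using common_homog_denominator[of "{x, y}" "\<lambda>z. z" "\<lambda>_. \<alpha>"] False y0 x y by auto
      then obtain \<gamma> h where
        h: "\<gamma> \<in> \<Gamma>" "h \<in> G \<gamma>" "h \<noteq> 0" "\<alpha> + \<gamma> \<in> \<Gamma>" "h * x \<in> G (\<alpha> + \<gamma>)" "h * y \<in> G (\<alpha> + \<gamma>)"
        by auto
      show ?thesis using U_scaleI[OF h(1-4), of "x - y"] G_diff[OF h(4-6)] by (simp add: right_diff_distrib)
    qed
  qed
  show "x * y \<in> U (\<alpha> + \<beta>)" if x: "x \<in> U \<alpha>" and y: "y \<in> U \<beta>"
  proof (cases "x = 0 \<or> y = 0")
    case True
    then show ?thesis by (auto simp: U_def)
  next
    case False
    obtain \<gamma> h where h: "\<gamma> \<in> \<Gamma>" "h \<in> G \<gamma>" "h \<noteq> 0" "\<alpha> + \<gamma> \<in> \<Gamma>" "h * x \<in> G (\<alpha> + \<gamma>)"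
      using U_scaleE[OF x] False by auto
    obtain \<epsilon> k where k: "\<epsilon> \<in> \<Gamma>" "k \<in> G \<epsilon>" "k \<noteq> 0" "\<beta> + \<epsilon> \<in> \<Gamma>" "k * y \<in> G (\<beta> + \<epsilon>)"
      using U_scaleE[OF y] False by auto
    have *: "(\<alpha> + \<gamma>) + (\<beta> + \<epsilon>) = (\<alpha> + \<beta>) + (\<gamma> + \<epsilon>)" "(h * x) * (k * y) = (h * k) * (x * y)"
      by (auto simp: ac_simps)
    show ?thesis
      using U_scaleI[OF \<Gamma>_add[OF h(1) k(1)] G_mult[OF h(1) k(1) h(2) k(2)]]
        \<Gamma>_add[OF h(4) k(4)] G_mult[OF h(4) k(4) h(5) k(5)] h(3) k(3) unfolding * by simp
  qed
  show "inverse x \<in> U (- \<alpha>)" if x: "x \<in> U \<alpha>"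
  proof (cases "x = 0")
    case True
    then show ?thesis by (simp add: U_def)
  next
    case False
    from U_E[OF x this] obtain a h \<beta> \<gamma> where
      *: "x = a / h" "\<beta> \<in> \<Gamma>" "\<gamma> \<in> \<Gamma>" "a \<in> G \<beta>" "h \<in> G \<gamma>" "h \<noteq> 0" "\<alpha> = \<beta> - \<gamma>" .
    then show ?thesis using U_I[of \<gamma> \<beta> h a "- \<alpha>"] False by auto
  qed
next
  fix F and f :: "'g \<Rightarrow> 'k" and \<alpha>
  assume F: "finite F" "\<And>\<alpha>. \<alpha> \<in> F \<Longrightarrow> f \<alpha> \<in> U \<alpha>" "(\<Sum>\<alpha>\<in>F. f \<alpha>) = 0" "\<alpha> \<in> F"
  show "f \<alpha> = 0"
  proof (rule ccontr)
    assume f: "f \<alpha> \<noteq> 0"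
    \<comment> \<open>Dropping the zero terms makes a common homogeneous denominator available;
      multiplying by it turns the relation into one in R, with all degrees shifted by
      \<open>\<gamma>\<close>.\<close>
    let ?F = "{\<alpha> \<in> F. f \<alpha> \<noteq> 0}"
    have fin: "finite ?F" using F(1) by simp
    obtain \<gamma> h where h: "\<gamma> \<in> \<Gamma>" "h \<in> G \<gamma>" "h \<noteq> 0" "\<And>\<beta>. \<beta> \<in> ?F \<Longrightarrow> \<beta> + \<gamma> \<in> \<Gamma> \<and> h * f \<beta> \<in> G (\<beta> + \<gamma>)"
      using common_homog_denominator[OF fin, of f "\<lambda>\<beta>. \<beta>"] F(2) by auto
    let ?H = "(\<lambda>\<beta>. \<beta> + \<gamma>) ` ?F"
    have "(\<Sum>\<beta>\<in>?H. h * f (\<beta> - \<gamma>)) = (\<Sum>\<beta>\<in>?F. h * f \<beta>)"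
      by (subst sum.reindex) (auto simp: inj_on_def)
    also have "\<dots> = (\<Sum>\<beta>\<in>F. h * f \<beta>)" by (rule sum.mono_neutral_left) (use F(1) in auto)
    also have "\<dots> = 0" using F(3) by (simp flip: sum_distrib_left)
    finally have "\<forall>\<beta>\<in>?H. h * f (\<beta> - \<gamma>) = 0"
      by (intro G_indep) (use fin h in auto)
    moreover have "\<alpha> + \<gamma> \<in> ?H" using F(4) f by auto
    ultimately have "h * f (\<alpha> + \<gamma> - \<gamma>) = 0" by blast
    then show False using f h(3) by simp
  qed
qed

lemma homog_R: "homog R"
proof (rule homogI)
  fix x assume "x \<in> R"
  from G_decomp[OF this] obtain F f where *: "finite F" "F \<subseteq> \<Gamma>" "\<forall>\<alpha>\<in>F. f \<alpha> \<in> G \<alpha>" "x = (\<Sum>\<alpha>\<in>F. f \<alpha>)" by auto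
  then show "\<exists>F f. finite F \<and> (\<forall>\<alpha>\<in>F. f \<alpha> \<in> R \<inter> U \<alpha>) \<and> x = (\<Sum>\<alpha>\<in>F. f \<alpha>)"
    using G_sub G_U by (intro exI[of _ F] exI[of _ f]) blast
qed (rule subringD[OF R_ring])

text \<open>By uniqueness of components the decomposition of \<open>x\<close> inside R has the
  single term \<open>x\<close>, so the gradings of R and of R_H agree on R.\<close>

lemma R_U:
  assumes "x \<in> R" "x \<in> U \<alpha>" "x \<noteq> 0"
  shows "\<alpha> \<in> \<Gamma>" "x \<in> G \<alpha>"
proof -
  from G_decomp[OF assms(1)] obtain F f where
    *: "finite F" "F \<subseteq> \<Gamma>" "\<forall>\<alpha>\<in>F. f \<alpha> \<in> G \<alpha>" "x = (\<Sum>\<alpha>\<in>F. f \<alpha>)" by auto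
  have "comp x = (\<lambda>\<alpha>. if \<alpha> \<in> F then f \<alpha> else 0)"
    by (rule comp_unique(2)[OF *(1)]) (use * G_U U_0 in auto)
  then have "x = (if \<alpha> \<in> F then f \<alpha> else 0)" using comp_hom(2)[OF assms(2)] by metis
  then show "\<alpha> \<in> \<Gamma>" "x \<in> G \<alpha>" using assms(3) * by (auto split: if_splits)
qed

lemma scale_R:
  assumes "finite X" "X \<subseteq> tot"
  shows "\<exists>\<gamma>\<in>\<Gamma>. \<exists>h\<in>G \<gamma>. h \<noteq> 0 \<and> (\<forall>x\<in>X. h * x \<in> R)"
proof -
  let ?I = "Sigma X supp"
  have fin: "finite ?I" using assms comp_spec(1) by auto
  have "\<exists>\<gamma>\<in>\<Gamma>. \<exists>h\<in>G \<gamma>. h \<noteq> 0 \<and> (\<forall>i\<in>?I. snd i + \<gamma> \<in> \<Gamma> \<and> h * comp (fst i) (snd i) \<in> G (snd i + \<gamma>))"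
    by (rule common_homog_denominator[OF fin]) (use assms(2) comp_spec(2) in \<open>auto simp: supp_def\<close>)
  then obtain \<gamma> h where h: "\<gamma> \<in> \<Gamma>" "h \<in> G \<gamma>" "h \<noteq> 0"
    "\<And>x \<alpha>. x \<in> X \<Longrightarrow> \<alpha> \<in> supp x \<Longrightarrow> \<alpha> + \<gamma> \<in> \<Gamma> \<and> h * comp x \<alpha> \<in> G (\<alpha> + \<gamma>)" by auto
  have "h * x \<in> R" if x: "x \<in> X" for x
  proof -
    have "(\<Sum>\<alpha>\<in>supp x. h * comp x \<alpha>) \<in> R"
      by (rule sum_closed) (use subringD(1,3)[OF R_ring] h(4)[OF x] G_sub in blast)+
    then show ?thesis using comp_spec(3)[of x] x assms(2) by (auto simp flip: sum_distrib_left)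
  qed
  then show ?thesis using h by blast
qed

lemma tot_RH: "tot = RH \<Gamma> G R"
proof
  show "tot \<subseteq> RH \<Gamma> G R"
  proof
    fix x assume "x \<in> tot"
    then obtain \<gamma> h where "\<gamma> \<in> \<Gamma>" "h \<in> G \<gamma>" "h \<noteq> 0" "h * x \<in> R" using scale_R[of "{x}"] by auto
    moreover from this have "x = (h * x) / h" by simp
    ultimately show "x \<in> RH \<Gamma> G R" unfolding RH_def homs_def by blast
  qed
  show "RH \<Gamma> G R \<subseteq> tot"
  proof
    fix x assume "x \<in> RH \<Gamma> G R"
    then obtain a h \<gamma> where *: "x = a / h" "a \<in> R" "\<gamma> \<in> \<Gamma>" "h \<in> G \<gamma>" unfolding RH_def homs_def by auto
    have "inverse h * a \<in> tot"
      using comp_hmult(1)[OF U_inverse[OF G_U[OF *(3,4)]]] homog_R *(2) unfolding homog_def by blast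
    then show "x \<in> tot" using * by (simp add: divide_inverse mult.commute)
  qed
qed

lemma decomp_R_iff:
  assumes "I \<subseteq> R" "0 \<in> I"
  shows "decomp \<Gamma> G I \<longleftrightarrow> homog I"
proof
  assume d: "decomp \<Gamma> G I"
  show "homog I"
  proof (rule homogI[OF _ assms(2)])
    fix x assume "x \<in> I"
    from bspec[OF d[unfolded decomp_def] this] obtain F f where
      "finite F" "F \<subseteq> \<Gamma>" "\<forall>\<alpha>\<in>F. f \<alpha> \<in> I \<inter> G \<alpha>" "x = (\<Sum>\<alpha>\<in>F. f \<alpha>)" by auto
    then show "\<exists>F f. finite F \<and> (\<forall>\<alpha>\<in>F. f \<alpha> \<in> I \<inter> U \<alpha>) \<and> x = (\<Sum>\<alpha>\<in>F. f \<alpha>)"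
      using G_U by (intro exI[of _ F] exI[of _ f]) blast
  qed
next
  assume h: "homog I"
  show "decomp \<Gamma> G I" unfolding decomp_def
  proof
    fix x assume "x \<in> I"
    then have x: "x \<in> tot" "\<And>\<alpha>. comp x \<alpha> \<in> I" using h unfolding homog_def by auto
    have "\<alpha> \<in> \<Gamma> \<and> comp x \<alpha> \<in> I \<inter> G \<alpha>" if "\<alpha> \<in> supp x" for \<alpha>
      using R_U[of "comp x \<alpha>" \<alpha>] x comp_spec(2)[OF x(1)] that assms(1) by (auto simp: supp_def)
    then show "\<exists>F f. finite F \<and> F \<subseteq> \<Gamma> \<and> (\<forall>\<alpha>\<in>F. f \<alpha> \<in> I \<inter> G \<alpha>) \<and> x = (\<Sum>\<alpha>\<in>F. f \<alpha>)"
      using comp_spec(1,3)[OF x(1)] by (intro exI[of _ "supp x"] exI[of _ "comp x"]) auto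
  qed
qed

lemma RHg_grp: "x \<in> RHg \<Gamma> G \<alpha> \<Longrightarrow> \<alpha> \<in> grp \<Gamma>"
  unfolding RHg_def grp_def by auto

lemma decomp_RH_iff:
  assumes "0 \<in> E"
  shows "decomp (grp \<Gamma>) (RHg \<Gamma> G) E \<longleftrightarrow> homog E"
proof
  assume d: "decomp (grp \<Gamma>) (RHg \<Gamma> G) E"
  show "homog E"
  proof (rule homogI[OF _ assms])
    fix x assume "x \<in> E"
    from bspec[OF d[unfolded decomp_def] this] obtain F f where
      "finite F" "\<forall>\<alpha>\<in>F. f \<alpha> \<in> E \<inter> RHg \<Gamma> G \<alpha>" "x = (\<Sum>\<alpha>\<in>F. f \<alpha>)" by auto
    then show "\<exists>F f. finite F \<and> (\<forall>\<alpha>\<in>F. f \<alpha> \<in> E \<inter> U \<alpha>) \<and> x = (\<Sum>\<alpha>\<in>F. f \<alpha>)"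
      unfolding U_def by (intro exI[of _ F] exI[of _ f]) blast
  qed
next
  assume h: "homog E"
  show "decomp (grp \<Gamma>) (RHg \<Gamma> G) E" unfolding decomp_def
  proof
    fix x assume "x \<in> E"
    then have x: "x \<in> tot" "\<And>\<alpha>. comp x \<alpha> \<in> E" using h unfolding homog_def by auto
    have *: "comp x \<alpha> \<in> RHg \<Gamma> G \<alpha>" if "\<alpha> \<in> supp x" for \<alpha>
      using comp_spec(2)[OF x(1), of \<alpha>] that unfolding U_def supp_def by auto
    then have "supp x \<subseteq> grp \<Gamma>" using RHg_grp by blast
    then show "\<exists>F f. finite F \<and> F \<subseteq> grp \<Gamma> \<and> (\<forall>\<alpha>\<in>F. f \<alpha> \<in> E \<inter> RHg \<Gamma> G \<alpha>) \<and> x = (\<Sum>\<alpha>\<in>F. f \<alpha>)"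
      using * x(2) comp_spec(1,3)[OF x(1)] by (intro exI[of _ "supp x"] exI[of _ "comp x"]) auto
  qed
qed

lemma hom_overring_iff: "hom_overring \<Gamma> G R T \<longleftrightarrow> subring T \<and> R \<subseteq> T \<and> homog T"
proof -
  have "subring T \<Longrightarrow> decomp (grp \<Gamma>) (RHg \<Gamma> G) T \<longleftrightarrow> homog T"
    by (rule decomp_RH_iff[OF subringD(1)])
  moreover have "homog T \<Longrightarrow> T \<subseteq> RH \<Gamma> G R" unfolding homog_def tot_RH by auto
  ultimately show ?thesis unfolding hom_overring_def by auto
qed

lemma torsion_free_degrees: "torsion_free {\<alpha>. U \<alpha> \<noteq> {0}}"
proof -
  have "{\<alpha>. U \<alpha> \<noteq> {0}} \<subseteq> grp \<Gamma>" unfolding U_def using RHg_grp by blast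
  then show ?thesis using \<Gamma>_torsion_free unfolding torsion_free_def by blast
qed

lemma homog_generators:
  assumes T: "subring T" and E: "homog E" "E = prodm T S" "finite S" "E \<noteq> {0}"
  shows "\<exists>C. finite C \<and> C \<noteq> {} \<and> (\<forall>c\<in>C. c \<noteq> 0 \<and> (\<exists>\<alpha>. c \<in> U \<alpha>)) \<and> C \<subseteq> E \<and> E = prodm T C"
proof -
  let ?C = "\<Union>s\<in>S. comp s ` supp s"
  have subE: "submod T E" unfolding E(2) by (rule submod_span[OF T])
  have SE: "S \<subseteq> E" unfolding E(2) using span_base[OF T] by auto
  then have St: "S \<subseteq> tot" using E(1) unfolding homog_def by auto
  have CE: "?C \<subseteq> E" using SE E(1) unfolding homog_def by auto
  have "S \<subseteq> prodm T ?C"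
  proof
    fix s assume s: "s \<in> S"
    have "(\<Sum>\<alpha>\<in>supp s. comp s \<alpha>) \<in> prodm T ?C"
      by (rule sum_closed[OF prodm_0 prodm_add span_base[OF T]]) (use s in auto)
    then show "s \<in> prodm T ?C" using comp_spec(3) s St by auto
  qed
  then have "E \<subseteq> prodm T ?C" unfolding E(2) by (intro span_least submod_span T)
  moreover have "prodm T ?C \<subseteq> E" by (rule span_least[OF subE CE])
  ultimately have "E = prodm T ?C" by blast
  moreover have "?C \<noteq> {}"
  proof
    assume "?C = {}"
    then have "E \<subseteq> {0}" using \<open>E = prodm T ?C\<close> prodm_least[of "{0}" T "{}"] by auto
    then show False using E(4) submodD(1)[OF subE] by auto
  qed
  moreover have "finite ?C" using E(3) St comp_spec(1) by auto
  moreover have "\<forall>c\<in>?C. c \<noteq> 0 \<and> (\<exists>\<alpha>. c \<in> U \<alpha>)" using St comp_spec(2) by (auto simp: supp_def)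
  ultimately show ?thesis using CE by blast
qed

text \<open>\<open>H\<close> concerns subsets of R because star-invertibility is about ideals of R.
  A homogeneous denominator moves any finite homogeneous set there, and \<open>t_inv_rescale\<close>
  moves the witness back.\<close>

theorem PvMD_from_homogeneous:
  assumes T: "subring T" "R \<subseteq> T" "homog T"
    and H: "\<And>C. finite C \<Longrightarrow> C \<noteq> {} \<Longrightarrow> \<forall>c\<in>C. c \<noteq> 0 \<and> (\<exists>\<alpha>. c \<in> U \<alpha>) \<Longrightarrow> C \<subseteq> R \<Longrightarrow> t_inv T C"
  shows "PvMD T"
proof -
  have scale: "\<exists>\<gamma> h. h \<in> U \<gamma> \<and> h \<noteq> 0 \<and> (\<forall>x\<in>X. h * x \<in> T)" if X: "finite X" "X \<subseteq> tot" for X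
    using scale_R[OF X] G_U T(2) by blast
  have H': "t_inv T C" if C: "finite C" "C \<noteq> {}" "\<forall>c\<in>C. c \<noteq> 0 \<and> (\<exists>\<alpha>. c \<in> U \<alpha>)" for C
  proof -
    have "C \<subseteq> tot" using C(3) comp_hom(1) by blast
    from scale_R[OF C(1) this] obtain \<gamma> h where h: "\<gamma> \<in> \<Gamma>" "h \<in> G \<gamma>" "h \<noteq> 0" "\<forall>x\<in>C. h * x \<in> R" by auto
    have "t_inv T ((*) h ` C)"
    proof (rule H)
      show "\<forall>c\<in>(*) h ` C. c \<noteq> 0 \<and> (\<exists>\<alpha>. c \<in> U \<alpha>)"
        using C(3) h(3) U_mult[OF G_U[OF h(1,2)]] by fastforce
    qed (use C h(4) in auto)
    then show ?thesis
    proof (rule t_inv_rescale[OF _ T(1) h(3)])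
      show "\<exists>t\<in>T. \<exists>a'\<in>C. a = t * (a' * h)" if "a \<in> (*) h ` C" for a
        using that subringD(2)[OF T(1)] by (force simp: mult.commute)
      show "\<exists>t\<in>T. \<exists>a\<in>(*) h ` C. a' * h = t * a" if "a' \<in> C" for a'
        using that subringD(2)[OF T(1)] by (intro bexI[of _ 1] bexI[of _ "h * a'"]) (auto simp: mult.commute)
    qed
  qed
  show ?thesis unfolding PvMD_def
  proof (intro allI impI)
    fix I assume "ideal_of T I \<and> I \<noteq> {0} \<and> fg T I"
    then obtain S where I: "I \<subseteq> T" "I \<noteq> {0}" "finite S" "I = prodm T S"
      unfolding ideal_of_def fg_def by auto
    have ST: "S \<subseteq> tot" using span_base[OF T(1)] I T(3) unfolding homog_def by blast
    have "\<exists>a\<in>S. a \<noteq> 0"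
    proof (rule ccontr)
      assume "\<not> ?thesis"
      then have "prodm T S \<subseteq> {0}" by (intro prodm_least) auto
      then show False using I prodm_0[of T S] by auto
    qed
    then obtain a where a: "a \<in> S" "a \<noteq> 0" by auto
    have "t_inv tot S" by (rule t_inv_tot[OF torsion_free_degrees I(3) ST a])
    from t_inv_from_homogeneous[OF T(1,3) unique_sums_degrees[OF torsion_free_degrees] scale H' this I(3) ST a]
    have "t_inv T S" .
    then show "star_f_inv T (t_op T) I" unfolding I(4) by (rule t_inv_imp_star_f_inv[OF T(1) I(3) _ a])
  qed
qed

lemma overring_PvMD_integrally_closed:
  assumes "subring T" "R \<subseteq> T" "PvMD T"
  shows "integrally_closed T"
  by (rule PvMD_integrally_closed[OF assms(1) _ assms(3)]) (use R_quot assms(2) in blast)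

end

section \<open>Semistar operations and linked overrings\<close>

locale graded_star = graded_dom +
  fixes st :: "'b set \<Rightarrow> 'b set"
  assumes star: "semistar R st"
begin

lemma st_nz: "nz_submod R E \<Longrightarrow> nz_submod R (st E)"
  and st_scale: "x \<noteq> 0 \<Longrightarrow> nz_submod R E \<Longrightarrow> st ((\<lambda>y. x * y) ` E) = (\<lambda>y. x * y) ` st E"
  and st_mono: "nz_submod R E \<Longrightarrow> nz_submod R F \<Longrightarrow> E \<subseteq> F \<Longrightarrow> st E \<subseteq> st F"
  and st_ext: "nz_submod R E \<Longrightarrow> E \<subseteq> st E"
  and st_idem: "nz_submod R E \<Longrightarrow> st (st E) = st E"
  using star unfolding semistar_def by simp_all

lemma nz_R: "nz_submod R R"
  unfolding nz_submod_def using subring_submod[OF R_ring] subringD(2)[OF R_ring] by auto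

lemma nz_fg: "fg R F \<Longrightarrow> F \<noteq> {0} \<Longrightarrow> nz_submod R F"
  unfolding nz_submod_def fg_def using submod_span[OF R_ring] by auto

lemma st_eq_R_iff:
  assumes "nz_submod R F" "F \<subseteq> R"
  shows "st F = st R \<longleftrightarrow> 1 \<in> st F"
proof
  assume "st F = st R"
  then show "1 \<in> st F" using st_ext[OF nz_R] subringD(2)[OF R_ring] by auto
next
  assume 1: "1 \<in> st F"
  have "submod R (st F)" using st_nz[OF assms(1)] by (simp add: nz_submod_def)
  then have "r \<in> st F" if "r \<in> R" for r using submodD(3)[of R "st F" r 1] 1 that by simp
  then have "R \<subseteq> st F" by blast
  then have "st R \<subseteq> st F" using st_mono[OF nz_R st_nz[OF assms(1)]] st_idem[OF assms(1)] by simp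
  then show "st F = st R" using st_mono[OF assms(1) nz_R assms(2)] by simp
qed

text \<open>For \<open>Q\<close> inside R this is \<open>1 \<in> star_f R st Q\<close>, since the
  requirement \<open>frac\<close> in \<open>star_f\<close> then holds automatically.\<close>

definition has_unit :: "'b set \<Rightarrow> bool" where
  "has_unit Q \<longleftrightarrow> (\<exists>F\<subseteq>Q. F \<noteq> {0} \<and> fg R F \<and> 1 \<in> st F)"

lemma star_f_inv_iff: "star_f_inv R st I \<longleftrightarrow> has_unit (prodm I (colon R I))"
proof -
  let ?J = "prodm I (colon R I)"
  have JR: "?J \<subseteq> R" by (rule prodm_colon_subset[OF R_ring])
  show ?thesis
  proof
    assume "star_f_inv R st I"
    then have "1 \<in> star_f R st ?J"
      unfolding star_f_inv_def using st_ext[OF nz_R] subringD(2)[OF R_ring] by auto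
    then show "has_unit ?J" unfolding star_f_def has_unit_def by blast
  next
    assume "has_unit ?J"
    then obtain F where F: "F \<subseteq> ?J" "F \<noteq> {0}" "fg R F" "1 \<in> st F" unfolding has_unit_def by auto
    have "Defs.frac R F"
      using frac_ideal[of R F] nz_fg[OF F(3,2)] F(1) JR unfolding nz_submod_def by auto
    then have "st F \<subseteq> star_f R st ?J" unfolding star_f_def using F by blast
    moreover have "st F = st R" using st_eq_R_iff[OF nz_fg[OF F(3,2)]] F(1,4) JR by auto
    moreover have "st F' \<subseteq> st R" if "F' \<subseteq> ?J" "F' \<noteq> {0}" "fg R F'" for F'
      using st_mono[OF nz_fg[OF that(3,2)] nz_R] that(1) JR by auto
    then have "star_f R st ?J \<subseteq> st R" unfolding star_f_def by blast
    ultimately show "star_f_inv R st I" unfolding star_f_inv_def by auto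
  qed
qed

lemma homog_ideal:
  assumes "\<forall>c\<in>C. c \<noteq> 0 \<and> (\<exists>\<alpha>. c \<in> U \<alpha>)" "C \<subseteq> R" "C \<noteq> {}"
  shows "ideal_of R (prodm R C)" "prodm R C \<noteq> {0}" "decomp \<Gamma> G (prodm R C)" "homog (prodm R C)"
proof -
  have "prodm R C \<subseteq> R" by (rule span_least[OF subring_submod[OF R_ring] assms(2)])
  then show "ideal_of R (prodm R C)" unfolding ideal_of_def using submod_span[OF R_ring] by auto
  show "prodm R C \<noteq> {0}" using span_base[OF R_ring, of _ C] assms by blast
  show h: "homog (prodm R C)"
    by (rule homog_span[OF homog_R subringD(1)[OF R_ring]]) (use assms in auto)
  show "decomp \<Gamma> G (prodm R C)" using decomp_R_iff[OF \<open>prodm R C \<subseteq> R\<close> prodm_0] h by simp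
qed

text \<open>Linkedness tests homogeneous F only, while invertibility yields an arbitrary F. As I (R
  : I) is homogeneous, it contains the components of the generators of F; these generate a
  homogeneous ideal containing F, whose star closure still contains 1.\<close>

lemma GPstarMD_witness:
  assumes "GPstarMD \<Gamma> G R st" and C: "finite C" "C \<noteq> {}" "\<forall>c\<in>C. c \<noteq> 0 \<and> (\<exists>\<alpha>. c \<in> U \<alpha>)" "C \<subseteq> R"
  shows "\<exists>F. F \<subseteq> prodm (prodm R C) (colon R (prodm R C)) \<and> ideal_of R F \<and> F \<noteq> {0} \<and> fg R F \<and> decomp \<Gamma> G F \<and> st F = st R"
proof -
  let ?I = "prodm R C"
  let ?J = "prodm ?I (colon R ?I)"
  note I = homog_ideal[OF C(3,4,2)]
  have "fg R ?I" unfolding fg_def using C(1) by blast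
  then have "star_f_inv R st ?I" using assms(1) I unfolding GPstarMD_def by blast
  then obtain F where F: "F \<subseteq> ?J" "F \<noteq> {0}" "fg R F" "1 \<in> st F"
    unfolding star_f_inv_iff has_unit_def by auto
  obtain S where S: "finite S" "F = prodm R S" using F(3) unfolding fg_def by auto
  obtain c where c: "c \<in> ?I" "c \<noteq> 0" using C span_base[OF R_ring] by blast
  have JR: "?J \<subseteq> R" by (rule prodm_colon_subset[OF R_ring])
  have hJ: "homog ?J" by (rule homog_prodm[OF I(4) homog_colon[OF homog_R R_ring I(4) c]])
  have sJ: "submod R ?J" by (intro submod_prodm submod_span R_ring)
  have SJ: "S \<subseteq> ?J" using F(1) S span_base[OF R_ring] by blast
  let ?S = "\<Union>s\<in>S. comp s ` supp s"
  let ?F = "prodm R ?S"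
  have St: "S \<subseteq> tot" using SJ hJ unfolding homog_def by auto
  have SJ': "?S \<subseteq> ?J" using SJ hJ unfolding homog_def by auto
  have "s \<in> ?F" if s: "s \<in> S" for s
  proof -
    have "(\<Sum>\<alpha>\<in>supp s. comp s \<alpha>) \<in> ?F"
      by (rule sum_closed[OF prodm_0 prodm_add span_base[OF R_ring]]) (use s in auto)
    then show ?thesis using comp_spec(3) s St by auto
  qed
  then have FF: "F \<subseteq> ?F" unfolding S(2) by (intro span_least submod_span R_ring) blast
  have Shom: "\<forall>c\<in>?S. c \<noteq> 0 \<and> (\<exists>\<alpha>. c \<in> U \<alpha>)" using St comp_spec(2) by (auto simp: supp_def)
  have S0: "?S \<noteq> {}"
  proof
    assume "?S = {}"
    then have "F \<subseteq> {0}" using FF prodm_least[of "{0}" R "{}"] by auto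
    then show False using F(2) prodm_0[of R S] S(2) by auto
  qed
  have "?S \<subseteq> R" using SJ' JR by blast
  note F' = homog_ideal[OF Shom this S0]
  have fin: "finite ?S" using S(1) St comp_spec(1) by auto
  then have fgF': "fg R ?F" unfolding fg_def by (intro exI[of _ ?S]) simp
  have "1 \<in> st ?F" using st_mono[OF nz_fg[OF F(3,2)] nz_fg[OF fgF' F'(2)] FF] F(4) by auto
  then have "st ?F = st R" using st_eq_R_iff[OF nz_fg[OF fgF' F'(2)]] F'(1) unfolding ideal_of_def by auto
  moreover have "?F \<subseteq> ?J" by (rule span_least[OF sJ SJ'])
  ultimately show ?thesis using F' fgF' by (intro exI[of _ ?F]) simp
qed

text \<open>For the witness F inside I (R : I), linkedness gives (T : F T) inside T. Finitely many
  elements B of (R : I) already express the generators of F, and then x C B inside T implies x F T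
  inside T, hence \<open>x\<close> in T.\<close>

lemma GPstarMD_t_linked_PvMD:
  assumes "GPstarMD \<Gamma> G R st" "hlinked \<Gamma> G R st T (t_op T)"
  shows "PvMD T"
proof -
  have T: "subring T" "R \<subseteq> T" "homog T" using assms(2) unfolding hlinked_def hom_overring_iff by auto
  note T1 = subringD[OF T(1)]
  show ?thesis
  proof (rule PvMD_from_homogeneous[OF T])
    fix C assume C: "finite C" "C \<noteq> {}" "\<forall>c\<in>C. c \<noteq> 0 \<and> (\<exists>\<alpha>. c \<in> U \<alpha>)" "C \<subseteq> R"
    let ?I = "prodm R C"
    obtain F where F: "F \<subseteq> prodm ?I (colon R ?I)" "ideal_of R F" "F \<noteq> {0}" "fg R F" "decomp \<Gamma> G F" "st F = st R"
      using GPstarMD_witness[OF assms(1) C] by auto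
    have "t_op T (prodm F T) = T"
      using assms(2) F t_op_eq_ring[OF T(1)] unfolding hlinked_def by auto
    then have FT: "colon T (prodm F T) \<subseteq> T" using t_op_unit_colon[of T "prodm F T"] T1(2) by auto
    obtain S where S: "finite S" "F = prodm R S" using F(4) unfolding fg_def by auto
    have "S \<subseteq> prodm ?I (colon R ?I)" using span_base[OF R_ring] S F(1) by blast
    from prodm_finite_right[OF S(1) this] obtain B where
      B: "finite B" "B \<subseteq> colon R ?I" "S \<subseteq> prodm ?I B" by auto
    have "\<exists>b\<in>B. b \<noteq> 0"
    proof (rule ccontr)
      assume "\<not> ?thesis"
      then have "prodm ?I B \<subseteq> {0}" by (intro prodm_least) auto
      then have "S \<subseteq> {0}" using B(3) by blast
      then have "prodm R S \<subseteq> {0}" by (intro prodm_least) auto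
      then show False using F(3) S(2) prodm_0[of R S] by auto
    qed
    then obtain b where b: "b \<in> B" "b \<noteq> 0" by auto
    show "t_inv T C"
    proof (rule t_invI[OF B(1) b])
      fix c b assume "c \<in> C" "b \<in> B"
      then show "c * b \<in> T" using B(2) T(2) span_base[OF R_ring, of c C] by (auto simp: colon_def mult.commute[of c])
    next
      fix x assume x: "\<And>c b. c \<in> C \<Longrightarrow> b \<in> B \<Longrightarrow> x * (c * b) \<in> T"
      have xI: "x * y \<in> T" if "y \<in> prodm ?I B" for y
      proof (rule prodm_mult_closed[OF that _ T1(1,3)])
        fix a b assume a: "a \<in> ?I" and b: "b \<in> B"
        have "(x * b) * a \<in> T"
        proof (rule prodm_mult_closed[OF a _ T1(1,3)])
          fix r c assume "r \<in> R" "c \<in> C"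
          then have "r * (x * (c * b)) \<in> T" using x b T(2) T1(4) by blast
          then show "x * b * (r * c) \<in> T" by (simp add: ac_simps)
        qed
        then show "x * (a * b) \<in> T" by (simp add: ac_simps)
      qed
      have xF: "x * y \<in> T" if "y \<in> F" for y
      proof (rule prodm_mult_closed[of y R S])
        fix r s assume "r \<in> R" "s \<in> S"
        then have "r * (x * s) \<in> T" using xI B(3) T(2) T1(4) by blast
        then show "x * (r * s) \<in> T" by (simp add: ac_simps)
      qed (use that S(2) T1 in auto)
      have "x * y \<in> T" if "y \<in> prodm F T" for y
      proof (rule prodm_mult_closed[OF that _ T1(1,3)])
        fix f t assume "f \<in> F" "t \<in> T"
        then show "x * (f * t) \<in> T" using xF T1(4)[of "x * f" t] by (simp add: mult.assoc)
      qed
      then have "x \<in> colon T (prodm F T)" by (simp add: colon_def)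
      then show "x \<in> T" using FT by blast
    qed
  qed
qed

text \<open>A homogeneous \<open>h\<close> moves the generators of I into R. It cancels in the
  product with the inverse, so the F found for the scaled generators lies in I (T : I), and F T = T
  finishes.\<close>

lemma GPstarMD_d_linked_graded_Prufer:
  assumes "GPstarMD \<Gamma> G R st" "hlinked \<Gamma> G R st T (d_op T)"
  shows "graded_Prufer \<Gamma> G T"
  unfolding graded_Prufer_def
proof (intro allI impI)
  have T: "subring T" "R \<subseteq> T" "homog T" using assms(2) unfolding hlinked_def hom_overring_iff by auto
  note T1 = subringD[OF T(1)]
  fix I assume I: "ideal_of T I \<and> I \<noteq> {0} \<and> fg T I \<and> decomp (grp \<Gamma>) (RHg \<Gamma> G) I"
  have "0 \<in> I" using I submodD(1) unfolding ideal_of_def by blast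
  then have hI: "homog I" using decomp_RH_iff I by auto
  obtain S where S: "finite S" "I = prodm T S" using I unfolding fg_def by auto
  from homog_generators[OF T(1) hI S(2,1)] I obtain C where
    C: "finite C" "C \<noteq> {}" "\<forall>c\<in>C. c \<noteq> 0 \<and> (\<exists>\<alpha>. c \<in> U \<alpha>)" "C \<subseteq> I" "I = prodm T C" by auto
  have "C \<subseteq> tot" using C(3) comp_hom(1) by blast
  from scale_R[OF C(1) this] obtain \<gamma> h where h: "\<gamma> \<in> \<Gamma>" "h \<in> G \<gamma>" "h \<noteq> 0" "\<forall>x\<in>C. h * x \<in> R" by auto
  let ?C = "(*) h ` C"
  have C': "finite ?C" "?C \<noteq> {}" "\<forall>c\<in>?C. c \<noteq> 0 \<and> (\<exists>\<alpha>. c \<in> U \<alpha>)" "?C \<subseteq> R"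
    using C(1,2,3) h(3,4) U_mult[OF G_U[OF h(1,2)]] by fastforce+
  obtain F where F: "F \<subseteq> prodm (prodm R ?C) (colon R (prodm R ?C))"
    "ideal_of R F" "F \<noteq> {0}" "fg R F" "decomp \<Gamma> G F" "st F = st R"
    using GPstarMD_witness[OF assms(1) C'] by auto
  have FT: "prodm F T = T" using assms(2) F unfolding hlinked_def d_op_def by auto
  let ?Q = "prodm I (colon T I)"
  have sQ: "submod T ?Q" unfolding C(5) by (intro submod_prodm submod_span T(1))
  note Q1 = submodD[OF sQ]
  have "prodm (prodm R ?C) (colon R (prodm R ?C)) \<subseteq> ?Q"
  proof (rule prodm_least[OF Q1(1,2)])
    fix a b assume a: "a \<in> prodm R ?C" and b: "b \<in> colon R (prodm R ?C)"
    have "b * c \<in> R" if "c \<in> ?C" for c using b span_base[OF R_ring that] by (simp add: colon_def)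
    then have *: "b * (h * c) \<in> T" if "c \<in> C" for c using that T(2) by blast
    then have hb: "h * b \<in> colon T I" unfolding C(5) colon_span[OF T(1)] using * by (simp add: colon_def ac_simps)
    have "b * a \<in> ?Q"
    proof (rule prodm_mult_closed[OF a _ Q1(1,2)])
      fix r c assume r: "r \<in> R" and "c \<in> ?C"
      then obtain c' where c': "c' \<in> C" "c = h * c'" by auto
      have "c' * (h * b) \<in> ?Q" using c'(1) C(4) hb by (intro prodm_mem) auto
      then have "r * (c' * (h * b)) \<in> ?Q" using r T(2) Q1(3) by blast
      then show "b * (r * c) \<in> ?Q" unfolding c'(2) by (simp add: ac_simps)
    qed
    then show "a * b \<in> ?Q" by (simp add: mult.commute)
  qed
  then have FQ: "F \<subseteq> ?Q" using F(1) by blast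
  have "prodm F T \<subseteq> ?Q"
  proof (rule prodm_least[OF Q1(1,2)])
    fix f t assume "f \<in> F" "t \<in> T"
    then show "f * t \<in> ?Q" using FQ Q1(3)[of t f] by (auto simp: mult.commute)
  qed
  then show "?Q = T" using FT prodm_colon_subset[OF T(1), of I] by auto
qed

text \<open>Invertibility writes 1 as a finite sum of products from I and (T : I); the finitely many
  elements of (T : I) in that sum are the witness, because x = x * 1.\<close>

lemma graded_Prufer_PvMD:
  assumes T: "subring T" "R \<subseteq> T" "homog T" and "graded_Prufer \<Gamma> G T"
  shows "PvMD T"
proof (rule PvMD_from_homogeneous[OF T])
  note T1 = subringD[OF T(1)]
  fix C assume C: "finite C" "C \<noteq> {}" "\<forall>c\<in>C. c \<noteq> 0 \<and> (\<exists>\<alpha>. c \<in> U \<alpha>)" "C \<subseteq> R"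
  let ?I = "prodm T C"
  have IT: "?I \<subseteq> T" by (rule span_least[OF subring_submod[OF T(1)]]) (use C(4) T(2) in blast)
  then have "ideal_of T ?I" unfolding ideal_of_def using submod_span[OF T(1)] by auto
  moreover have "?I \<noteq> {0}" using span_base[OF T(1), of _ C] C by blast
  moreover have "fg T ?I" unfolding fg_def using C(1) by blast
  moreover have "homog ?I" by (rule homog_span[OF T(3) T1(1)]) (use C(3) in auto)
  ultimately have "prodm ?I (colon T ?I) = T"
    using assms(4) decomp_RH_iff[OF prodm_0] unfolding graded_Prufer_def by auto
  then have "{1} \<subseteq> prodm ?I (colon T ?I)" using T1(2) by auto
  from prodm_finite_right[OF _ this] obtain B where B: "finite B" "B \<subseteq> colon T ?I" "1 \<in> prodm ?I B" by auto
  have "\<exists>b\<in>B. b \<noteq> 0"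
  proof (rule ccontr)
    assume "\<not> ?thesis"
    then have "prodm ?I B \<subseteq> {0}" by (intro prodm_least) auto
    then show False using B(3) by auto
  qed
  then obtain b where b: "b \<in> B" "b \<noteq> 0" by auto
  show "t_inv T C"
  proof (rule t_invI[OF B(1) b])
    fix c b assume "c \<in> C" "b \<in> B"
    then show "c * b \<in> T" using B(2) span_base[OF T(1), of c C] by (auto simp: colon_def mult.commute[of c])
  next
    fix x assume x: "\<And>c b. c \<in> C \<Longrightarrow> b \<in> B \<Longrightarrow> x * (c * b) \<in> T"
    have "x * 1 \<in> T"
    proof (rule prodm_mult_closed[OF B(3) _ T1(1,3)])
      fix a b assume a: "a \<in> ?I" and b: "b \<in> B"
      have "(x * b) * a \<in> T"
      proof (rule prodm_mult_closed[OF a _ T1(1,3)])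
        fix r c assume "r \<in> T" "c \<in> C"
        then have "r * (x * (c * b)) \<in> T" using x b T1(4) by blast
        then show "x * b * (r * c) \<in> T" by (simp add: ac_simps)
      qed
      then show "x * (a * b) \<in> T" by (simp add: ac_simps)
    qed
    then show "x \<in> T" by simp
  qed
qed

lemma d_linked_imp_t_linked:
  assumes "hlinked \<Gamma> G R st T (d_op T)"
  shows "hlinked \<Gamma> G R st T (t_op T)"
  using assms unfolding hlinked_def d_op_def by auto

end

section \<open>Localization at a maximal homogeneous prime\<close>

context graded_dom
begin

text \<open>Homogeneous form of the u, 1/u lemma for integrally closed local rings; m plays the role of the
  maximal ideal.\<close>

lemma unit_coefficient_lemma:
  assumes A: "subring A" "integrally_closed A"
    and m: "0 \<in> m" "m \<subseteq> A" "\<And>a b. a \<in> m \<Longrightarrow> b \<in> m \<Longrightarrow> a - b \<in> m"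
    and unit: "\<And>a \<alpha>. a \<in> A \<Longrightarrow> a \<in> U \<alpha> \<Longrightarrow> a \<notin> m \<Longrightarrow> a \<noteq> 0 \<and> inverse a \<in> A"
    and x: "x \<in> U \<alpha>" "x \<noteq> 0"
  shows "(\<And>i. i \<le> n \<Longrightarrow> a i \<in> A \<and> a i * x ^ i \<in> U \<delta>) \<Longrightarrow> (\<Sum>i\<le>n. a i * x ^ i) = 0 \<Longrightarrow>
    j \<le> n \<Longrightarrow> a j \<notin> m \<Longrightarrow> x \<in> A \<or> inverse x \<in> A"
proof (induction n arbitrary: a j)
  case 0
  then show ?case using m(1) by simp
next
  case (Suc n)
  note A1 = subringD[OF A(1)]
  let ?c = "a (Suc n)"
  have hom: "\<exists>\<beta>. a i \<in> U \<beta>" if "i \<le> Suc n" for i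
  proof -
    obtain \<beta> where "x ^ i \<in> U \<beta>" using U_power[OF x(1)] by auto
    from U_mult[OF _ U_inverse[OF this], of "a i * x ^ i" \<delta>] Suc(2)[OF that] x(2)
    show ?thesis by (auto simp: mult.assoc)
  qed
  obtain \<epsilon> where \<epsilon>: "?c \<in> U \<epsilon>" using hom[of "Suc n"] by auto
  have cA: "?c \<in> A" using Suc(2) by auto
  define b where "b = ?c * x"
  have bU: "b \<in> U (\<epsilon> + \<alpha>)" unfolding b_def by (rule U_mult[OF \<epsilon> x(1)])
  \<comment> \<open>Multiplying by this power makes \<open>b\<close>, the product of the top
    coefficient and \<open>x\<close>, a root of a monic polynomial over A.\<close>
  have "?c ^ n * (\<Sum>i\<le>Suc n. a i * x ^ i) = 0" using Suc(3) by simp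
  then have "?c ^ n * (?c * x ^ Suc n) + (\<Sum>i\<le>n. ?c ^ n * (a i * x ^ i)) = 0"
    by (simp add: distrib_left sum_distrib_left add.commute)
  moreover have "?c ^ n * (?c * x ^ Suc n) = b ^ Suc n" unfolding b_def power_mult_distrib by simp
  moreover have "(\<Sum>i\<le>n. ?c ^ n * (a i * x ^ i)) = (\<Sum>i<Suc n. (a i * ?c ^ (n - i)) * b ^ i)"
    unfolding lessThan_Suc_atMost
  proof (rule sum.cong[OF refl])
    fix i assume "i \<in> {..n}"
    then have "?c ^ n = ?c ^ (n - i) * ?c ^ i" by (simp flip: power_add)
    then show "?c ^ n * (a i * x ^ i) = (a i * ?c ^ (n - i)) * b ^ i"
      unfolding b_def power_mult_distrib by (simp add: ac_simps)
  qed
  ultimately have rel: "b ^ Suc n + (\<Sum>i<Suc n. (a i * ?c ^ (n - i)) * b ^ i) = 0" by simp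
  have "\<forall>i<Suc n. a i * ?c ^ (n - i) \<in> A" using Suc(2) cA A1(4,7) by simp
  then have bA: "b \<in> A"
    using A(2)[unfolded integrally_closed_def] rel
    by (elim allE[of _ b]) (erule mp, intro exI[of _ "Suc n"] exI[of _ "\<lambda>i. a i * ?c ^ (n - i)"] conjI)
  show ?case
  proof (cases "?c \<in> m")
    case False
    then have "?c \<noteq> 0" "inverse ?c \<in> A" using unit[OF cA \<epsilon>] by auto
    moreover from this have "x = b * inverse ?c" by (simp add: b_def)
    ultimately show ?thesis using bA A1(4) by metis
  next
    case cm: True
    show ?thesis
    proof (cases "b \<in> m")
      case False
      then have *: "b \<noteq> 0" "inverse b \<in> A" using unit[OF bA bU] by auto
      then have "inverse x = ?c * inverse b" by (auto simp: b_def)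
      then show ?thesis using *(2) cA A1(4) by metis
    next
      case bm: True
      \<comment> \<open>Now the top term equals \<open>b * x ^ n\<close> and merges into the term
        below it. Since \<open>b\<close> lies in \<open>m\<close>, the coefficient outside
        \<open>m\<close> stays outside.\<close>
      define a' where "a' = a(n := a n + b)"
      have "(\<Sum>i\<le>n. a' i * x ^ i) = (\<Sum>i\<le>Suc n. a i * x ^ i)"
        by (cases n) (simp_all add: a'_def b_def algebra_simps)
      then have 1: "(\<Sum>i\<le>n. a' i * x ^ i) = 0" using Suc(3) by simp
      have bx: "b * x ^ n = ?c * x ^ Suc n" by (simp add: b_def)
      have 2: "a' i \<in> A \<and> a' i * x ^ i \<in> U \<delta>" if "i \<le> n" for i
      proof (cases "i = n")
        case True
        have "a n * x ^ n + ?c * x ^ Suc n \<in> U \<delta>" using Suc(2)[of n] Suc(2)[of "Suc n"] by (intro U_add) auto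
        then show ?thesis using True bA Suc(2)[of n] A1(3) by (simp add: a'_def distrib_right bx)
      next
        case False
        then show ?thesis using Suc(2)[of i] that by (simp add: a'_def)
      qed
      have j: "j \<le> n" using Suc(4,5) cm by (cases "j = Suc n") auto
      have "a' j \<notin> m"
      proof
        assume *: "a' j \<in> m"
        show False
        proof (cases "j = n")
          case True
          then have "a j = a' j - b" by (simp add: a'_def)
          then show False using m(3)[OF * bm] Suc(5) by simp
        next
          case False
          then show False using * Suc(5) by (simp add: a'_def)
        qed
      qed
      from Suc(1)[OF 2 1 j this] show ?thesis .
    qed
  qed
qed

lemma sum_even_odd:
  fixes f :: "nat \<Rightarrow> 'b::comm_monoid_add"
  shows "(\<Sum>k\<le>2 * d + 1. f k) = (\<Sum>i\<le>d. f (2 * i)) + (\<Sum>i\<le>d. f (2 * i + 1))"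
  by (induction d) (auto simp: ac_simps)

text \<open>The square is what makes this work: \<open>x\<close> is integral over A[x^2], hence a
  polynomial in x^2, and in the resulting relation the only odd term is -x. Its coefficient -1 is
  outside \<open>m\<close>, whatever the even coefficients are.\<close>

lemma valuation_lemma:
  assumes A: "subring A" "homog A"
    and int: "\<And>T. subring T \<Longrightarrow> homog T \<Longrightarrow> A \<subseteq> T \<Longrightarrow> integrally_closed T"
    and m: "0 \<in> m" "1 \<notin> m" "m \<subseteq> A" "\<And>a b. a \<in> m \<Longrightarrow> b \<in> m \<Longrightarrow> a - b \<in> m"
    and unit: "\<And>a \<alpha>. a \<in> A \<Longrightarrow> a \<in> U \<alpha> \<Longrightarrow> a \<notin> m \<Longrightarrow> a \<noteq> 0 \<and> inverse a \<in> A"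
    and x: "x \<in> U \<alpha>" "x \<noteq> 0"
  shows "x \<in> A \<or> inverse x \<in> A"
proof -
  note A1 = subringD[OF A(1)]
  let ?M = "range (\<lambda>i. (x ^ 2) ^ i)"
  let ?T = "prodm A ?M"
  have 1: "1 \<in> ?M" using rangeI[of "\<lambda>i. (x ^ 2) ^ i" 0] by simp
  have T: "subring ?T"
  proof (rule subring_span_monoid[OF A(1) 1])
    fix y z assume "y \<in> ?M" "z \<in> ?M"
    then obtain i j where "y = (x ^ 2) ^ i" "z = (x ^ 2) ^ j" by auto
    then have "y * z = (x ^ 2) ^ (i + j)" by (simp only: power_add)
    then show "y * z \<in> ?M" by auto
  qed
  have Mhom: "\<exists>\<beta>. y \<in> U \<beta>" if "y \<in> ?M" for y
    using that U_power[OF x(1)] by (auto simp flip: power_mult)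
  have "integrally_closed ?T"
    by (rule int[OF T homog_span[OF A(2) A1(1) Mhom] span_subset_ring[OF 1 A(1)]])
  moreover have x2T: "- (x ^ 2) \<in> ?T"
  proof -
    have "(x ^ 2) ^ 1 \<in> ?M" by (rule rangeI)
    then have "x ^ 2 \<in> ?T" using span_base[OF A(1)] by simp
    then show ?thesis by (rule subringD(5)[OF T])
  qed
  moreover have "x ^ 2 + (\<Sum>i<2. (if i = 0 then - (x ^ 2) else 0) * x ^ i) = 0"
    by (simp add: numeral_2_eq_2)
  ultimately have xT: "x \<in> ?T"
    unfolding integrally_closed_def using subringD(1)[OF T]
    by (elim allE[of _ x]) (erule mp, rule exI[of _ 2], rule exI[of _ "\<lambda>i. if i = 0 then - (x ^ 2) else 0"], simp)
  have "?T \<subseteq> {y. \<exists>p. (\<forall>i. coeff p i \<in> A) \<and> y = poly p (x ^ 2)}"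
  proof (rule prodm_least)
    show "0 \<in> {y. \<exists>p. (\<forall>i. coeff p i \<in> A) \<and> y = poly p (x ^ 2)}"
      using A1 by (auto intro!: exI[of _ 0])
    fix y z assume "y \<in> {y. \<exists>p. (\<forall>i. coeff p i \<in> A) \<and> y = poly p (x ^ 2)}"
      "z \<in> {y. \<exists>p. (\<forall>i. coeff p i \<in> A) \<and> y = poly p (x ^ 2)}"
    then obtain p q where "\<forall>i. coeff p i \<in> A" "y = poly p (x ^ 2)" "\<forall>i. coeff q i \<in> A" "z = poly q (x ^ 2)" by auto
    then show "y + z \<in> {y. \<exists>p. (\<forall>i. coeff p i \<in> A) \<and> y = poly p (x ^ 2)}"
      using A1(3) by (intro CollectI exI[of _ "p + q"]) auto
  next
    fix a y assume "a \<in> A" "y \<in> ?M"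
    then obtain i where a: "a \<in> A" "y = (x ^ 2) ^ i" by auto
    then show "a * y \<in> {y. \<exists>p. (\<forall>i. coeff p i \<in> A) \<and> y = poly p (x ^ 2)}"
      using A1(1) by (intro CollectI exI[of _ "monom a i"]) (auto simp: poly_monom)
  qed
  then obtain p where p: "\<And>i. coeff p i \<in> A" "x = poly p (x ^ 2)" using xT by blast
  let ?d = "degree p"
  have "\<forall>i. \<exists>\<beta>. (x ^ 2) ^ i \<in> U \<beta>" using Mhom by blast
  then obtain \<beta> where \<beta>: "\<And>i. (x ^ 2) ^ i \<in> U (\<beta> i)" by metis
  \<comment> \<open>Only the part of x = p(x^2) in the degree of \<open>x\<close> is kept; it makes
    all terms homogeneous of the same degree.\<close>
  define e where "e i = comp (coeff p i) (\<alpha> - \<beta> i)" for i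
  have pt: "coeff p i \<in> tot" for i using p(1) A(2) unfolding homog_def by blast
  have eA: "e i \<in> A" for i using p(1) A(2) unfolding homog_def e_def by blast
  have eU: "e i * (x ^ 2) ^ i \<in> U \<alpha>" for i
    using U_mult[OF comp_spec(2)[OF pt, of i "\<alpha> - \<beta> i"] \<beta>[of i]] by (simp add: e_def)
  have cc: "(x ^ 2) ^ i * coeff p i \<in> tot" "comp ((x ^ 2) ^ i * coeff p i) \<alpha> = (x ^ 2) ^ i * e i" for i
    using comp_hmult[OF \<beta>[of i] pt[of i]] by (simp_all add: e_def)
  have xs: "x = (\<Sum>i\<le>?d. (x ^ 2) ^ i * coeff p i)"
    using p(2) by (simp add: poly_altdef mult.commute)
  have "x = comp x \<alpha>" using comp_hom(2)[OF x(1)] by simp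
  also have "\<dots> = comp (\<Sum>i\<le>?d. (x ^ 2) ^ i * coeff p i) \<alpha>" by (rule arg_cong[OF xs])
  also have "\<dots> = (\<Sum>i\<le>?d. (x ^ 2) ^ i * e i)"
    using comp_sum[of "{..?d}" "\<lambda>i. (x ^ 2) ^ i * coeff p i" \<alpha>] cc by simp
  also have "\<dots> = (\<Sum>i\<le>?d. e i * x ^ (2 * i))"
    unfolding power_mult by (rule sum.cong) (auto intro: mult.commute)
  finally have xe: "(\<Sum>i\<le>?d. e i * x ^ (2 * i)) = x" ..
  \<comment> \<open>The coefficients of p(x^2) - x as a polynomial in \<open>x\<close>.\<close>
  define a where "a k = (if even k then e (k div 2) else if k = 1 then - 1 else 0)" for k :: nat
  have "(\<Sum>i\<le>?d. a (2 * i + 1) * x ^ (2 * i + 1)) = (\<Sum>i\<le>?d. if i = 0 then - x else 0)"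
    by (rule sum.cong) (auto simp: a_def)
  also have "\<dots> = - x" by simp
  finally have rel: "(\<Sum>k\<le>2 * ?d + 1. a k * x ^ k) = 0"
    unfolding sum_even_odd using xe by (simp add: a_def)
  have coeffs: "a k \<in> A \<and> a k * x ^ k \<in> U \<alpha>" for k
  proof (cases "even k")
    case True
    then obtain i where "k = 2 * i" by auto
    then show ?thesis using eA eU[of i] by (simp add: a_def power_mult)
  next
    case False
    then show ?thesis using A1 x(1) U_0 U_minus[OF x(1)] by (auto simp: a_def)
  qed
  have a1: "a 1 \<notin> m"
  proof
    assume "a 1 \<in> m"
    then have "0 - a 1 \<in> m" by (rule m(4)[OF m(1)])
    then show False using m(2) by (simp add: a_def)
  qed
  show ?thesis
    by (rule unit_coefficient_lemma[OF A(1) int[OF A subset_refl] m(1,3,4) unit x coeffs rel le_add2 a1])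
qed

end

section \<open>Maximal homogeneous ideals for the star operation and the localization at one of
  them\<close>

context graded_star
begin

text \<open>Let F be generated by the products of the generators. For a generator b of F2, 1 in the
  closure of F1 gives b in the closure of b F1, hence in that of F. So F2 lies in the closure of F,
  and with it 1.\<close>

lemma has_unit_product:
  assumes "F1 \<noteq> {0}" "fg R F1" "1 \<in> st F1" "F2 \<noteq> {0}" "fg R F2" "1 \<in> st F2"
    "\<And>a b. a \<in> F1 \<Longrightarrow> b \<in> F2 \<Longrightarrow> a * b \<in> Q" "submod R Q"
  shows "has_unit Q"
proof -
  obtain S1 S2 where S: "finite S1" "F1 = prodm R S1" "finite S2" "F2 = prodm R S2"
    using assms(2,5) unfolding fg_def by auto
  let ?S = "(\<lambda>(a, b). a * b) ` (S1 \<times> S2)"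
  let ?F = "prodm R ?S"
  have "finite ?S" using S by simp
  then have fgF: "fg R ?F" unfolding fg_def by (intro exI[of _ ?S]) simp
  have base: "s \<in> F1" if "s \<in> S1" for s using span_base[OF R_ring that] S(2) by simp
  have base2: "s \<in> F2" if "s \<in> S2" for s using span_base[OF R_ring that] S(4) by simp
  have FQ: "?F \<subseteq> Q" by (rule span_least[OF assms(8)]) (use base base2 assms(7) in auto)
  have nonzero: "\<exists>s\<in>S. s \<noteq> 0" if "prodm R S \<noteq> {0}" for S
  proof (rule ccontr)
    assume "\<not> ?thesis"
    then have "prodm R S \<subseteq> {0}" by (intro prodm_least) auto
    then show False using that prodm_0[of R S] by auto
  qed
  obtain s1 s2 where s: "s1 \<in> S1" "s1 \<noteq> 0" "s2 \<in> S2" "s2 \<noteq> 0" using nonzero assms(1,4) S by metis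
  have in_S: "a * b \<in> ?F" if "a \<in> S1" "b \<in> S2" for a b
  proof -
    have "(\<lambda>(a, b). a * b) (a, b) \<in> ?S" using that by (intro imageI) simp
    then show ?thesis using span_base[OF R_ring, of "a * b" ?S] by simp
  qed
  have "s1 * s2 \<noteq> 0" using s by simp
  then have F0: "?F \<noteq> {0}" using in_S[OF s(1,3)] by (metis singletonD)
  note nzF = nz_fg[OF fgF F0] and nz1 = nz_fg[OF assms(2,1)] and nz2 = nz_fg[OF assms(5,4)]
  have sF: "submod R ?F" "submod R (st ?F)" using nzF st_nz[OF nzF] unfolding nz_submod_def by auto
  have "b \<in> st ?F" if b: "b \<in> S2" for b
  proof (cases "b = 0")
    case True
    then show ?thesis using submodD(1)[OF sF(2)] by simp
  next
    case False
    let ?E = "(\<lambda>y. b * y) ` F1"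
    have E: "?E \<subseteq> ?F"
    proof clarify
      fix y assume "y \<in> F1"
      then show "b * y \<in> ?F" unfolding S(2)
      proof (rule prodm_mult_closed)
        fix r a assume "r \<in> R" "a \<in> S1"
        then have "r * (a * b) \<in> ?F" using in_S b submodD(3)[OF sF(1)] by blast
        then show "b * (r * a) \<in> ?F" by (simp add: ac_simps)
      qed (use submodD[OF sF(1)] in auto)
    qed
    have F1: "submod R F1" using nz1 unfolding nz_submod_def by simp
    have "submod R ?E" unfolding submod_def
    proof (intro conjI ballI)
      show "0 \<in> ?E" using submodD(1)[OF F1] by force
      show "y + z \<in> ?E" if "y \<in> ?E" "z \<in> ?E" for y z
        using that submodD(2)[OF F1] by (auto simp flip: distrib_left)
      show "r * y \<in> ?E" if "r \<in> R" "y \<in> ?E" for r y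
        using that submodD(3)[OF F1] by (auto simp: mult.left_commute)
    qed
    moreover have "b * s1 \<in> ?E" "b * s1 \<noteq> 0" using base s(1,2) False by auto
    ultimately have nzE: "nz_submod R ?E" unfolding nz_submod_def by (metis singletonD)
    have "b * 1 \<in> (\<lambda>y. b * y) ` st F1" using assms(3) by (rule imageI)
    then have "b \<in> st ?E" using st_scale[OF False nz1] by simp
    then show ?thesis using st_mono[OF nzE nzF E] by blast
  qed
  then have "F2 \<subseteq> st ?F" unfolding S(4) by (intro span_least[OF sF(2)]) blast
  then have "st F2 \<subseteq> st ?F" using st_mono[OF nz2 st_nz[OF nzF]] st_idem[OF nzF] by simp
  then show ?thesis unfolding has_unit_def using FQ F0 fgF assms(6) by blast
qed

text \<open>No closedness under \<open>st\<close> is demanded, as the star closure of a homogeneous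
  ideal need not be homogeneous.\<close>

definition unitless :: "'b set \<Rightarrow> bool" where
  "unitless Q \<longleftrightarrow> submod R Q \<and> Q \<subseteq> R \<and> homog Q \<and> \<not> has_unit Q"

text \<open>Zorn's lemma applies because a finitely generated F inside the union of a chain already
  lies in one member.\<close>

lemma ex_maximal_unitless:
  assumes "unitless J"
  shows "\<exists>P. unitless P \<and> J \<subseteq> P \<and> (\<forall>Q. unitless Q \<longrightarrow> P \<subseteq> Q \<longrightarrow> Q = P)"
proof -
  let ?A = "{Q. unitless Q \<and> J \<subseteq> Q}"
  have "\<exists>P\<in>?A. \<forall>X\<in>?A. P \<subseteq> X \<longrightarrow> X = P"
  proof (rule subset_Zorn_nonempty)
    show "?A \<noteq> {}" using assms by auto
    fix C assume C: "C \<noteq> {}" "subset.chain ?A C"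
    then have CA: "\<And>Q. Q \<in> C \<Longrightarrow> unitless Q \<and> J \<subseteq> Q"
      and lin: "\<And>Q Q'. Q \<in> C \<Longrightarrow> Q' \<in> C \<Longrightarrow> Q \<subseteq> Q' \<or> Q' \<subseteq> Q"
      unfolding subset_chain_def by auto
    have sub: "submod R Q" if "Q \<in> C" for Q using CA[OF that] unfolding unitless_def by simp
    have "submod R (\<Union>C)" unfolding submod_def
    proof (intro conjI ballI)
      show "0 \<in> \<Union>C" using C(1) sub submodD(1) by blast
      show "r * x \<in> \<Union>C" if "r \<in> R" "x \<in> \<Union>C" for r x using that sub submodD(3) by blast
      show "x + y \<in> \<Union>C" if xy: "x \<in> \<Union>C" "y \<in> \<Union>C" for x y
      proof -
        obtain Q Q' where Q: "x \<in> Q" "Q \<in> C" "y \<in> Q'" "Q' \<in> C" using xy by auto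
        then have "(x \<in> Q' \<and> y \<in> Q') \<or> (x \<in> Q \<and> y \<in> Q)" using lin by blast
        then show ?thesis using Q sub submodD(2) by blast
      qed
    qed
    moreover have "\<Union>C \<subseteq> R" "homog (\<Union>C)" using CA unfolding unitless_def homog_def by blast+
    moreover have "\<not> has_unit (\<Union>C)"
    proof
      assume "has_unit (\<Union>C)"
      then obtain F where F: "F \<subseteq> \<Union>C" "F \<noteq> {0}" "fg R F" "1 \<in> st F" unfolding has_unit_def by auto
      obtain S where S: "finite S" "F = prodm R S" using F(3) unfolding fg_def by auto
      have "S \<subseteq> \<Union>C" using F(1) span_base[OF R_ring] S(2) by blast
      then obtain Q where Q: "Q \<in> C" "S \<subseteq> Q"
        using finite_subset_Union_chain[OF S(1) _ C] by auto
      then have "F \<subseteq> Q" unfolding S(2) by (intro span_least sub)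
      then have "has_unit Q" unfolding has_unit_def using F by blast
      then show False using CA[OF Q(1)] unfolding unitless_def by simp
    qed
    ultimately have "unitless (\<Union>C)" unfolding unitless_def by simp
    then show "\<Union>C \<in> ?A" using CA C(1) by blast
  qed
  then obtain P where P: "unitless P" "J \<subseteq> P" "\<And>X. unitless X \<Longrightarrow> J \<subseteq> X \<Longrightarrow> P \<subseteq> X \<Longrightarrow> X = P" by auto
  then have "\<forall>Q. unitless Q \<longrightarrow> P \<subseteq> Q \<longrightarrow> Q = P" using subset_trans by blast
  then show ?thesis using P by blast
qed

text \<open>As \<open>a\<close> is homogeneous, P + a R is a homogeneous ideal; it is strictly
  larger than P, so maximality leaves only this way of failing to be
  \<open>unitless\<close>.\<close>

lemma maximal_unitless_adjoin:
  assumes P: "unitless P" "\<And>Q. unitless Q \<Longrightarrow> P \<subseteq> Q \<Longrightarrow> Q = P"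
    and a: "a \<in> R" "a \<in> U \<alpha>" "a \<notin> P"
  shows "has_unit {p + a * r | p r. p \<in> P \<and> r \<in> R}"
proof (rule ccontr)
  let ?Q = "{p + a * r | p r. p \<in> P \<and> r \<in> R}"
  assume n: "\<not> has_unit ?Q"
  have P1: "submod R P" "P \<subseteq> R" "homog P" using P(1) unfolding unitless_def by auto
  note P2 = submodD[OF P1(1)] and R1 = subringD[OF R_ring]
  have QI: "p + a * r \<in> ?Q" if "p \<in> P" "r \<in> R" for p r using that by blast
  have PQ: "P \<subseteq> ?Q"
  proof
    fix p assume "p \<in> P"
    then show "p \<in> ?Q" using QI[of p 0] R1 by simp
  qed
  have "submod R ?Q" unfolding submod_def
  proof (intro conjI ballI)
    show "0 \<in> ?Q" using PQ P2(1) by blast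
    fix x y assume "x \<in> ?Q" "y \<in> ?Q"
    then obtain p r q s where *: "p \<in> P" "r \<in> R" "q \<in> P" "s \<in> R" "x = p + a * r" "y = q + a * s" by blast
    have "x + y = (p + q) + a * (r + s)" using * by (simp add: algebra_simps)
    then show "x + y \<in> ?Q" using QI[OF P2(2)[OF *(1,3)] R1(3)[OF *(2,4)]] by simp
  next
    fix t x assume t: "t \<in> R" and "x \<in> ?Q"
    then obtain p r where *: "p \<in> P" "r \<in> R" "x = p + a * r" by blast
    have "t * x = t * p + a * (t * r)" using * by (simp add: algebra_simps)
    then show "t * x \<in> ?Q" using QI[OF P2(3)[OF t *(1)] R1(4)[OF t *(2)]] by simp
  qed
  moreover have "?Q \<subseteq> R" using P1(2) a(1) R1 by blast
  moreover have "homog ?Q" unfolding homog_def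
  proof
    fix x assume "x \<in> ?Q"
    then obtain p r where *: "p \<in> P" "r \<in> R" "x = p + a * r" by blast
    have pr: "p \<in> tot" "r \<in> tot" "\<And>\<beta>. comp p \<beta> \<in> P" "\<And>\<beta>. comp r \<beta> \<in> R"
      using *(1,2) P1(3) homog_R unfolding homog_def by auto
    note ar = comp_hmult[OF a(2) pr(2)]
    have "comp x \<beta> = comp p \<beta> + a * comp r (\<beta> - \<alpha>)" for \<beta>
      unfolding *(3) comp_add(2)[OF pr(1) ar(1)] ar(2) ..
    then show "x \<in> tot \<and> (\<forall>\<beta>. comp x \<beta> \<in> ?Q)"
      using comp_add(1)[OF pr(1) ar(1)] *(3) QI[OF pr(3,4)] by simp
  qed
  ultimately have "unitless ?Q" using n unfolding unitless_def by blast
  then have "?Q = P" using P(2) PQ by blast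
  then show False using QI[OF P2(1) R1(2)] a(3) by simp
qed

text \<open>If a b were in P, then (P + a R) (P + b R) would lie in P, and
  \<open>has_unit_product\<close> would give P a unit.\<close>

lemma maximal_unitless_prime:
  assumes P: "unitless P" "\<And>Q. unitless Q \<Longrightarrow> P \<subseteq> Q \<Longrightarrow> Q = P"
    and a: "a \<in> R" "a \<in> U \<alpha>" "a \<notin> P" and b: "b \<in> R" "b \<in> U \<beta>" "b \<notin> P"
  shows "a * b \<notin> P"
proof
  assume ab: "a * b \<in> P"
  have P1: "submod R P" "P \<subseteq> R" using P(1) unfolding unitless_def by auto
  obtain F1 where F1: "F1 \<subseteq> {p + a * r | p r. p \<in> P \<and> r \<in> R}" "F1 \<noteq> {0}" "fg R F1" "1 \<in> st F1"
    using maximal_unitless_adjoin[OF P a] unfolding has_unit_def by auto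
  obtain F2 where F2: "F2 \<subseteq> {p + b * r | p r. p \<in> P \<and> r \<in> R}" "F2 \<noteq> {0}" "fg R F2" "1 \<in> st F2"
    using maximal_unitless_adjoin[OF P b] unfolding has_unit_def by auto
  have "x * y \<in> P" if x: "x \<in> F1" and y: "y \<in> F2" for x y
  proof -
    obtain p r where x: "x = p + a * r" "p \<in> P" "r \<in> R" using x F1(1) by blast
    obtain q s where y: "y = q + b * s" "q \<in> P" "s \<in> R" using y F2(1) by blast
    note R1 = subringD[OF R_ring] and P2 = submodD[OF P1(1)]
    have "y \<in> R" "a * r \<in> R" "r * s \<in> R" using y x a b P1(2) R1 by auto
    then have "y * p \<in> P" "(a * r) * q \<in> P" "(r * s) * (a * b) \<in> P"
      using P2(3) x(2) y(2) ab by blast+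
    then have "y * p + (a * r) * q + (r * s) * (a * b) \<in> P" by (intro P2(2))
    moreover have "x * y = y * p + (a * r) * q + (r * s) * (a * b)" unfolding x(1) y(1) by (simp add: algebra_simps)
    ultimately show ?thesis by simp
  qed
  then have "has_unit P" by (rule has_unit_product[OF F1(2-4) F2(2-4) _ P1(1)])
  then show False using P(1) unfolding unitless_def by simp
qed

lemma d_linked_integrally_closed_GPstarMD:
  assumes int: "\<And>T. hlinked \<Gamma> G R st T (d_op T) \<Longrightarrow> integrally_closed T"
  shows "GPstarMD \<Gamma> G R st"
  unfolding GPstarMD_def
proof (intro allI impI)
  note R1 = subringD[OF R_ring]
  fix I assume I: "ideal_of R I \<and> I \<noteq> {0} \<and> fg R I \<and> decomp \<Gamma> G I"
  then have I1: "submod R I" "I \<subseteq> R" unfolding ideal_of_def by auto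
  have hI: "homog I" using I decomp_R_iff[OF I1(2) submodD(1)[OF I1(1)]] by simp
  obtain S where S: "finite S" "I = prodm R S" using I unfolding fg_def by auto
  from homog_generators[OF R_ring hI S(2,1)] I obtain C where
    C: "finite C" "C \<noteq> {}" "\<forall>c\<in>C. c \<noteq> 0 \<and> (\<exists>\<alpha>. c \<in> U \<alpha>)" "C \<subseteq> I" "I = prodm R C" by auto
  let ?J = "prodm I (colon R I)"
  obtain c where c: "c \<in> C" "c \<in> I" "c \<noteq> 0" using C by blast
  have JR: "?J \<subseteq> R" by (rule prodm_colon_subset[OF R_ring])
  have hJ: "homog ?J" by (rule homog_prodm[OF hI homog_colon[OF homog_R R_ring hI c(2,3)]])
  have sJ: "submod R ?J" by (rule submod_prodm[OF I1(1)])
  show "star_f_inv R st I"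
  proof (rule ccontr)
    assume "\<not> star_f_inv R st I"
    then have "unitless ?J" using JR hJ sJ unfolding unitless_def star_f_inv_iff by simp
    from ex_maximal_unitless[OF this] obtain P where
      P: "unitless P" "?J \<subseteq> P" "\<And>Q. unitless Q \<Longrightarrow> P \<subseteq> Q \<Longrightarrow> Q = P" by auto
    have P1: "submod R P" "P \<subseteq> R" "homog P" "\<not> has_unit P" using P(1) unfolding unitless_def by auto
    note P2 = submodD[OF P1(1)]
    \<comment> \<open>Only homogeneous elements become denominators, which keeps the localization
      homogeneous.\<close>
    define N where "N = {s \<in> R. s \<noteq> 0 \<and> (\<exists>\<alpha>. s \<in> U \<alpha>) \<and> s \<notin> P}"
    have "1 \<notin> P"
    proof
      assume "1 \<in> P"
      then have "R \<subseteq> P" using P2(3)[of _ 1] by auto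
      moreover have "R = prodm R {1}"
        using span_subset_ring[of "{1}" R, OF _ R_ring] span_least[OF subring_submod[OF R_ring], of "{1}"] R1 by auto
      then have "fg R R" unfolding fg_def by blast
      moreover have "1 \<in> st R" using st_ext[OF nz_R] R1 by blast
      ultimately have "has_unit P" unfolding has_unit_def using nz_R unfolding nz_submod_def by blast
      then show False using P1(4) by simp
    qed
    then have N1: "1 \<in> N" using R1 U_1 unfolding N_def by auto
    have N_mult: "s * t \<in> N" if st: "s \<in> N" "t \<in> N" for s t
    proof -
      obtain \<alpha> \<beta> where *: "s \<in> R" "s \<in> U \<alpha>" "s \<notin> P" "s \<noteq> 0" "t \<in> R" "t \<in> U \<beta>" "t \<notin> P" "t \<noteq> 0"
        using st unfolding N_def by auto
      have "s * t \<notin> P" by (rule maximal_unitless_prime[OF P(1,3) *(1-3) *(5-7)])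
      then show ?thesis unfolding N_def using R1(4)[OF *(1,5)] U_mult[OF *(2,6)] *(4,8) by auto
    qed
    let ?M = "inverse ` N"
    define A where "A = prodm R ?M"
    have M1: "1 \<in> ?M" using imageI[OF N1, of inverse] by simp
    have A: "subring A" unfolding A_def
    proof (rule subring_span_monoid[OF R_ring M1])
      fix x y assume "x \<in> ?M" "y \<in> ?M"
      then obtain s t where "s \<in> N" "t \<in> N" "x = inverse s" "y = inverse t" by auto
      then show "x * y \<in> ?M" using imageI[OF N_mult[of s t], of inverse] by simp
    qed
    have hA: "homog A" unfolding A_def
      by (rule homog_span[OF homog_R R1(1)]) (use U_inverse in \<open>auto simp: N_def\<close>)
    have RA: "R \<subseteq> A" unfolding A_def by (rule span_subset_ring[OF M1 R_ring])
    have MA: "inverse s \<in> A" if "s \<in> N" for s unfolding A_def by (rule span_base[OF R_ring imageI[OF that]])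
    note A1 = subringD[OF A]
    have linked: "integrally_closed T" if T: "subring T" "homog T" "A \<subseteq> T" for T
    proof (rule int)
      note T1 = subringD[OF T(1)]
      have "prodm F T = T" if F: "ideal_of R F" "F \<noteq> {0}" "fg R F" "decomp \<Gamma> G F" "st F = st R" for F
      proof -
        have FR: "F \<subseteq> R" "submod R F" using F(1) unfolding ideal_of_def by auto
        \<comment> \<open>P contains no such F, so some homogeneous component of an element of F
          lies outside P. It is inverted in A, hence F T contains 1.\<close>
        have "1 \<in> st F" using st_eq_R_iff[OF nz_fg[OF F(3,2)] FR(1)] F(5) by simp
        then have "\<not> F \<subseteq> P" using P1(4) F(2,3) unfolding has_unit_def by blast
        then obtain x where x: "x \<in> F" "x \<notin> P" by auto
        have "homog F" using decomp_R_iff[OF FR(1) submodD(1)[OF FR(2)]] F(4) by simp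
        then have xF: "x \<in> tot" "\<And>\<alpha>. comp x \<alpha> \<in> F" using x(1) unfolding homog_def by auto
        have "\<exists>\<alpha>. comp x \<alpha> \<notin> P"
        proof (rule ccontr)
          assume "\<not> ?thesis"
          then have "(\<Sum>\<alpha>\<in>supp x. comp x \<alpha>) \<in> P" by (intro sum_closed P2(1,2)) auto
          then show False using comp_spec(3)[OF xF(1)] x(2) by simp
        qed
        then obtain \<alpha> where \<alpha>: "comp x \<alpha> \<notin> P" by auto
        then have n0: "comp x \<alpha> \<noteq> 0" using P2(1) by auto
        then have "comp x \<alpha> \<in> N"
          unfolding N_def using \<alpha> xF(2) FR(1) comp_spec(2)[OF xF(1)] by blast
        then have "comp x \<alpha> * inverse (comp x \<alpha>) \<in> prodm F T"
          by (intro prodm_mem xF(2)) (use MA T(3) in blast)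
        then have 1: "1 \<in> prodm F T" using n0 by simp
        have sFT: "submod T (prodm F T)"
          unfolding prodm_commute[of F T] by (rule submod_span[OF T(1)])
        have "T \<subseteq> prodm F T"
        proof
          fix t assume "t \<in> T"
          from submodD(3)[OF sFT this 1] show "t \<in> prodm F T" by simp
        qed
        moreover have "prodm F T \<subseteq> T"
          by (rule prodm_least[OF T1(1,3)]) (use T1(4) FR(1) RA T(3) in blast)+
        ultimately show ?thesis by blast
      qed
      then show "hlinked \<Gamma> G R st T (d_op T)"
        unfolding hlinked_def hom_overring_iff d_op_def using T RA by auto
    qed
    have den: "\<exists>s\<in>N. s * x \<in> R" if "x \<in> A" for x
    proof -
      have "A \<subseteq> {x. \<exists>s\<in>N. s * x \<in> R}" unfolding A_def
      proof (rule prodm_least)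
        show "0 \<in> {x. \<exists>s\<in>N. s * x \<in> R}" using N1 R1 by auto
        fix x y assume "x \<in> {x. \<exists>s\<in>N. s * x \<in> R}" "y \<in> {x. \<exists>s\<in>N. s * x \<in> R}"
        then obtain s t where *: "s \<in> N" "s * x \<in> R" "t \<in> N" "t * y \<in> R" by auto
        have "s * t * (x + y) = t * (s * x) + s * (t * y)" by (simp add: algebra_simps)
        moreover have "s \<in> R" "t \<in> R" using * unfolding N_def by auto
        ultimately have "s * t * (x + y) \<in> R" using * R1 by simp
        then show "x + y \<in> {x. \<exists>s\<in>N. s * x \<in> R}" using N_mult[OF *(1,3)] by blast
      next
        fix a b assume "a \<in> R" "b \<in> ?M"
        then obtain s where "s \<in> N" "b = inverse s" by auto
        then have "s * (a * b) = a" unfolding N_def by auto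
        then have "s * (a * b) \<in> R" using \<open>a \<in> R\<close> by metis
        then show "a * b \<in> {x. \<exists>s\<in>N. s * x \<in> R}" using \<open>s \<in> N\<close> by blast
      qed
      then show ?thesis using that by blast
    qed
    \<comment> \<open>The extension of P to A. It need not be a maximal ideal, but the homogeneous
      elements of A outside it are units, which is all that the valuation argument asks of
      it.\<close>
    define m where "m = {a \<in> A. \<exists>s\<in>N. s * a \<in> P}"
    have m_diff: "a - b \<in> m" if ab: "a \<in> m" "b \<in> m" for a b
    proof -
      obtain s t where *: "a \<in> A" "s \<in> N" "s * a \<in> P" "b \<in> A" "t \<in> N" "t * b \<in> P"
        using ab unfolding m_def by auto
      then have st: "t \<in> R" "- s \<in> R" unfolding N_def using R1 by auto
      have "t * (s * a) + (- s) * (t * b) \<in> P" using P2(2)[OF P2(3)[OF st(1) *(3)] P2(3)[OF st(2) *(6)]] .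
      then have "s * t * (a - b) \<in> P" by (simp add: algebra_simps)
      then show ?thesis unfolding m_def using N_mult[OF *(2,5)] A1(6)[OF *(1,4)] by blast
    qed
    have m_unit: "a \<noteq> 0 \<and> inverse a \<in> A" if a: "a \<in> A" "a \<in> U \<alpha>" "a \<notin> m" for a \<alpha>
    proof -
      obtain s where s: "s \<in> N" "s * a \<in> R" using den[OF a(1)] by auto
      have sa: "s * a \<notin> P" using a(1,3) s(1) unfolding m_def by auto
      then have sa0: "s * a \<noteq> 0" using P2(1) by auto
      obtain \<beta> where "s \<in> U \<beta>" "s \<in> R" using s(1) unfolding N_def by auto
      then have "s * a \<in> N" unfolding N_def using s(2) sa sa0 U_mult[OF _ a(2)] by blast
      then have "s * inverse (s * a) \<in> A" using MA RA \<open>s \<in> R\<close> A1(4) by blast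
      moreover have "s * inverse (s * a) = inverse a" using sa0 by (simp flip: mult.assoc)
      ultimately have "inverse a \<in> A" by metis
      then show ?thesis using sa0 by simp
    qed
    have m0: "0 \<in> m" unfolding m_def using A1(1) N1 P2(1) by auto
    have m1: "1 \<notin> m" unfolding m_def N_def by auto
    have mA: "m \<subseteq> A" unfolding m_def by auto
    have val: "x \<in> A \<or> inverse x \<in> A" if "x \<in> U \<alpha>" "x \<noteq> 0" for x \<alpha>
      by (rule valuation_lemma[OF A hA linked m0 m1 mA m_diff m_unit that])
    \<comment> \<open>Divisibility in A is total on nonzero homogeneous elements, so one of the
      generators divides all the others.\<close>
    have "\<exists>c\<in>C. \<forall>c'\<in>C. c' * inverse c \<in> A" using C(1,2,3)
    proof (induction C rule: finite_ne_induct)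
      case (singleton c)
      then show ?case using A1(2) by simp
    next
      case (insert d C)
      then obtain c where c: "c \<in> C" "\<forall>c'\<in>C. c' * inverse c \<in> A" by auto
      obtain \<alpha> \<beta> where *: "c \<in> U \<alpha>" "c \<noteq> 0" "d \<in> U \<beta>" "d \<noteq> 0" using insert.prems c(1) by auto
      have "d * inverse c \<in> A \<or> inverse (d * inverse c) \<in> A"
        by (rule val[OF U_mult[OF *(3) U_inverse[OF *(1)]]]) (use * in simp)
      then show ?case
      proof
        assume "d * inverse c \<in> A"
        then show ?thesis using c by auto
      next
        assume "inverse (d * inverse c) \<in> A"
        then have cd: "c * inverse d \<in> A" by (simp add: mult.commute)
        have "c' * inverse d \<in> A" if "c' \<in> C" for c'
        proof -
          have "(c' * inverse c) * (c * inverse d) \<in> A" using c(2) cd that A1(4) by blast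
          then show ?thesis using *(2) by (simp add: mult.assoc) (simp flip: mult.assoc)
        qed
        then show ?thesis using *(4) A1(2) by auto
      qed
    qed
    then obtain e where e: "e \<in> C" "\<And>c'. c' \<in> C \<Longrightarrow> c' * inverse e \<in> A" by auto
    have "\<exists>s\<in>N. \<forall>x\<in>X. s * x \<in> R" if "finite X" "X \<subseteq> A" for X
      using that
    proof (induction X)
      case empty
      then show ?case using N1 by auto
    next
      case (insert x X)
      then obtain s t where *: "s \<in> N" "\<forall>x\<in>X. s * x \<in> R" "t \<in> N" "t * x \<in> R" using den[of x] by auto
      then have "s \<in> R" "t \<in> R" unfolding N_def by auto
      then have "t * (s * y) \<in> R" if "y \<in> X" for y using *(2) that R1(4) by blast
      moreover have "s * (t * x) \<in> R" using \<open>s \<in> R\<close> *(4) R1(4) by blast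
      ultimately have "\<forall>y\<in>insert x X. s * t * y \<in> R" by (auto simp: ac_simps)
      then show ?case using N_mult[OF *(1,3)] by blast
    qed
    from this[of "(\<lambda>c'. c' * inverse e) ` C"] obtain s where
      s: "s \<in> N" "\<And>c'. c' \<in> C \<Longrightarrow> s * (c' * inverse e) \<in> R" using C(1) e(2) by auto
    \<comment> \<open>The common denominator turns the inverse of \<open>e\<close>, which multiplies
      I into A, into an element of (R : I). Multiplying back by \<open>e\<close> shows that
      \<open>s\<close> itself lies in I (R : I), hence in P.\<close>
    have "s * inverse e \<in> colon R C" unfolding colon_def using s(2) by (auto simp: ac_simps)
    then have "s * inverse e \<in> colon R I" unfolding C(5) colon_span[OF R_ring] .
    then have "e * (s * inverse e) \<in> ?J" using e(1) C(4) by (intro prodm_mem) auto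
    moreover have "e \<noteq> 0" using C(3) e(1) by auto
    then have "e * (s * inverse e) = s" by simp
    ultimately have "s \<in> P" using P(2) by auto
    then show False using s(1) unfolding N_def by simp
  qed
qed

end

theorem theorem3p7:
  fixes \<Gamma> :: "'g::ab_group_add set" and G :: "'g \<Rightarrow> 'k::field set" and R :: "'k set"
    and st :: "'k set \<Rightarrow> 'k set"
  assumes "graded_domain \<Gamma> G R"
    and "semistar R st"
    and "st R \<subset> RH \<Gamma> G R"
  shows "(GPstarMD \<Gamma> G R st \<longleftrightarrow> (\<forall>T. hlinked \<Gamma> G R st T (t_op T) \<longrightarrow> PvMD T))
    \<and> (GPstarMD \<Gamma> G R st \<longleftrightarrow> (\<forall>T. hlinked \<Gamma> G R st T (d_op T) \<longrightarrow> graded_Prufer \<Gamma> G T))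
    \<and> (GPstarMD \<Gamma> G R st \<longleftrightarrow> (\<forall>T. hlinked \<Gamma> G R st T (t_op T) \<longrightarrow> integrally_closed T))
    \<and> (GPstarMD \<Gamma> G R st \<longleftrightarrow> (\<forall>T. hlinked \<Gamma> G R st T (d_op T) \<longrightarrow> integrally_closed T))"
proof -
  interpret graded_star \<Gamma> G R st by unfold_locales (rule assms(1,2))+
  have overring: "subring T \<and> R \<subseteq> T \<and> homog T" if "hlinked \<Gamma> G R st T st'" for T st'
    using that unfolding hlinked_def hom_overring_iff by simp
  have 12: "PvMD T" if "GPstarMD \<Gamma> G R st" "hlinked \<Gamma> G R st T (t_op T)" for T
    using GPstarMD_t_linked_PvMD that .
  have 13: "graded_Prufer \<Gamma> G T" if "GPstarMD \<Gamma> G R st" "hlinked \<Gamma> G R st T (d_op T)" for T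
    using GPstarMD_d_linked_graded_Prufer that .
  have 24: "integrally_closed T" if "PvMD T" "hlinked \<Gamma> G R st T st'" for T st'
    using overring_PvMD_integrally_closed[of T] overring[OF that(2)] that(1) by simp
  have 35: "integrally_closed T" if "graded_Prufer \<Gamma> G T" "hlinked \<Gamma> G R st T (d_op T)" for T
    using 24[OF _ that(2)] graded_Prufer_PvMD[of T] overring[OF that(2)] that(1) by simp
  note 51 = d_linked_integrally_closed_GPstarMD
  \<comment> \<open>The implications close two cycles, (1) (2) (4) (5) (1) and (1) (3) (5) (1); (4)
    gives (5) because equality F T = T makes every d-linked overring t-linked.\<close>
  show ?thesis
    by (metis 12 13 24 35 51 d_linked_imp_t_linked)
qed

end
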